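(* Let $(M,\nabla,\circ,e,\nabla^*,*,E)$ be a bi-flat F-manifold and let $L=E\circ$. Then the sheaf morphisms $d_\nabla$ and $d_{L\nabla^*}$ determine a differential bicomplex structure on the graded sheaf $\mathcal{T}_M\otimes_{\mathcal{O}_M}\Omega_M^\bullet$ of forms with values in the tangent sheaf (on the locus where $\nabla^*$ is defined); that is, $$d_\nabla^2=0,\qquad d_{L\nabla^*}^2=0,\qquad d_\nabla d_{L\nabla^*}+d_{L\nabla^*}d_\nabla=0 .$$
   Context: Conventions: $M$ is a smooth, real analytic or complex manifold, $\mathcal{T}_M$ its tangent sheaf, $\mathcal{O}_M$ its structure sheaf, $\Omega_M^k$ the sheaf of $k$-forms ($k\ge 0$, $\Omega^0_M=\mathcal{O}_M$); in the complex case everything is holomorphic. $X,Y,Z,W,X_i$ denote arbitrary local sections of $\mathcal{T}_M$. F-manifold $(M,\circ,e)$: $\circ$ is an $\mathcal{O}_M$-bilinear commutative associative product on $\mathcal{T}_M$ with unit a global vector field $e$ ($e\circ X=X$), satisfying $[X\circ Y,W\circ Z]-[X\circ Y,Z]\circ W-[X\circ Y,W]\circ Z-X\circ[Y,Z\circ W]+X\circ[Y,Z]\circ W+X\circ[Y,W]\circ Z-Y\circ[X,Z\circ W]+Y\circ[X,Z]\circ W+Y\circ[X,W]\circ Z=0$. Flat F-manifold $(M,\nabla,\circ,e)$: an F-manifold with a connection $\nabla$ on $\mathcal{T}_M$ such that for every constant $\lambda$ the connection $(X,Y)\mapsto \nabla_XY-\lambda X\circ Y$ is flat and torsionless, and $\nabla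 e=0$. Euler vector field of an F-manifold: a global vector field $E$ with $[e,E]=e$ and $\mathcal{L}_E\circ=\circ$, i.e. $[E,X\circ Y]-[E,X]\circ Y-X\circ[E,Y]=X\circ Y$. Bi-flat F-manifold $(M,\nabla,\circ,e,\nabla^*,*,E)$: (i) $(\nabla,\circ,e)$ is a flat F-structure on $M$; (ii) $E$ is an Euler vector field for $(M,\circ,e)$ and the operator $E\circ$ is invertible at generic points, i.e. on an open dense subset $U$; (iii) on $U$, $X*Y=(E\circ)^{-1}(X\circ Y)$; (iv) $(\nabla^*,*,E)$ is a flat F-structure on $U$ (with unit $E$, so $\nabla^*E=0$); (v) $(d_\nabla-d_{\nabla^*})(X\circ)=0$ for all local $X$, i.e. $\nabla_Y(X\circ Z)-\nabla_Z(X\circ Y)=\nabla^*_Y(X\circ Z)-\nabla^*_Z(X\circ Y)$. The connection $\nabla^*$ and the product $*$ are defined only on $U$. Differentials: for a connection $D$ on $\mathcal{T}_M$ and an endomorphism $L$ of $\mathcal{T}_M$, the morphism $d_{LD}:\mathcal{T}_M\otimes\Omega^k_M\to\mathcal{T}_M\otimes\Omega^{k+1}_M$ is $$(d_{LD}\omega)(X_0,\dots,X_k)=\sum_{i=0}^k(-1)^iD_{LX_i}(\omega(X_0,\dots,\hat X_i,\dots,X_k))+\sum_{0\le i<j\le k}(-1)^{i+j}\omega([X_i,X_j]_L,X_0,\dots,\hat X_i,\dots,\hat X_j,\dots,X_k),$$ where $[X,Y]_L=[LX,Y]+[X,LY]-L[X,Y]$; and $d_D$ is the usual exterior covariant derivative,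 i.e. the same formula with $L=I$ (so $[X,Y]_I=[X,Y]$). No bigrading is required in the term "differential bicomplex". *)

theory Defs
  imports "HOL-Analysis.Analysis" "HOL-Library.Function_Algebras"
begin

text \<open>
  The ground field is a type \<open>'k\<close> of sort \<open>{real_normed_field, banach}\<close>; up to isomorphism these
  are exactly the real and the complex numbers.  Together with the two regularity classes below
  this covers smooth manifolds (\<open>'k = real\<close>, \<open>Smooth\<close>), real analytic manifolds (\<open>'k = real\<close>,
  \<open>Analytic\<close>) and complex manifolds (\<open>'k = complex\<close>; both classes then mean holomorphic, since
  derivatives are required to be \<open>'k\<close>-linear).
\<close>

datatype regularity = Smooth | Analytic

primrec Ck_on :: "nat \<Rightarrow> ('k::real_normed_field ^ 'n) set \<Rightarrow> ('k ^ 'n \<Rightarrow> 'k) \<Rightarrow> bool" where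
  "Ck_on 0 S f \<longleftrightarrow> continuous_on S f"
| "Ck_on (Suc k) S f \<longleftrightarrow>
     (\<exists>g. (\<forall>x\<in>S. (f has_derivative (\<lambda>h. \<Sum>i\<in>UNIV. g i x * h $ i)) (at x)) \<and> (\<forall>i. Ck_on k S (g i)))"

definition power_series_on :: "('k::real_normed_field ^ 'n) set \<Rightarrow> ('k ^ 'n \<Rightarrow> 'k) \<Rightarrow> bool" where
  "power_series_on S f \<longleftrightarrow>
     (\<forall>p\<in>S. \<exists>a :: ('n \<Rightarrow> nat) \<Rightarrow> 'k. \<exists>\<epsilon>>0. \<forall>x\<in>ball p \<epsilon>.
        (\<lambda>\<alpha>. norm (a \<alpha> * (\<Prod>i\<in>UNIV. (x $ i - p $ i) ^ \<alpha> i))) summable_on UNIV \<and>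
        ((\<lambda>\<alpha>. a \<alpha> * (\<Prod>i\<in>UNIV. (x $ i - p $ i) ^ \<alpha> i)) has_sum f x) UNIV)"

text \<open>Only meaningful for open \<open>S\<close>.\<close>

definition regular_on ::
  "regularity \<Rightarrow> ('k::real_normed_field ^ 'n) set \<Rightarrow> ('k ^ 'n \<Rightarrow> 'k) \<Rightarrow> bool" where
  "regular_on r S f \<longleftrightarrow>
     (case r of Smooth \<Rightarrow> (\<forall>k. Ck_on k S f) | Analytic \<Rightarrow> power_series_on S f)"


section \<open>Manifolds, functions and vector fields\<close>

text \<open>A chart is a pair of its domain and its coordinate map; the manifold is the whole type \<open>'m\<close>.\<close>

type_synonym ('m, 'k, 'n) chart = "'m set \<times> ('m \<Rightarrow> 'k ^ 'n)"

definition manifold ::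
  "regularity \<Rightarrow> ('m::{second_countable_topology, t2_space}, 'k::{real_normed_field, banach}, 'n::finite) chart set
    \<Rightarrow> bool" where
  "manifold r A \<longleftrightarrow>
     (\<Union>(D, \<phi>)\<in>A. D) = UNIV \<and>
     (\<forall>(D, \<phi>)\<in>A. open D \<and> open (\<phi> ` D) \<and> homeomorphism D (\<phi> ` D) \<phi> (inv_into D \<phi>)) \<and>
     (\<forall>(D, \<phi>)\<in>A. \<forall>(D', \<phi>')\<in>A. \<forall>i. regular_on r (\<phi> ` (D \<inter> D')) (\<lambda>x. \<phi>' (inv_into D \<phi> x) $ i))"

text \<open>
  Sections over an open set \<open>V\<close> are encoded by total functions that vanish outside their proper
  domain, so that equality of sections is HOL equality and the ring and module operations are
  pointwise.
\<close>

definition structure_sheaf ::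
  "regularity \<Rightarrow> ('m::{second_countable_topology, t2_space}, 'k::{real_normed_field, banach}, 'n::finite) chart set
    \<Rightarrow> 'm set \<Rightarrow> ('m \<Rightarrow> 'k) set" where
  "structure_sheaf r A V =
     {f. (\<forall>p. p \<notin> V \<longrightarrow> f p = 0) \<and>
         (\<forall>(D, \<phi>)\<in>A. regular_on r (\<phi> ` (D \<inter> V)) (\<lambda>x. f (inv_into D \<phi> x)))}"

definition res :: "'m set \<Rightarrow> ('m \<Rightarrow> 'k::zero) \<Rightarrow> 'm \<Rightarrow> 'k" where
  "res W f = (\<lambda>p. if p \<in> W then f p else 0)"

text \<open>
  The tangent sheaf is the sheaf of derivations of the structure sheaf \<open>S\<close>: a vector field \<open>X\<close>
  over \<open>V\<close> is a family of \<open>'k\<close>-linear derivations \<open>X W\<close> of \<open>S W\<close>, for \<open>W\<close> open in \<open>V\<close>, compatible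
  with restriction.
\<close>

type_synonym ('m, 'k) vfield = "'m set \<Rightarrow> ('m \<Rightarrow> 'k) \<Rightarrow> ('m \<Rightarrow> 'k)"

definition tangent ::
  "('m::topological_space set \<Rightarrow> ('m \<Rightarrow> 'k::field) set) \<Rightarrow> 'm set \<Rightarrow> ('m, 'k) vfield set" where
  "tangent S V = {X.
     (\<forall>W f. \<not> (open W \<and> W \<subseteq> V \<and> f \<in> S W) \<longrightarrow> X W f = 0) \<and>
     (\<forall>W. open W \<and> W \<subseteq> V \<longrightarrow>
        (\<forall>f\<in>S W. X W f \<in> S W) \<and>
        (\<forall>f\<in>S W. \<forall>g\<in>S W. X W (f + g) = X W f + X W g) \<and>
        (\<forall>c. \<forall>f\<in>S W. X W ((\<lambda>_. c) * f) = (\<lambda>_. c) * X W f) \<and>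
        (\<forall>f\<in>S W. \<forall>g\<in>S W. X W (f * g) = X W f * g + f * X W g) \<and>
        (\<forall>W' f. open W' \<and> W' \<subseteq> W \<and> f \<in> S W \<longrightarrow> X W' (res W' f) = res W' (X W f)))}"

definition vres :: "'m set \<Rightarrow> ('m, 'k::zero) vfield \<Rightarrow> ('m, 'k) vfield" where
  "vres V X = (\<lambda>W f. if W \<subseteq> V then X W f else 0)"

definition fmult :: "('m \<Rightarrow> 'k::times) \<Rightarrow> ('m, 'k) vfield \<Rightarrow> ('m, 'k) vfield"  (infixr \<open>\<cdot>\<close> 75) where
  "f \<cdot> X = (\<lambda>W g. f * X W g)"

definition lie :: "('m, 'k::minus) vfield \<Rightarrow> ('m, 'k) vfield \<Rightarrow> ('m, 'k) vfield" where
  "lie X Y = (\<lambda>W f. X W (Y W f) - Y W (X W f))"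


section \<open>Flat and bi-flat F-manifolds\<close>

text \<open>
  Products and connections on the tangent sheaf are families of binary operations indexed by the
  open set over which the arguments are defined.  In the following, \<open>B\<close> is the open subset of the
  manifold on which a structure lives (\<open>UNIV\<close> for structures on all of it).
\<close>

type_synonym ('m, 'k) vop2 = "'m set \<Rightarrow> ('m, 'k) vfield \<Rightarrow> ('m, 'k) vfield \<Rightarrow> ('m, 'k) vfield"

definition sheaf_op2 ::
  "('m::topological_space set \<Rightarrow> ('m \<Rightarrow> 'k::field) set) \<Rightarrow> 'm set \<Rightarrow> ('m, 'k) vop2 \<Rightarrow> bool" where
  "sheaf_op2 S B m \<longleftrightarrow>
     (\<forall>V. open V \<and> V \<subseteq> B \<longrightarrow> (\<forall>X\<in>tangent S V. \<forall>Y\<in>tangent S V.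
        m V X Y \<in> tangent S V \<and>
        (\<forall>V'. open V' \<and> V' \<subseteq> V \<longrightarrow> m V' (vres V' X) (vres V' Y) = vres V' (m V X Y))))"

definition F_manifold ::
  "('m::topological_space set \<Rightarrow> ('m \<Rightarrow> 'k::field) set) \<Rightarrow> 'm set \<Rightarrow> ('m, 'k) vop2 \<Rightarrow> ('m, 'k) vfield \<Rightarrow> bool"
  where
  "F_manifold S B m e \<longleftrightarrow>
     sheaf_op2 S B m \<and> e \<in> tangent S B \<and>
     (\<forall>V. open V \<and> V \<subseteq> B \<longrightarrow>
       (\<forall>X\<in>tangent S V. \<forall>Y\<in>tangent S V. \<forall>Z\<in>tangent S V.
          m V (X + Y) Z = m V X Z + m V Y Z \<and>
          (\<forall>f\<in>S V. m V (f \<cdot> X) Y = f \<cdot> m V X Y) \<and>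
          m V X Y = m V Y X \<and>
          m V (m V X Y) Z = m V X (m V Y Z)) \<and>
       (\<forall>X\<in>tangent S V. m V (vres V e) X = X) \<and>
       (\<forall>X\<in>tangent S V. \<forall>Y\<in>tangent S V. \<forall>Z\<in>tangent S V. \<forall>W\<in>tangent S V.
          lie (m V X Y) (m V W Z) - m V (lie (m V X Y) Z) W - m V (lie (m V X Y) W) Z
          - m V X (lie Y (m V Z W)) + m V X (m V (lie Y Z) W) + m V X (m V (lie Y W) Z)
          - m V Y (lie X (m V Z W)) + m V Y (m V (lie X Z) W) + m V Y (m V (lie X W) Z) = 0))"

definition connection ::
  "('m::topological_space set \<Rightarrow> ('m \<Rightarrow> 'k::field) set) \<Rightarrow> 'm set \<Rightarrow> ('m, 'k) vop2 \<Rightarrow> bool" where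
  "connection S B D \<longleftrightarrow>
     sheaf_op2 S B D \<and>
     (\<forall>V. open V \<and> V \<subseteq> B \<longrightarrow> (\<forall>X\<in>tangent S V. \<forall>Y\<in>tangent S V.
        (\<forall>Z\<in>tangent S V. D V (X + Y) Z = D V X Z + D V Y Z \<and> D V Z (X + Y) = D V Z X + D V Z Y) \<and>
        (\<forall>f\<in>S V. D V (f \<cdot> X) Y = f \<cdot> D V X Y \<and> D V X (f \<cdot> Y) = X V f \<cdot> Y + f \<cdot> D V X Y)))"

definition flat_torsionless ::
  "('m::topological_space set \<Rightarrow> ('m \<Rightarrow> 'k::field) set) \<Rightarrow> 'm set \<Rightarrow> ('m, 'k) vop2 \<Rightarrow> bool" where
  "flat_torsionless S B D \<longleftrightarrow>
     (\<forall>V. open V \<and> V \<subseteq> B \<longrightarrow> (\<forall>X\<in>tangent S V. \<forall>Y\<in>tangent S V.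
        (\<forall>Z\<in>tangent S V. D V X (D V Y Z) - D V Y (D V X Z) - D V (lie X Y) Z = 0) \<and>
        D V X Y - D V Y X - lie X Y = 0))"

definition flat_F_manifold ::
  "('m::topological_space set \<Rightarrow> ('m \<Rightarrow> 'k::field) set) \<Rightarrow> 'm set
    \<Rightarrow> ('m, 'k) vop2 \<Rightarrow> ('m, 'k) vop2 \<Rightarrow> ('m, 'k) vfield \<Rightarrow> bool" where
  "flat_F_manifold S B D m e \<longleftrightarrow>
     F_manifold S B m e \<and> connection S B D \<and>
     (\<forall>c. flat_torsionless S B (\<lambda>V X Y. D V X Y - (\<lambda>_. c) \<cdot> m V X Y)) \<and>
     (\<forall>V. open V \<and> V \<subseteq> B \<longrightarrow> (\<forall>X\<in>tangent S V. D V X (vres V e) = 0))"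

definition Euler_field ::
  "('m::topological_space set \<Rightarrow> ('m \<Rightarrow> 'k::field) set) \<Rightarrow> 'm set
    \<Rightarrow> ('m, 'k) vop2 \<Rightarrow> ('m, 'k) vfield \<Rightarrow> ('m, 'k) vfield \<Rightarrow> bool" where
  "Euler_field S B m e E \<longleftrightarrow>
     E \<in> tangent S B \<and> lie e E = e \<and>
     (\<forall>V. open V \<and> V \<subseteq> B \<longrightarrow> (\<forall>X\<in>tangent S V. \<forall>Y\<in>tangent S V.
        lie (vres V E) (m V X Y) - m V (lie (vres V E) X) Y - m V X (lie (vres V E) Y) = m V X Y))"

definition mult_by :: "('m, 'k::zero) vop2 \<Rightarrow> ('m, 'k) vfield \<Rightarrow> 'm set \<Rightarrow> ('m, 'k) vfield \<Rightarrow> ('m, 'k) vfield" where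
  "mult_by m E V X = m V (vres V E) X"

text \<open>
  \<open>U\<close> is the open dense locus carrying the second structure \<open>(D', m', E)\<close>; invertibility of the
  operator \<open>mult_by m E\<close> there means that it is an automorphism of the tangent sheaf of \<open>U\<close>.
\<close>

definition bi_flat_F_manifold ::
  "('m::topological_space set \<Rightarrow> ('m \<Rightarrow> 'k::field) set)
    \<Rightarrow> ('m, 'k) vop2 \<Rightarrow> ('m, 'k) vop2 \<Rightarrow> ('m, 'k) vfield
    \<Rightarrow> 'm set \<Rightarrow> ('m, 'k) vop2 \<Rightarrow> ('m, 'k) vop2 \<Rightarrow> ('m, 'k) vfield \<Rightarrow> bool" where
  "bi_flat_F_manifold S D m e U D' m' E \<longleftrightarrow>
     flat_F_manifold S UNIV D m e \<and>
     Euler_field S UNIV m e E \<and>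
     open U \<and> closure U = UNIV \<and>
     (\<forall>V. open V \<and> V \<subseteq> U \<longrightarrow> bij_betw (mult_by m E V) (tangent S V) (tangent S V)) \<and>
     (\<forall>V. open V \<and> V \<subseteq> U \<longrightarrow> (\<forall>X\<in>tangent S V. \<forall>Y\<in>tangent S V.
        m' V X Y = inv_into (tangent S V) (mult_by m E V) (m V X Y))) \<and>
     flat_F_manifold S U D' m' (vres U E) \<and>
     (\<forall>V. open V \<and> V \<subseteq> U \<longrightarrow> (\<forall>X\<in>tangent S V. \<forall>Y\<in>tangent S V. \<forall>Z\<in>tangent S V.
        D V Y (m V X Z) - D V Z (m V X Y) = D' V Y (m V X Z) - D' V Z (m V X Y)))"


section \<open>Forms with values in the tangent sheaf\<close>

text \<open>
  A section over \<open>V\<close> of the tensor product of the tangent sheaf with the sheaf of \<open>k\<close>-forms is an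
  alternating multilinear morphism of sheaves over \<open>V\<close>, from \<open>k\<close> copies of the tangent sheaf to
  the tangent sheaf.  The arguments \<open>X\<^sub>0, \<dots>\<close> are passed as a list of length \<open>k\<close>.
\<close>

type_synonym ('m, 'k) vform = "'m set \<Rightarrow> ('m, 'k) vfield list \<Rightarrow> ('m, 'k) vfield"

definition vforms ::
  "('m::topological_space set \<Rightarrow> ('m \<Rightarrow> 'k::field) set) \<Rightarrow> 'm set \<Rightarrow> nat \<Rightarrow> ('m, 'k) vform set" where
  "vforms S V k = {\<omega>.
     (\<forall>W Xs. \<not> (open W \<and> W \<subseteq> V \<and> length Xs = k \<and> set Xs \<subseteq> tangent S W) \<longrightarrow> \<omega> W Xs = 0) \<and>
     (\<forall>W Xs. open W \<and> W \<subseteq> V \<and> length Xs = k \<and> set Xs \<subseteq> tangent S W \<longrightarrow>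
        \<omega> W Xs \<in> tangent S W \<and>
        (\<forall>W'. open W' \<and> W' \<subseteq> W \<longrightarrow> \<omega> W' (map (vres W') Xs) = vres W' (\<omega> W Xs)) \<and>
        (\<forall>i<k. \<forall>X\<in>tangent S W. \<forall>Y\<in>tangent S W.
           \<omega> W (Xs[i := X + Y]) = \<omega> W (Xs[i := X]) + \<omega> W (Xs[i := Y])) \<and>
        (\<forall>i<k. \<forall>f\<in>S W. \<forall>X\<in>tangent S W. \<omega> W (Xs[i := f \<cdot> X]) = f \<cdot> \<omega> W (Xs[i := X])) \<and>
        (\<forall>i j. i < j \<and> j < k \<and> Xs ! i = Xs ! j \<longrightarrow> \<omega> W Xs = 0))}"

definition form_res :: "'m set \<Rightarrow> ('m, 'k::zero) vform \<Rightarrow> ('m, 'k) vform" where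
  "form_res V \<omega> = (\<lambda>W Xs. if W \<subseteq> V then \<omega> W Xs else 0)"

definition omit :: "nat \<Rightarrow> 'a list \<Rightarrow> 'a list" where
  "omit i xs = take i xs @ drop (Suc i) xs"

definition lie_via ::
  "('m set \<Rightarrow> ('m, 'k::ab_group_add) vfield \<Rightarrow> ('m, 'k) vfield)
    \<Rightarrow> 'm set \<Rightarrow> ('m, 'k) vfield \<Rightarrow> ('m, 'k) vfield \<Rightarrow> ('m, 'k) vfield" where
  "lie_via L V X Y = lie (L V X) Y + lie X (L V Y) - L V (lie X Y)"

text \<open>
  The differential twisted by an endomorphism \<open>L\<close> of the tangent sheaf, on \<open>k\<close>-forms over \<open>V\<close>.
  In the double sum \<open>i < j\<close>, so \<open>omit i (omit j Xs)\<close> removes the entries originally at \<open>i\<close> and \<open>j\<close>.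
\<close>

definition twisted_d ::
  "('m::topological_space set \<Rightarrow> ('m \<Rightarrow> 'k::field) set)
    \<Rightarrow> ('m set \<Rightarrow> ('m, 'k) vfield \<Rightarrow> ('m, 'k) vfield) \<Rightarrow> ('m, 'k) vop2
    \<Rightarrow> 'm set \<Rightarrow> nat \<Rightarrow> ('m, 'k) vform \<Rightarrow> ('m, 'k) vform" where
  "twisted_d S L D V k \<omega> = (\<lambda>W Xs.
     if open W \<and> W \<subseteq> V \<and> length Xs = Suc k \<and> set Xs \<subseteq> tangent S W then
       (\<Sum>i\<le>k. (-1) ^ i \<cdot> D W (L W (Xs ! i)) (\<omega> W (omit i Xs))) +
       (\<Sum>j\<le>k. \<Sum>i<j. (-1) ^ (i + j) \<cdot> \<omega> W (lie_via L W (Xs ! i) (Xs ! j) # omit i (omit j Xs)))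
     else 0)"

definition exterior_d ::
  "('m::topological_space set \<Rightarrow> ('m \<Rightarrow> 'k::field) set) \<Rightarrow> ('m, 'k) vop2
    \<Rightarrow> 'm set \<Rightarrow> nat \<Rightarrow> ('m, 'k) vform \<Rightarrow> ('m, 'k) vform" where
  "exterior_d S D = twisted_d S (\<lambda>V X. X) D"

definition degree_one_morphism ::
  "('m::topological_space set \<Rightarrow> ('m \<Rightarrow> 'k::field) set) \<Rightarrow> 'm set
    \<Rightarrow> ('m set \<Rightarrow> nat \<Rightarrow> ('m, 'k) vform \<Rightarrow> ('m, 'k) vform) \<Rightarrow> bool" where
  "degree_one_morphism S U d \<longleftrightarrow>
     (\<forall>V k. open V \<and> V \<subseteq> U \<longrightarrow>
        (\<forall>\<omega>\<in>vforms S V k.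
           d V k \<omega> \<in> vforms S V (Suc k) \<and>
           (\<forall>\<eta>\<in>vforms S V k. d V k (\<omega> + \<eta>) = d V k \<omega> + d V k \<eta>) \<and>
           (\<forall>c. d V k (\<lambda>W Xs. (\<lambda>_. c) \<cdot> \<omega> W Xs) = (\<lambda>W Xs. (\<lambda>_. c) \<cdot> d V k \<omega> W Xs)) \<and>
           (\<forall>V'. open V' \<and> V' \<subseteq> V \<longrightarrow> d V' k (form_res V' \<omega>) = form_res V' (d V k \<omega>))))"

definition differential_bicomplex ::
  "('m::topological_space set \<Rightarrow> ('m \<Rightarrow> 'k::field) set) \<Rightarrow> 'm set
    \<Rightarrow> ('m set \<Rightarrow> nat \<Rightarrow> ('m, 'k) vform \<Rightarrow> ('m, 'k) vform)
    \<Rightarrow> ('m set \<Rightarrow> nat \<Rightarrow> ('m, 'k) vform \<Rightarrow> ('m, 'k) vform) \<Rightarrow> bool" where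
  "differential_bicomplex S U d d' \<longleftrightarrow>
     degree_one_morphism S U d \<and> degree_one_morphism S U d' \<and>
     (\<forall>V k. open V \<and> V \<subseteq> U \<longrightarrow> (\<forall>\<omega>\<in>vforms S V k.
        d V (Suc k) (d V k \<omega>) = 0 \<and>
        d' V (Suc k) (d' V k \<omega>) = 0 \<and>
        d V (Suc k) (d' V k \<omega>) + d' V (Suc k) (d V k \<omega>) = 0))"

end

theory Submission
  imports Defs
begin

text \<open>
  Write \<open>L = E\<circ>\<close>, let \<open>\<nabla>\<close> be the first and \<open>\<nabla>'\<close> the second flat connection.  Both differentials are
  instances of one construction: a bracket \<open>b\<close> on vector fields together with directional derivatives
  \<open>P X\<close> defines a differential on alternating forms by the Koszul formula, and this differential
  squares to zero as soon as \<open>b\<close> satisfies the Jacobi identity and \<open>P\<close> is a representation of \<open>b\<close>,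
  that is, \<open>P [X,Y] = [P X, P Y]\<close> (\<open>cartan_d_square\<close>).  The first differential is
  the case \<open>P X = \<nabla>\<^sub>X\<close> with the Lie bracket, the second one the case \<open>P X = \<nabla>'\<close> along \<open>L X\<close> with the
  deformed bracket \<open>[X,Y]\<^sub>L\<close>.  The formula is linear in the pair \<open>(P, b)\<close>, so the sum of the two
  differentials is the differential of the sum of the two pairs, and the three bicomplex identities
  amount to the statement that all three pairs are flat (\<open>cartan_d_anticommute\<close>).

  For the first pair this is flatness of \<open>\<nabla>\<close>.  For the second one, the Hertling-Manin identity and the
  Euler property of \<open>E\<close> give \<open>[L X, L Y] = L [X,Y]\<^sub>L\<close> (\<open>nijenhuis\<close>): the Jacobi identity follows
  because \<open>L\<close> is injective, and flatness of \<open>\<nabla>'\<close> can be read along \<open>L\<close>.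

  The third pair is the point where the two structures interact.  The mixed Jacobi identity holds
  for every additive \<open>L\<close>.  For the mixed flatness, the compatibility of the two connections, evaluated
  at the unit, says that \<open>\<nabla>'\<^sub>Y X = \<nabla>\<^sub>Y X + t (Y \<circ> X)\<close> for an additive map \<open>t\<close>; with \<open>\<nabla>' E = 0\<close> this yields
  \<open>t (E \<circ> Y) = - \<nabla>\<^sub>Y E\<close>, so that \<open>\<nabla>'\<close> along \<open>L X\<close> is \<open>Z \<mapsto> \<nabla>\<^bsub>L X\<^esub> Z - \<nabla>\<^bsub>X \<circ> Z\<^esub> E\<close>.  Substituting this
  and using the flatness of the pencil \<open>\<nabla> - c \<circ>\<close>, the mixed flatness reduces to the symmetry in \<open>X, Y\<close> of
  \<open>(\<nabla>\<nabla>E)(X, Y \<circ> Z)\<close>, which is a consequence of the flatness of \<open>\<nabla>'\<close> (\<open>D_D_E_symmetric\<close>).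

  The arguments about forms and about the bi-flat structure are algebra over the module of vector
  fields on one open set.  Geometry enters only to see that this module and the operations on it are
  well behaved; about regular functions it suffices to know that they form a sheaf of rings
  containing the constants.
\<close>

section \<open>Regular functions\<close>

lemma Ck_on_const: "Ck_on k S (\<lambda>_. c)"
proof (induction k arbitrary: c)
  case (Suc k)
  have "\<exists>g. (\<forall>x\<in>S. ((\<lambda>_. c) has_derivative (\<lambda>h. \<Sum>i\<in>UNIV. g i x * h $ i)) (at x)) \<and> (\<forall>i. Ck_on k S (g i))"
    by (rule exI[of _ "\<lambda>_ _. 0"]) (simp add: Suc.IH)
  then show ?case by simp
qed simp

text \<open>Only the bottom level has content: differentiability gives continuity.  The product rule needs
  this descent, since the derivative of a product again contains the undifferentiated factors.\<close>

lemma Ck_on_SucD: "Ck_on (Suc k) S f \<Longrightarrow> Ck_on k S f"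
proof (induction k arbitrary: f)
  case 0
  then obtain g where "\<And>x. x \<in> S \<Longrightarrow> (f has_derivative (\<lambda>h. \<Sum>i\<in>UNIV. g i x * h $ i)) (at x)"
    by auto
  then have "continuous (at x within S) f" if "x \<in> S" for x
    using has_derivative_continuous continuous_at_imp_continuous_at_within that by blast
  then show ?case by (simp add: continuous_on_eq_continuous_within)
next
  case (Suc k)
  from Suc.prems obtain g where
    g: "\<forall>x\<in>S. (f has_derivative (\<lambda>h. \<Sum>i\<in>UNIV. g i x * h $ i)) (at x)" "\<forall>i. Ck_on (Suc k) S (g i)"
    unfolding Ck_on.simps(2)[of "Suc k"] by blast
  have "\<forall>i. Ck_on k S (g i)" using g(2) Suc.IH by blast
  with g(1) show ?case unfolding Ck_on.simps(2)[of k] by blast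
qed

lemma Ck_on_add: "Ck_on k S f \<Longrightarrow> Ck_on k S g \<Longrightarrow> Ck_on k S (\<lambda>x. f x + g x)"
proof (induction k arbitrary: f g)
  case 0
  then show ?case by (simp add: continuous_on_add)
next
  case (Suc k)
  from Suc.prems obtain f' g' where
    f': "\<forall>x\<in>S. (f has_derivative (\<lambda>h. \<Sum>i\<in>UNIV. f' i x * h $ i)) (at x)" "\<forall>i. Ck_on k S (f' i)" and
    g': "\<forall>x\<in>S. (g has_derivative (\<lambda>h. \<Sum>i\<in>UNIV. g' i x * h $ i)) (at x)" "\<forall>i. Ck_on k S (g' i)"
    by auto
  have "((\<lambda>x. f x + g x) has_derivative (\<lambda>h. \<Sum>i\<in>UNIV. (f' i x + g' i x) * h $ i)) (at x)" if "x \<in> S" for x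
    using has_derivative_add[OF f'(1)[rule_format, OF that] g'(1)[rule_format, OF that]]
    by (simp add: sum.distrib distrib_right)
  moreover have "\<forall>i. Ck_on k S (\<lambda>x. f' i x + g' i x)"
    using Suc.IH f'(2) g'(2) by blast
  ultimately show ?case unfolding Ck_on.simps
    by (intro exI[of _ "\<lambda>i x. f' i x + g' i x"]) simp
qed

lemma Ck_on_mult: "Ck_on k S f \<Longrightarrow> Ck_on k S g \<Longrightarrow> Ck_on k S (\<lambda>x. f x * g x)"
proof (induction k arbitrary: f g)
  case 0
  then show ?case by (simp add: continuous_on_mult)
next
  case (Suc k)
  note low = Ck_on_SucD[OF Suc.prems(1)] Ck_on_SucD[OF Suc.prems(2)]
  from Suc.prems obtain f' g' where
    f': "\<forall>x\<in>S. (f has_derivative (\<lambda>h. \<Sum>i\<in>UNIV. f' i x * h $ i)) (at x)" "\<forall>i. Ck_on k S (f' i)" and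
    g': "\<forall>x\<in>S. (g has_derivative (\<lambda>h. \<Sum>i\<in>UNIV. g' i x * h $ i)) (at x)" "\<forall>i. Ck_on k S (g' i)"
    by auto
  have "((\<lambda>x. f x * g x) has_derivative (\<lambda>h. \<Sum>i\<in>UNIV. (f x * g' i x + f' i x * g x) * h $ i)) (at x)" if "x \<in> S" for x
    using has_derivative_mult[OF f'(1)[rule_format, OF that] g'(1)[rule_format, OF that]]
    by (simp add: sum.distrib sum_distrib_left sum_distrib_right algebra_simps)
  moreover have "\<forall>i. Ck_on k S (\<lambda>x. f x * g' i x + f' i x * g x)"
    using Ck_on_add Suc.IH low f'(2) g'(2) by blast
  ultimately show ?case unfolding Ck_on.simps
    by (intro exI[of _ "\<lambda>i x. f x * g' i x + f' i x * g x"]) simp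
qed

lemma Ck_on_subset: "Ck_on k S f \<Longrightarrow> T \<subseteq> S \<Longrightarrow> Ck_on k T f"
proof (induction k arbitrary: f)
  case 0
  then show ?case using continuous_on_subset by auto
next
  case (Suc k)
  then obtain g where "\<forall>x\<in>S. (f has_derivative (\<lambda>h. \<Sum>i\<in>UNIV. g i x * h $ i)) (at x)" "\<forall>i. Ck_on k S (g i)"
    by auto
  with Suc show ?case unfolding Ck_on.simps by (intro exI[of _ g]) blast
qed

lemma Ck_on_cong:
  assumes "Ck_on k S f" "open S" "\<And>x. x \<in> S \<Longrightarrow> f x = g x"
  shows "Ck_on k S g"
proof (cases k)
  case 0
  then show ?thesis using assms continuous_on_cong[of S S f g] by simp
next
  case (Suc j)
  then obtain f' where
    f': "\<forall>x\<in>S. (f has_derivative (\<lambda>h. \<Sum>i\<in>UNIV. f' i x * h $ i)) (at x)" "\<forall>i. Ck_on j S (f' i)"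
    using assms(1) by auto
  then have "\<forall>x\<in>S. (g has_derivative (\<lambda>h. \<Sum>i\<in>UNIV. f' i x * h $ i)) (at x)"
    using has_derivative_transform_within_open[OF _ assms(2)] assms(3) by blast
  with f'(2) Suc show ?thesis by auto
qed

lemma power_series_on_const: "power_series_on S (\<lambda>_. c)"
  unfolding power_series_on_def
proof (intro ballI)
  fix p :: "'a ^ 'b"
  define a :: "('b \<Rightarrow> nat) \<Rightarrow> 'a" where "a \<alpha> = (if \<alpha> = (\<lambda>_. 0) then c else 0)" for \<alpha>
  have "((\<lambda>\<alpha>. norm (a \<alpha> * (\<Prod>i\<in>UNIV. (x $ i - p $ i) ^ \<alpha> i))) has_sum norm c) UNIV"
    "((\<lambda>\<alpha>. a \<alpha> * (\<Prod>i\<in>UNIV. (x $ i - p $ i) ^ \<alpha> i)) has_sum c) UNIV" for x :: "'a ^ 'b"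
    by (rule has_sum_finite_neutralI[where B = "{\<lambda>_. 0}"]; simp add: a_def)+
  then show "\<exists>a. \<exists>\<epsilon>>0. \<forall>x\<in>ball p \<epsilon>.
       (\<lambda>\<alpha>. norm (a \<alpha> * (\<Prod>i\<in>UNIV. (x $ i - p $ i) ^ \<alpha> i))) summable_on UNIV \<and>
       ((\<lambda>\<alpha>. a \<alpha> * (\<Prod>i\<in>UNIV. (x $ i - p $ i) ^ \<alpha> i)) has_sum c) UNIV"
    by (intro exI[of _ a] exI[of _ 1]) (auto dest: has_sum_imp_summable)
qed

lemma power_series_on_add:
  assumes "power_series_on S f" "power_series_on S g"
  shows "power_series_on S (\<lambda>x. f x + g x)"
  unfolding power_series_on_def
proof (intro ballI)
  fix p assume p: "p \<in> S"
  let ?m = "\<lambda>x \<alpha>. \<Prod>i\<in>UNIV. (x $ i - p $ i) ^ \<alpha> i"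
  obtain a \<epsilon> where a: "\<epsilon> > 0" "\<And>x. x \<in> ball p \<epsilon> \<Longrightarrow> (\<lambda>\<alpha>. norm (a \<alpha> * ?m x \<alpha>)) summable_on UNIV"
     "\<And>x. x \<in> ball p \<epsilon> \<Longrightarrow> ((\<lambda>\<alpha>. a \<alpha> * ?m x \<alpha>) has_sum f x) UNIV"
    using assms(1) p unfolding power_series_on_def by blast
  obtain b \<delta> where b: "\<delta> > 0" "\<And>x. x \<in> ball p \<delta> \<Longrightarrow> (\<lambda>\<alpha>. norm (b \<alpha> * ?m x \<alpha>)) summable_on UNIV"
     "\<And>x. x \<in> ball p \<delta> \<Longrightarrow> ((\<lambda>\<alpha>. b \<alpha> * ?m x \<alpha>) has_sum g x) UNIV"
    using assms(2) p unfolding power_series_on_def by blast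
  have "(\<lambda>\<alpha>. norm ((a \<alpha> + b \<alpha>) * ?m x \<alpha>)) summable_on UNIV"
    if "x \<in> ball p (min \<epsilon> \<delta>)" for x
  proof (rule Infinite_Sum.abs_summable_on_comparison_test'[OF summable_on_add])
    show "(\<lambda>\<alpha>. norm (a \<alpha> * ?m x \<alpha>)) summable_on UNIV" "(\<lambda>\<alpha>. norm (b \<alpha> * ?m x \<alpha>)) summable_on UNIV"
      using a(2) b(2) that by auto
    show "norm ((a \<alpha> + b \<alpha>) * ?m x \<alpha>) \<le> norm (a \<alpha> * ?m x \<alpha>) + norm (b \<alpha> * ?m x \<alpha>)" for \<alpha>
      unfolding distrib_right by (rule norm_triangle_ineq)
  qed
  moreover have "((\<lambda>\<alpha>. (a \<alpha> + b \<alpha>) * ?m x \<alpha>) has_sum f x + g x) UNIV"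
    if "x \<in> ball p (min \<epsilon> \<delta>)" for x
    using has_sum_add[OF a(3) b(3)] that by (simp add: distrib_right)
  ultimately show "\<exists>a. \<exists>\<epsilon>>0. \<forall>x\<in>ball p \<epsilon>. (\<lambda>\<alpha>. norm (a \<alpha> * ?m x \<alpha>)) summable_on UNIV \<and>
       ((\<lambda>\<alpha>. a \<alpha> * ?m x \<alpha>) has_sum (f x + g x)) UNIV"
    using a(1) b(1) by (intro exI[of _ "\<lambda>\<alpha>. a \<alpha> + b \<alpha>"] exI[of _ "min \<epsilon> \<delta>"]) auto
qed

text \<open>Absolute convergence is what makes the double series over pairs of indices summable, so that it
  can be evaluated in iterated form here and regrouped along antidiagonals below.\<close>

lemma has_sum_product:
  fixes u :: "'a \<Rightarrow> 'k::{real_normed_field, banach}"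
  assumes "(\<lambda>x. norm (u x)) summable_on UNIV" "(\<lambda>x. norm (v x)) summable_on UNIV"
    and "(u has_sum s) UNIV" "(v has_sum t) UNIV"
  shows "(\<lambda>z. norm (case z of (x, y) \<Rightarrow> u x * v y)) summable_on UNIV"
    and "((\<lambda>(x, y). u x * v y) has_sum s * t) UNIV"
proof -
  have "(\<lambda>z. norm (case z of (x, y) \<Rightarrow> u x * v y)) summable_on UNIV \<times> UNIV"
    unfolding Infinite_Sum.abs_summable_on_Sigma_iff
    using assms(1,2)
    by (auto simp: norm_mult infsum_cmult_right' summable_on_cmult_right' infsum_nonneg
        intro!: summable_on_cmult_right summable_on_cmult_left)
  then show abs: "(\<lambda>z. norm (case z of (x, y) \<Rightarrow> u x * v y)) summable_on UNIV" by simp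
  have "((\<lambda>(x, y). u x * v y) has_sum s * t) (UNIV \<times> UNIV)"
  proof (rule has_sum_SigmaI)
    show "((\<lambda>y. case (x, y) of (x, y) \<Rightarrow> u x * v y) has_sum u x * t) UNIV" for x
      using has_sum_cmult_right[OF assms(4), of "u x"] by simp
    show "((\<lambda>x. u x * t) has_sum s * t) UNIV"
      by (rule has_sum_cmult_left[OF assms(3)])
    show "(\<lambda>(x, y). u x * v y) summable_on UNIV \<times> UNIV"
      using abs_summable_summable[OF abs] by simp
  qed
  then show "((\<lambda>(x, y). u x * v y) has_sum s * t) UNIV" by simp
qed

text \<open>The antidiagonals are finite because there are finitely many variables.  Hence a convergent double
  series can be regrouped along them with finite inner sums, which is the Cauchy product.\<close>

lemma finite_sum_fibre: "finite {(\<alpha>, \<beta>). (\<lambda>i. \<alpha> i + \<beta> i) = (\<gamma> :: 'n::finite \<Rightarrow> nat)}"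
proof (rule finite_subset)
  let ?B = "PiE UNIV (\<lambda>i. {..\<gamma> i})"
  show "{(\<alpha>, \<beta>). (\<lambda>i. \<alpha> i + \<beta> i) = \<gamma>} \<subseteq> ?B \<times> ?B" by auto
  show "finite (?B \<times> ?B)" by (intro finite_cartesian_product finite_PiE) auto
qed

lemma has_sum_regroup:
  fixes w :: "('n::finite \<Rightarrow> nat) \<times> ('n \<Rightarrow> nat) \<Rightarrow> 'b::{banach}"
  assumes "(w has_sum s) UNIV"
  shows "((\<lambda>\<gamma>. \<Sum>q\<in>{(\<alpha>, \<beta>). (\<lambda>i. \<alpha> i + \<beta> i) = \<gamma>}. w q) has_sum s) UNIV"
proof -
  let ?F = "\<lambda>\<gamma>. {(\<alpha>, \<beta>). (\<lambda>i. \<alpha> i + \<beta> i) = (\<gamma> :: 'n \<Rightarrow> nat)}"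
  have "bij_betw snd (Sigma UNIV ?F) UNIV"
    by (rule bij_betwI[where g = "\<lambda>q. ((\<lambda>i. fst q i + snd q i), q)"]) auto
  then have "((\<lambda>z. w (snd z)) has_sum s) (Sigma UNIV ?F)"
    using has_sum_reindex_bij_betw assms by blast
  then show ?thesis
    by (rule has_sum_SigmaD) (auto intro!: has_sum_finite[OF finite_sum_fibre])
qed

text \<open>The coefficients of the product are those of the Cauchy product; their majorant is obtained by
  regrouping the norms of the double series in the same way.\<close>

lemma power_series_on_mult:
  fixes f :: "'k::{real_normed_field, banach} ^ 'n \<Rightarrow> 'k"
  assumes "power_series_on S f" "power_series_on S g"
  shows "power_series_on S (\<lambda>x. f x * g x)"
  unfolding power_series_on_def
proof (intro ballI)
  fix p assume p: "p \<in> S"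
  let ?m = "\<lambda>x \<alpha>. \<Prod>i\<in>UNIV. (x $ i - p $ i) ^ \<alpha> i"
  let ?F = "\<lambda>\<gamma>. {(\<alpha>, \<beta>). (\<lambda>i. \<alpha> i + \<beta> i) = (\<gamma> :: 'n \<Rightarrow> nat)}"
  obtain a \<epsilon> where a: "\<epsilon> > 0" "\<And>x. x \<in> ball p \<epsilon> \<Longrightarrow> (\<lambda>\<alpha>. norm (a \<alpha> * ?m x \<alpha>)) summable_on UNIV"
     "\<And>x. x \<in> ball p \<epsilon> \<Longrightarrow> ((\<lambda>\<alpha>. a \<alpha> * ?m x \<alpha>) has_sum f x) UNIV"
    using assms(1) p unfolding power_series_on_def by blast
  obtain b \<delta> where b: "\<delta> > 0" "\<And>x. x \<in> ball p \<delta> \<Longrightarrow> (\<lambda>\<alpha>. norm (b \<alpha> * ?m x \<alpha>)) summable_on UNIV"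
     "\<And>x. x \<in> ball p \<delta> \<Longrightarrow> ((\<lambda>\<alpha>. b \<alpha> * ?m x \<alpha>) has_sum g x) UNIV"
    using assms(2) p unfolding power_series_on_def by blast
  define c where "c \<gamma> = (\<Sum>q\<in>?F \<gamma>. a (fst q) * b (snd q))" for \<gamma>
  have key: "(\<lambda>\<gamma>. norm (c \<gamma> * ?m x \<gamma>)) summable_on UNIV \<and> ((\<lambda>\<gamma>. c \<gamma> * ?m x \<gamma>) has_sum f x * g x) UNIV"
    if x: "x \<in> ball p (min \<epsilon> \<delta>)" for x
  proof -
    \<comment> \<open>the unregrouped double series\<close>
    let ?w = "\<lambda>(\<alpha>, \<beta>). (a \<alpha> * ?m x \<alpha>) * (b \<beta> * ?m x \<beta>)"
    have w: "(\<lambda>q. norm (?w q)) summable_on UNIV" "(?w has_sum f x * g x) UNIV"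
      using has_sum_product[of "\<lambda>\<alpha>. a \<alpha> * ?m x \<alpha>" "\<lambda>\<alpha>. b \<alpha> * ?m x \<alpha>" "f x" "g x"] a(2,3) b(2,3) x
      by simp_all
    have cw: "c \<gamma> * ?m x \<gamma> = (\<Sum>q\<in>?F \<gamma>. ?w q)" for \<gamma>
      unfolding c_def sum_distrib_right
      by (rule sum.cong) (auto simp: power_add prod.distrib)
    have "(\<lambda>\<gamma>. \<Sum>q\<in>?F \<gamma>. norm (?w q)) summable_on UNIV"
      using has_sum_regroup[OF has_sum_infsum[OF w(1)]] by (rule has_sum_imp_summable)
    then have "(\<lambda>\<gamma>. norm (c \<gamma> * ?m x \<gamma>)) summable_on UNIV"
      by (rule Infinite_Sum.abs_summable_on_comparison_test') (simp only: cw norm_sum)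
    moreover have "((\<lambda>\<gamma>. c \<gamma> * ?m x \<gamma>) has_sum f x * g x) UNIV"
      unfolding cw by (rule has_sum_regroup[OF w(2)])
    ultimately show ?thesis ..
  qed
  show "\<exists>a. \<exists>\<epsilon>>0. \<forall>x\<in>ball p \<epsilon>. (\<lambda>\<alpha>. norm (a \<alpha> * ?m x \<alpha>)) summable_on UNIV \<and>
       ((\<lambda>\<alpha>. a \<alpha> * ?m x \<alpha>) has_sum (f x * g x)) UNIV"
    using a(1) b(1) key by (intro exI[of _ c] exI[of _ "min \<epsilon> \<delta>"]) auto
qed

lemma power_series_on_cong:
  assumes "power_series_on S f" "open S" "\<And>x. x \<in> S \<Longrightarrow> f x = g x"
  shows "power_series_on S g"
  unfolding power_series_on_def
proof (intro ballI)
  fix p assume p: "p \<in> S"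
  let ?m = "\<lambda>x \<alpha>. \<Prod>i\<in>UNIV. (x $ i - p $ i) ^ \<alpha> i"
  obtain a \<epsilon> where a: "\<epsilon> > 0" "\<And>x. x \<in> ball p \<epsilon> \<Longrightarrow> (\<lambda>\<alpha>. norm (a \<alpha> * ?m x \<alpha>)) summable_on UNIV"
     "\<And>x. x \<in> ball p \<epsilon> \<Longrightarrow> ((\<lambda>\<alpha>. a \<alpha> * ?m x \<alpha>) has_sum f x) UNIV"
    using assms(1) p unfolding power_series_on_def by blast
  obtain \<delta> where d: "\<delta> > 0" "ball p \<delta> \<subseteq> S"
    using assms(2) p open_contains_ball by blast
  have "((\<lambda>\<alpha>. a \<alpha> * ?m x \<alpha>) has_sum g x) UNIV" if "x \<in> ball p (min \<epsilon> \<delta>)" for x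
  proof -
    have "x \<in> S" "x \<in> ball p \<epsilon>" using d(2) that by auto
    then show ?thesis using a(3) assms(3) by metis
  qed
  then show "\<exists>a. \<exists>\<epsilon>>0. \<forall>x\<in>ball p \<epsilon>. (\<lambda>\<alpha>. norm (a \<alpha> * ?m x \<alpha>)) summable_on UNIV \<and>
       ((\<lambda>\<alpha>. a \<alpha> * ?m x \<alpha>) has_sum (g x)) UNIV"
    using a(1,2) d(1) by (intro exI[of _ a] exI[of _ "min \<epsilon> \<delta>"]) auto
qed

lemma regular_on_const: "regular_on r S (\<lambda>_. c)"
  by (cases r) (simp_all add: regular_on_def Ck_on_const power_series_on_const)

lemma regular_on_add: "regular_on r S f \<Longrightarrow> regular_on r S g \<Longrightarrow> regular_on r S (\<lambda>x. f x + g x)"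
  by (cases r) (simp_all add: regular_on_def Ck_on_add power_series_on_add)

lemma regular_on_mult:
  fixes f :: "'k::{real_normed_field, banach} ^ 'n \<Rightarrow> 'k"
  shows "regular_on r S f \<Longrightarrow> regular_on r S g \<Longrightarrow> regular_on r S (\<lambda>x. f x * g x)"
  by (cases r) (simp_all add: regular_on_def Ck_on_mult power_series_on_mult)

text \<open>Both regularity conditions are local, so a function may also be altered outside the smaller open
  set.  This is what allows sections to be extended by zero.\<close>

lemma regular_on_restrict:
  assumes "regular_on r S f" "T \<subseteq> S" "open T" "\<And>x. x \<in> T \<Longrightarrow> f x = g x"
  shows "regular_on r T g"
proof (cases r)
  case Smooth
  then show ?thesis
    using assms(1) Ck_on_cong[OF Ck_on_subset[OF _ assms(2)] assms(3,4)] by (auto simp: regular_on_def)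
next
  case Analytic
  then have "power_series_on T f"
    using assms(1,2) unfolding regular_on_def power_series_on_def by auto
  then show ?thesis
    using power_series_on_cong[OF _ assms(3,4)] Analytic by (simp add: regular_on_def)
qed

text \<open>What the rest of the argument uses about the structure sheaf: sections over open sets vanish
  outside their domain, form rings with constants, and restrict.\<close>

locale function_sheaf =
  fixes S :: "'m::topological_space set \<Rightarrow> ('m \<Rightarrow> 'k::field) set"
  assumes sec_outside: "f \<in> S V \<Longrightarrow> p \<notin> V \<Longrightarrow> f p = 0"
    and sec_add: "open V \<Longrightarrow> f \<in> S V \<Longrightarrow> g \<in> S V \<Longrightarrow> f + g \<in> S V"
    and sec_mult: "open V \<Longrightarrow> f \<in> S V \<Longrightarrow> g \<in> S V \<Longrightarrow> f * g \<in> S V"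
    and sec_const: "open V \<Longrightarrow> res V (\<lambda>_. c) \<in> S V"
    and sec_res: "open V \<Longrightarrow> open V' \<Longrightarrow> V' \<subseteq> V \<Longrightarrow> f \<in> S V \<Longrightarrow> res V' f \<in> S V'"

lemma structure_sheaf_is_function_sheaf:
  fixes A :: "('m::{second_countable_topology, t2_space}, 'k::{real_normed_field, banach}, 'n::finite) chart set"
  assumes "manifold r A"
  shows "function_sheaf (structure_sheaf r A)"
proof
  have charts: "open D" "open (\<phi> ` D)" "homeomorphism D (\<phi> ` D) \<phi> (inv_into D \<phi>)" if "(D, \<phi>) \<in> A" for D \<phi>
    using assms that unfolding manifold_def by auto
  have opn: "open (\<phi> ` (D \<inter> V))" if "(D, \<phi>) \<in> A" "open V" for D \<phi> V
  proof -
    have "openin (top_of_set D) (D \<inter> V)" using that(2) by (simp add: openin_open_Int)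
    then have "openin (top_of_set (\<phi> ` D)) (\<phi> ` (D \<inter> V))"
      using homeomorphism_imp_open_map[OF charts(3)[OF that(1)]] by blast
    then show ?thesis using charts(2)[OF that(1)] by (simp add: openin_open_eq)
  qed
  have inv: "inv_into D \<phi> x \<in> V" if "(D, \<phi>) \<in> A" "x \<in> \<phi> ` (D \<inter> V)" for D \<phi> V x
    using homeomorphism_apply1[OF charts(3)[OF that(1)]] that(2) by auto
  fix V V' :: "'m set" and f g :: "'m \<Rightarrow> 'k" and c :: 'k and p
  show "f p = 0" if "f \<in> structure_sheaf r A V" "p \<notin> V"
    using that by (simp add: structure_sheaf_def)
  show "f + g \<in> structure_sheaf r A V" "f * g \<in> structure_sheaf r A V"
    if "f \<in> structure_sheaf r A V" "g \<in> structure_sheaf r A V"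
    using that by (auto simp: structure_sheaf_def intro!: regular_on_add regular_on_mult)
  show "res V (\<lambda>_. c) \<in> structure_sheaf r A V" if "open V"
  proof -
    have "regular_on r (\<phi> ` (D \<inter> V)) (\<lambda>x. res V (\<lambda>_. c) (inv_into D \<phi> x))" if "(D, \<phi>) \<in> A" for D \<phi>
      by (rule regular_on_restrict[OF regular_on_const[where c = c and S = UNIV]])
        (use opn inv that \<open>open V\<close> in \<open>auto simp: res_def\<close>)
    then show ?thesis by (auto simp: structure_sheaf_def res_def)
  qed
  show "res V' f \<in> structure_sheaf r A V'"
    if "open V" "open V'" "V' \<subseteq> V" "f \<in> structure_sheaf r A V"
  proof -
    have "regular_on r (\<phi> ` (D \<inter> V')) (\<lambda>x. res V' f (inv_into D \<phi> x))" if D: "(D, \<phi>) \<in> A" for D \<phi>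
    proof (rule regular_on_restrict)
      show "regular_on r (\<phi> ` (D \<inter> V)) (\<lambda>x. f (inv_into D \<phi> x))"
        using \<open>f \<in> _\<close> D by (auto simp: structure_sheaf_def)
      show "\<phi> ` (D \<inter> V') \<subseteq> \<phi> ` (D \<inter> V)" using \<open>V' \<subseteq> V\<close> by auto
      show "open (\<phi> ` (D \<inter> V'))" using opn D \<open>open V'\<close> by blast
      show "f (inv_into D \<phi> x) = res V' f (inv_into D \<phi> x)" if "x \<in> \<phi> ` (D \<inter> V')" for x
        using inv[OF D that] by (simp add: res_def)
    qed
    then show ?thesis by (auto simp: structure_sheaf_def res_def)
  qed
qed


section \<open>Cartan calculus of a bracket with directional derivatives\<close>

text \<open>Forms are functions of argument lists, and contraction with \<open>Y\<close> is fixing the head of the list.  In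
  these terms the commutation rule of Lie derivative and contraction, and Cartan's formula
  \<open>\<iota>\<^sub>X d = L\<^sub>X - d \<iota>\<^sub>X\<close>, become recursions on the argument list.  Taking them as definitions makes every
  identity of the calculus an induction on the degree, without manipulating signed double sums; the
  agreement with the Koszul formula is \<open>cartan_d_explicit\<close> below.\<close>

fun lie_deriv :: "('v::ab_group_add \<Rightarrow> 'v \<Rightarrow> 'v) \<Rightarrow> ('v \<Rightarrow> 'v \<Rightarrow> 'v) \<Rightarrow> 'v \<Rightarrow> ('v list \<Rightarrow> 'v) \<Rightarrow> 'v list \<Rightarrow> 'v" where
  "lie_deriv P b X \<omega> [] = P X (\<omega> [])"
| "lie_deriv P b X \<omega> (Y # Ys) = lie_deriv P b X (\<lambda>Zs. \<omega> (Y # Zs)) Ys - \<omega> (b X Y # Ys)"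

fun cartan_d :: "('v::ab_group_add \<Rightarrow> 'v \<Rightarrow> 'v) \<Rightarrow> ('v \<Rightarrow> 'v \<Rightarrow> 'v) \<Rightarrow> ('v list \<Rightarrow> 'v) \<Rightarrow> 'v list \<Rightarrow> 'v" where
  "cartan_d P b \<omega> [] = 0"
| "cartan_d P b \<omega> (X # Xs) = lie_deriv P b X \<omega> Xs - cartan_d P b (\<lambda>Zs. \<omega> (X # Zs)) Xs"

text \<open>The module of vector fields over one open set: \<open>R\<close> are the functions, acting by \<open>smul\<close>.\<close>

locale form_module =
  fixes T :: "'v::ab_group_add set" and R :: "'r set" and smul :: "'r \<Rightarrow> 'v \<Rightarrow> 'v"
  assumes zero_in: "0 \<in> T"
    and add_in: "X \<in> T \<Longrightarrow> Y \<in> T \<Longrightarrow> X + Y \<in> T"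
    and uminus_in: "X \<in> T \<Longrightarrow> - X \<in> T"
    and smul_in: "f \<in> R \<Longrightarrow> X \<in> T \<Longrightarrow> smul f X \<in> T"
    and smul_add: "f \<in> R \<Longrightarrow> X \<in> T \<Longrightarrow> Y \<in> T \<Longrightarrow> smul f (X + Y) = smul f X + smul f Y"
    and smul_commute: "f \<in> R \<Longrightarrow> g \<in> R \<Longrightarrow> X \<in> T \<Longrightarrow> smul f (smul g X) = smul g (smul f X)"
begin

lemma diff_in: "X \<in> T \<Longrightarrow> Y \<in> T \<Longrightarrow> X - Y \<in> T"
  using add_in[OF _ uminus_in, of X Y] by simp

lemma smul_zero: "f \<in> R \<Longrightarrow> smul f 0 = 0"
  using smul_add[OF _ zero_in zero_in, of f] by simp

lemma smul_diff: "f \<in> R \<Longrightarrow> X \<in> T \<Longrightarrow> Y \<in> T \<Longrightarrow> smul f (X - Y) = smul f X - smul f Y"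
  using smul_add[of f "X - Y" Y] diff_in by (simp add: algebra_simps)

definition tuples :: "nat \<Rightarrow> 'v list set" where
  "tuples k = {Xs. length Xs = k \<and> set Xs \<subseteq> T}"

lemma tuples_0 [simp]: "Xs \<in> tuples 0 \<longleftrightarrow> Xs = []"
  by (auto simp: tuples_def)

lemma tuples_Cons [simp]: "X # Xs \<in> tuples (Suc k) \<longleftrightarrow> X \<in> T \<and> Xs \<in> tuples k"
  by (auto simp: tuples_def)

lemma tuples_SucE:
  assumes "Xs \<in> tuples (Suc k)"
  obtains Y Ys where "Xs = Y # Ys" "Y \<in> T" "Ys \<in> tuples k"
  using assms by (cases Xs) (auto simp: tuples_def)

text \<open>Alternating multilinear forms of degree \<open>k\<close> on \<open>T\<close>, described so that the recursion matches the one
  of \<open>cartan_d\<close>: linearity in the first slot, vanishing on equal first two arguments, and the same for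
  all contractions.  Vanishing on equal adjacent arguments suffices for alternation.\<close>

primrec aform :: "nat \<Rightarrow> ('v list \<Rightarrow> 'v) \<Rightarrow> bool" where
  "aform 0 \<omega> \<longleftrightarrow> \<omega> [] \<in> T"
| "aform (Suc k) \<omega> \<longleftrightarrow> (\<forall>X\<in>T. aform k (\<lambda>Xs. \<omega> (X # Xs)) \<and>
     (\<forall>Xs\<in>tuples k. (\<forall>Y\<in>T. \<omega> ((X + Y) # Xs) = \<omega> (X # Xs) + \<omega> (Y # Xs)) \<and>
        (\<forall>f\<in>R. \<omega> (smul f X # Xs) = smul f (\<omega> (X # Xs)))) \<and>
     (\<forall>Xs. X # Xs \<in> tuples k \<longrightarrow> \<omega> (X # X # Xs) = 0))"

lemma aform_SucI:
  assumes "\<And>X. X \<in> T \<Longrightarrow> aform k (\<lambda>Xs. \<omega> (X # Xs))"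
    and "\<And>X Y Xs. X \<in> T \<Longrightarrow> Y \<in> T \<Longrightarrow> Xs \<in> tuples k \<Longrightarrow> \<omega> ((X + Y) # Xs) = \<omega> (X # Xs) + \<omega> (Y # Xs)"
    and "\<And>f X Xs. f \<in> R \<Longrightarrow> X \<in> T \<Longrightarrow> Xs \<in> tuples k \<Longrightarrow> \<omega> (smul f X # Xs) = smul f (\<omega> (X # Xs))"
    and "\<And>j X Xs. k = Suc j \<Longrightarrow> X \<in> T \<Longrightarrow> Xs \<in> tuples j \<Longrightarrow> \<omega> (X # X # Xs) = 0"
  shows "aform (Suc k) \<omega>"
  using assms by (cases k) auto

lemma aform_Cons: "aform (Suc k) \<omega> \<Longrightarrow> X \<in> T \<Longrightarrow> aform k (\<lambda>Xs. \<omega> (X # Xs))"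
  by simp

lemma aform_slot_add:
  "aform (Suc k) \<omega> \<Longrightarrow> X \<in> T \<Longrightarrow> Y \<in> T \<Longrightarrow> Xs \<in> tuples k \<Longrightarrow> \<omega> ((X + Y) # Xs) = \<omega> (X # Xs) + \<omega> (Y # Xs)"
  by simp

lemma aform_slot_smul:
  "aform (Suc k) \<omega> \<Longrightarrow> f \<in> R \<Longrightarrow> X \<in> T \<Longrightarrow> Xs \<in> tuples k \<Longrightarrow> \<omega> (smul f X # Xs) = smul f (\<omega> (X # Xs))"
  by simp

lemma aform_slot_diff:
  "aform (Suc k) \<omega> \<Longrightarrow> X \<in> T \<Longrightarrow> Y \<in> T \<Longrightarrow> Xs \<in> tuples k \<Longrightarrow> \<omega> ((X - Y) # Xs) = \<omega> (X # Xs) - \<omega> (Y # Xs)"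
  using aform_slot_add[of k \<omega> "X - Y" Y Xs] diff_in by (simp add: algebra_simps)

lemma aform_slot_zero: "aform (Suc k) \<omega> \<Longrightarrow> Xs \<in> tuples k \<Longrightarrow> \<omega> (0 # Xs) = 0"
  using aform_slot_diff[of k \<omega> 0 0 Xs] zero_in by simp

lemma aform_same: "aform (Suc (Suc k)) \<omega> \<Longrightarrow> X \<in> T \<Longrightarrow> Xs \<in> tuples k \<Longrightarrow> \<omega> (X # X # Xs) = 0"
  by simp

lemma aform_swap:
  assumes \<omega>: "aform (Suc (Suc k)) \<omega>" and X: "X \<in> T" and Y: "Y \<in> T" and Xs: "Xs \<in> tuples k"
  shows "\<omega> (Y # X # Xs) = - \<omega> (X # Y # Xs)"
proof -
  \<comment> \<open>polarization of \<open>\<omega>(Z, Z, \<dots>) = 0\<close>\<close>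
  have "0 = \<omega> ((X + Y) # (X + Y) # Xs)"
    using aform_same[OF \<omega> add_in[OF X Y] Xs] by simp
  also have "\<dots> = \<omega> (X # (X + Y) # Xs) + \<omega> (Y # (X + Y) # Xs)"
    using aform_slot_add[OF \<omega> X Y] add_in X Y Xs by simp
  also have "\<dots> = \<omega> (X # Y # Xs) + \<omega> (Y # X # Xs)"
    using aform_slot_add[OF aform_Cons[OF \<omega> X] X Y Xs] aform_slot_add[OF aform_Cons[OF \<omega> Y] X Y Xs]
      aform_same[OF \<omega> X Xs] aform_same[OF \<omega> Y Xs] by simp
  finally show ?thesis by (metis add_eq_0_iff)
qed

lemma aform_in: "aform k \<omega> \<Longrightarrow> Xs \<in> tuples k \<Longrightarrow> \<omega> Xs \<in> T"
proof (induction k arbitrary: \<omega> Xs)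
  case (Suc k)
  then show ?case by (metis aform_Cons tuples_SucE)
qed simp

lemma aform_cong:
  "aform k \<omega> \<Longrightarrow> (\<And>Xs. Xs \<in> tuples k \<Longrightarrow> \<omega> Xs = \<eta> Xs) \<Longrightarrow> aform k \<eta>"
proof (induction k arbitrary: \<omega> \<eta>)
  case (Suc k)
  note eq = Suc.prems(2)
  show ?case
  proof (rule aform_SucI)
    show "aform k (\<lambda>Xs. \<eta> (X # Xs))" if "X \<in> T" for X
      using Suc.IH[OF aform_Cons[OF Suc.prems(1) that]] eq that by simp
    show "\<eta> ((X + Y) # Xs) = \<eta> (X # Xs) + \<eta> (Y # Xs)" if "X \<in> T" "Y \<in> T" "Xs \<in> tuples k" for X Y Xs
      using aform_slot_add[OF Suc.prems(1) that] that eq add_in by simp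
    show "\<eta> (smul f X # Xs) = smul f (\<eta> (X # Xs))" if "f \<in> R" "X \<in> T" "Xs \<in> tuples k" for f X Xs
      using aform_slot_smul[OF Suc.prems(1) that] that eq smul_in by simp
    show "\<eta> (X # X # Xs) = 0" if "k = Suc j" "X \<in> T" "Xs \<in> tuples j" for j X Xs
      using aform_same[of j \<omega> X Xs] Suc.prems(1) that eq by simp
  qed
qed simp

lemma aform_add: "aform k \<omega> \<Longrightarrow> aform k \<eta> \<Longrightarrow> aform k (\<lambda>Xs. \<omega> Xs + \<eta> Xs)"
proof (induction k arbitrary: \<omega> \<eta>)
  case (Suc k)
  then show ?case
    by (intro aform_SucI)
      (simp_all add: aform_slot_add aform_slot_smul smul_add aform_in[OF aform_Cons] del: aform.simps(2),
       simp_all add: aform_Cons aform_same aform_in[of "Suc k"] algebra_simps del: aform.simps(2))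
qed (simp add: add_in)

lemma aform_smul: "g \<in> R \<Longrightarrow> aform k \<omega> \<Longrightarrow> aform k (\<lambda>Xs. smul g (\<omega> Xs))"
proof (induction k arbitrary: \<omega>)
  case (Suc k)
  then show ?case
    by (intro aform_SucI)
      (simp_all add: aform_slot_add aform_slot_smul smul_add smul_zero smul_commute[of g] aform_in[of "Suc k"] aform_Cons aform_same del: aform.simps(2))
qed (simp add: smul_in)

lemma aform_uminus: "aform k \<omega> \<Longrightarrow> aform k (\<lambda>Xs. - \<omega> Xs)"
proof (induction k arbitrary: \<omega>)
  case (Suc k)
  have "smul f (- X) = - smul f X" if "f \<in> R" "X \<in> T" for f X
    using smul_diff[OF that(1) zero_in that(2)] smul_zero that by simp
  with Suc show ?case
    by (intro aform_SucI)
      (simp_all add: aform_slot_add aform_slot_smul aform_in[of "Suc k"] aform_Cons aform_same del: aform.simps(2))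
qed (simp add: uminus_in)

lemma aform_diff: "aform k \<omega> \<Longrightarrow> aform k \<eta> \<Longrightarrow> aform k (\<lambda>Xs. \<omega> Xs - \<eta> Xs)"
  using aform_add[OF _ aform_uminus, of k \<omega> \<eta>] by simp

end

text \<open>The form \<open>df \<and> \<omega>\<close>, where \<open>df X = a X f\<close>.  It measures the failure of the differential to be linear over
  functions, and \<open>df \<and> \<iota>\<^sub>X \<omega>\<close> is the failure of \<open>L\<^sub>X \<omega>\<close> to be linear in \<open>X\<close>.\<close>

fun wedge_d :: "('v::ab_group_add \<Rightarrow> 'r \<Rightarrow> 'r) \<Rightarrow> ('r \<Rightarrow> 'v \<Rightarrow> 'v) \<Rightarrow> 'r \<Rightarrow> ('v list \<Rightarrow> 'v) \<Rightarrow> 'v list \<Rightarrow> 'v" where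
  "wedge_d a s f \<omega> [] = 0"
| "wedge_d a s f \<omega> (X # Xs) = s (a X f) (\<omega> Xs) - wedge_d a s f (\<lambda>Zs. \<omega> (X # Zs)) Xs"

text \<open>A bracket \<open>b\<close> and derivatives \<open>P\<close>, both satisfying the Leibniz rule with respect to the same action
  \<open>a\<close> of vector fields on functions.  That the two Leibniz rules share this action is what makes the
  differential preserve alternating multilinear forms.\<close>

locale anchored_connection = form_module T R smul
  for T :: "'v::ab_group_add set" and R :: "'r set" and smul :: "'r \<Rightarrow> 'v \<Rightarrow> 'v" +
  fixes a :: "'v \<Rightarrow> 'r \<Rightarrow> 'r" and P :: "'v \<Rightarrow> 'v \<Rightarrow> 'v" and b :: "'v \<Rightarrow> 'v \<Rightarrow> 'v"
  assumes anchor_in: "X \<in> T \<Longrightarrow> f \<in> R \<Longrightarrow> a X f \<in> R"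
    and P_in: "X \<in> T \<Longrightarrow> Y \<in> T \<Longrightarrow> P X Y \<in> T"
    and P_add_left: "X \<in> T \<Longrightarrow> Y \<in> T \<Longrightarrow> Z \<in> T \<Longrightarrow> P (X + Y) Z = P X Z + P Y Z"
    and P_add_right: "X \<in> T \<Longrightarrow> Y \<in> T \<Longrightarrow> Z \<in> T \<Longrightarrow> P X (Y + Z) = P X Y + P X Z"
    and P_smul_left: "f \<in> R \<Longrightarrow> X \<in> T \<Longrightarrow> Y \<in> T \<Longrightarrow> P (smul f X) Y = smul f (P X Y)"
    and P_smul_right: "f \<in> R \<Longrightarrow> X \<in> T \<Longrightarrow> Y \<in> T \<Longrightarrow> P X (smul f Y) = smul (a X f) Y + smul f (P X Y)"
    and b_in: "X \<in> T \<Longrightarrow> Y \<in> T \<Longrightarrow> b X Y \<in> T"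
    and b_self: "X \<in> T \<Longrightarrow> b X X = 0"
    and b_add_left: "X \<in> T \<Longrightarrow> Y \<in> T \<Longrightarrow> Z \<in> T \<Longrightarrow> b (X + Y) Z = b X Z + b Y Z"
    and b_add_right: "X \<in> T \<Longrightarrow> Y \<in> T \<Longrightarrow> Z \<in> T \<Longrightarrow> b X (Y + Z) = b X Y + b X Z"
    and b_smul_right: "f \<in> R \<Longrightarrow> X \<in> T \<Longrightarrow> Y \<in> T \<Longrightarrow> b X (smul f Y) = smul (a X f) Y + smul f (b X Y)"
begin

abbreviation LD :: "'v \<Rightarrow> ('v list \<Rightarrow> 'v) \<Rightarrow> 'v list \<Rightarrow> 'v" where "LD \<equiv> lie_deriv P b"
abbreviation d :: "('v list \<Rightarrow> 'v) \<Rightarrow> 'v list \<Rightarrow> 'v" where "d \<equiv> cartan_d P b"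
abbreviation W :: "'r \<Rightarrow> ('v list \<Rightarrow> 'v) \<Rightarrow> 'v list \<Rightarrow> 'v" where "W \<equiv> wedge_d a smul"

lemma P_zero: "X \<in> T \<Longrightarrow> P X 0 = 0"
  using P_add_right[of X 0 0] zero_in by simp

lemma P_diff: "X \<in> T \<Longrightarrow> Y \<in> T \<Longrightarrow> Z \<in> T \<Longrightarrow> P X (Y - Z) = P X Y - P X Z"
  using P_add_right[of X "Y - Z" Z] diff_in by (simp add: algebra_simps)

lemma b_anti: "X \<in> T \<Longrightarrow> Y \<in> T \<Longrightarrow> b Y X = - b X Y"
  using b_self[of "X + Y"] b_self[of X] b_self[of Y] b_add_left[of X Y "X + Y"]
    b_add_right[of X X Y] b_add_right[of Y X Y] add_in[of X Y]
  by (metis add.left_neutral add.right_neutral add_eq_0_iff)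

lemma b_smul_left:
  assumes "f \<in> R" "X \<in> T" "Y \<in> T"
  shows "b (smul f X) Y = smul f (b X Y) - smul (a Y f) X"
proof -
  have "b (smul f X) Y = - (smul (a Y f) X + smul f (b Y X))"
    using b_anti[OF assms(3) smul_in[OF assms(1,2)]] b_smul_right assms by simp
  moreover have "smul f (b Y X) = - smul f (b X Y)"
    using smul_diff[OF assms(1) zero_in b_in[OF assms(2,3)]] smul_zero[OF assms(1)] b_anti[OF assms(2,3)] by simp
  ultimately show ?thesis by simp
qed

lemma lie_deriv_in: "X \<in> T \<Longrightarrow> aform k \<omega> \<Longrightarrow> Xs \<in> tuples k \<Longrightarrow> LD X \<omega> Xs \<in> T"
proof (induction k arbitrary: \<omega> Xs)
  case (Suc k)
  then obtain Y Ys where Y: "Xs = Y # Ys" "Y \<in> T" "Ys \<in> tuples k" by (metis tuples_SucE)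
  show ?case
    using Suc.IH[OF Suc.prems(1) aform_Cons[OF Suc.prems(2) Y(2)] Y(3)] aform_in[OF Suc.prems(2)] b_in Suc.prems(1) Y
    by (simp add: diff_in)
qed (simp add: P_in)

lemma lie_deriv_cong:
  "X \<in> T \<Longrightarrow> Xs \<in> tuples k \<Longrightarrow> (\<And>Ys. Ys \<in> tuples k \<Longrightarrow> \<omega> Ys = \<eta> Ys) \<Longrightarrow> LD X \<omega> Xs = LD X \<eta> Xs"
proof (induction k arbitrary: \<omega> \<eta> Xs)
  case (Suc k)
  then obtain Y Ys where Y: "Xs = Y # Ys" "Y \<in> T" "Ys \<in> tuples k" by (metis tuples_SucE)
  then show ?case
    using Suc.IH[OF Suc.prems(1) Y(3), of "\<lambda>Zs. \<omega> (Y # Zs)" "\<lambda>Zs. \<eta> (Y # Zs)"] Suc.prems b_in by simp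
qed simp

lemma lie_deriv_add:
  "X \<in> T \<Longrightarrow> aform k \<omega> \<Longrightarrow> aform k \<eta> \<Longrightarrow> Xs \<in> tuples k \<Longrightarrow> LD X (\<lambda>Zs. \<omega> Zs + \<eta> Zs) Xs = LD X \<omega> Xs + LD X \<eta> Xs"
proof (induction k arbitrary: \<omega> \<eta> Xs)
  case (Suc k)
  then obtain Y Ys where Y: "Xs = Y # Ys" "Y \<in> T" "Ys \<in> tuples k" by (metis tuples_SucE)
  show ?case
    using Suc.IH[OF Suc.prems(1) aform_Cons[OF Suc.prems(2) Y(2)] aform_Cons[OF Suc.prems(3) Y(2)] Y(3)] Y(1)
    by simp
qed (simp add: P_add_right)

lemma lie_deriv_zero: "X \<in> T \<Longrightarrow> LD X (\<lambda>_. 0) Xs = 0"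
  by (induction Xs) (simp_all add: P_zero)

lemma lie_deriv_diff:
  assumes "X \<in> T" "aform k \<omega>" "aform k \<eta>" "Xs \<in> tuples k"
  shows "LD X (\<lambda>Zs. \<omega> Zs - \<eta> Zs) Xs = LD X \<omega> Xs - LD X \<eta> Xs"
  using lie_deriv_add[OF assms(1) aform_diff[OF assms(2,3)] assms(3,4)] by (simp add: algebra_simps)

lemma lie_deriv_smul:
  "X \<in> T \<Longrightarrow> f \<in> R \<Longrightarrow> aform k \<omega> \<Longrightarrow> Xs \<in> tuples k \<Longrightarrow>
     LD X (\<lambda>Zs. smul f (\<omega> Zs)) Xs = smul (a X f) (\<omega> Xs) + smul f (LD X \<omega> Xs)"
proof (induction k arbitrary: \<omega> Xs)
  case (Suc k)
  then obtain Y Ys where Y: "Xs = Y # Ys" "Y \<in> T" "Ys \<in> tuples k" by (metis tuples_SucE)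
  note \<omega>Y = aform_Cons[OF Suc.prems(3) Y(2)]
  have "smul f (LD X \<omega> Xs) = smul f (LD X (\<lambda>Zs. \<omega> (Y # Zs)) Ys) - smul f (\<omega> (b X Y # Ys))"
    unfolding Y(1) lie_deriv.simps
    using smul_diff[OF Suc.prems(2) lie_deriv_in[OF Suc.prems(1) \<omega>Y Y(3)] aform_in[OF Suc.prems(3)]]
      b_in[OF Suc.prems(1) Y(2)] Y(3) by simp
  then show ?case
    using Suc.IH[OF Suc.prems(1,2) \<omega>Y Y(3)] Y(1) by simp
qed (simp add: P_smul_right)

lemma lie_deriv_left_add:
  "X \<in> T \<Longrightarrow> Y \<in> T \<Longrightarrow> aform k \<omega> \<Longrightarrow> Xs \<in> tuples k \<Longrightarrow> LD (X + Y) \<omega> Xs = LD X \<omega> Xs + LD Y \<omega> Xs"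
proof (induction k arbitrary: \<omega> Xs)
  case (Suc k)
  then obtain Z Zs where Z: "Xs = Z # Zs" "Z \<in> T" "Zs \<in> tuples k" by (metis tuples_SucE)
  note Suc.IH[OF Suc.prems(1,2) aform_Cons[OF Suc.prems(3) Z(2)] Z(3)]
  moreover have "\<omega> (b (X + Y) Z # Zs) = \<omega> (b X Z # Zs) + \<omega> (b Y Z # Zs)"
    unfolding b_add_left[OF Suc.prems(1,2) Z(2)]
    using aform_slot_add[OF Suc.prems(3) b_in b_in] Suc.prems(1,2) Z by simp
  ultimately show ?case using Z(1) by simp
qed (simp add: P_add_left)

lemma wedge_uminus: "aform k \<omega> \<Longrightarrow> f \<in> R \<Longrightarrow> Xs \<in> tuples (Suc k) \<Longrightarrow> W f (\<lambda>Zs. - \<omega> Zs) Xs = - W f \<omega> Xs"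
proof (induction k arbitrary: \<omega> Xs)
  case 0
  then obtain X where "Xs = [X]" "X \<in> T" by (metis tuples_SucE tuples_0)
  then show ?case
    using smul_diff[OF anchor_in zero_in, of X f "\<omega> []"] smul_zero anchor_in 0 by simp
next
  case (Suc k)
  then obtain X Ys where X: "Xs = X # Ys" "X \<in> T" "Ys \<in> tuples (Suc k)" by (metis tuples_SucE)
  have "smul (a X f) (- \<omega> Ys) = - smul (a X f) (\<omega> Ys)"
    using smul_diff[OF anchor_in[OF X(2) Suc.prems(2)] zero_in aform_in[OF Suc.prems(1) X(3)]]
      smul_zero[OF anchor_in[OF X(2) Suc.prems(2)]] by simp
  then show ?case
    using Suc.IH[OF aform_Cons[OF Suc.prems(1) X(2)] Suc.prems(2) X(3)] X(1) by simp
qed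

lemma wedge_cong:
  "Xs \<in> tuples (Suc k) \<Longrightarrow> (\<And>Ys. Ys \<in> tuples k \<Longrightarrow> \<omega> Ys = \<eta> Ys) \<Longrightarrow> W f \<omega> Xs = W f \<eta> Xs"
proof (induction k arbitrary: \<omega> \<eta> Xs)
  case 0
  then obtain X where "Xs = [X]" by (metis tuples_SucE tuples_0)
  then show ?case using 0 by simp
next
  case (Suc k)
  then obtain X Ys where X: "Xs = X # Ys" "X \<in> T" "Ys \<in> tuples (Suc k)" by (metis tuples_SucE)
  then show ?case
    using Suc.IH[OF X(3), of "\<lambda>Zs. \<omega> (X # Zs)" "\<lambda>Zs. \<eta> (X # Zs)"] Suc.prems by simp
qed

text \<open>In the inductive step the Leibniz rule of the bracket puts \<open>X\<close> into the slot of \<open>Y\<close>; moving it to the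
  front costs the sign that appears in the recursion of \<open>wedge_d\<close>.\<close>

lemma lie_deriv_left_smul:
  "X \<in> T \<Longrightarrow> f \<in> R \<Longrightarrow> aform (Suc k) \<omega> \<Longrightarrow> Xs \<in> tuples (Suc k) \<Longrightarrow>
     LD (smul f X) \<omega> Xs = smul f (LD X \<omega> Xs) + W f (\<lambda>Zs. \<omega> (X # Zs)) Xs"
proof (induction k arbitrary: \<omega> Xs)
  case 0
  then obtain Y where Y: "Xs = [Y]" "Y \<in> T" by (metis tuples_SucE tuples_0)
  have "\<omega> [b (smul f X) Y] = smul f (\<omega> [b X Y]) - smul (a Y f) (\<omega> [X])"
    using 0 Y b_in anchor_in smul_in by (simp add: b_smul_left aform_slot_diff aform_slot_smul del: aform.simps)
  moreover have "\<omega> [Y] \<in> T" "\<omega> [b X Y] \<in> T"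
    using 0 Y b_in aform_in[OF 0(3)] by simp_all
  ultimately show ?case using Y 0(1,2) by (simp add: P_smul_left smul_diff P_in)
next
  case (Suc k)
  then obtain Y Ys where Y: "Xs = Y # Ys" "Y \<in> T" "Ys \<in> tuples (Suc k)" by (metis tuples_SucE)
  note \<omega>Y = aform_Cons[OF Suc.prems(3) Y(2)]
  have "\<omega> (b (smul f X) Y # Ys) = smul f (\<omega> (b X Y # Ys)) - smul (a Y f) (\<omega> (X # Ys))"
    using Suc.prems Y b_in anchor_in smul_in by (simp add: b_smul_left aform_slot_diff aform_slot_smul del: aform.simps)
  moreover have "W f (\<lambda>Zs. \<omega> (Y # X # Zs)) Ys = - W f (\<lambda>Zs. \<omega> (X # Y # Zs)) Ys"
    unfolding wedge_uminus[OF aform_Cons[OF aform_Cons[OF Suc.prems(3,1)] Y(2)] Suc.prems(2) Y(3), symmetric]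
    by (rule wedge_cong[OF Y(3)]) (use aform_swap[OF Suc.prems(3,1) Y(2)] in simp)
  moreover have "smul f (LD X \<omega> Xs) = smul f (LD X (\<lambda>Zs. \<omega> (Y # Zs)) Ys) - smul f (\<omega> (b X Y # Ys))"
    unfolding Y(1) lie_deriv.simps
    using smul_diff[OF Suc.prems(2) lie_deriv_in[OF Suc.prems(1) \<omega>Y Y(3)] aform_in[OF Suc.prems(3)]]
      b_in[OF Suc.prems(1) Y(2)] Y(3) by simp
  ultimately show ?case
    using Suc.IH[OF Suc.prems(1,2) \<omega>Y Y(3)] Y(1) by simp
qed

text \<open>The non-tensorial terms from differentiating \<open>f \<omega>(Y, \<dots>)\<close> and from the bracket \<open>b X (f Y)\<close> cancel.\<close>

lemma aform_lie_deriv: "X \<in> T \<Longrightarrow> aform k \<omega> \<Longrightarrow> aform k (LD X \<omega>)"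
proof (induction k arbitrary: \<omega>)
  case 0
  then show ?case by (simp add: P_in)
next
  case (Suc k)
  note X = Suc.prems(1) and \<omega> = Suc.prems(2)
  show ?case
  proof (rule aform_SucI)
    fix Y assume Y: "Y \<in> T"
    show "aform k (\<lambda>Ys. LD X \<omega> (Y # Ys))"
      using aform_diff[OF Suc.IH[OF X aform_Cons[OF \<omega> Y]] aform_Cons[OF \<omega> b_in[OF X Y]]] by simp
  next
    fix Y Z Ys assume Y: "Y \<in> T" and Z: "Z \<in> T" and Ys: "Ys \<in> tuples k"
    have "LD X (\<lambda>Zs. \<omega> ((Y + Z) # Zs)) Ys = LD X (\<lambda>Zs. \<omega> (Y # Zs) + \<omega> (Z # Zs)) Ys"
      by (rule lie_deriv_cong[OF X Ys]) (rule aform_slot_add[OF \<omega> Y Z])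
    also have "\<dots> = LD X (\<lambda>Zs. \<omega> (Y # Zs)) Ys + LD X (\<lambda>Zs. \<omega> (Z # Zs)) Ys"
      by (rule lie_deriv_add[OF X aform_Cons[OF \<omega> Y] aform_Cons[OF \<omega> Z] Ys])
    finally show "LD X \<omega> ((Y + Z) # Ys) = LD X \<omega> (Y # Ys) + LD X \<omega> (Z # Ys)"
      using aform_slot_add[OF \<omega> b_in[OF X Y] b_in[OF X Z] Ys] by (simp add: b_add_right X Y Z)
  next
    fix f Y Ys assume f: "f \<in> R" and Y: "Y \<in> T" and Ys: "Ys \<in> tuples k"
    note \<omega>Y = aform_Cons[OF \<omega> Y]
    have "LD X (\<lambda>Zs. \<omega> (smul f Y # Zs)) Ys = LD X (\<lambda>Zs. smul f (\<omega> (Y # Zs))) Ys"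
      by (rule lie_deriv_cong[OF X Ys]) (rule aform_slot_smul[OF \<omega> f Y])
    also have "\<dots> = smul (a X f) (\<omega> (Y # Ys)) + smul f (LD X (\<lambda>Zs. \<omega> (Y # Zs)) Ys)"
      by (rule lie_deriv_smul[OF X f \<omega>Y Ys])
    finally have 1: "LD X (\<lambda>Zs. \<omega> (smul f Y # Zs)) Ys = \<dots>" .
    have "\<omega> (b X (smul f Y) # Ys) = smul (a X f) (\<omega> (Y # Ys)) + smul f (\<omega> (b X Y # Ys))"
      using \<omega> X Y f Ys b_in anchor_in smul_in
      by (simp add: b_smul_right aform_slot_add aform_slot_smul del: aform.simps)
    then show "LD X \<omega> (smul f Y # Ys) = smul f (LD X \<omega> (Y # Ys))"
      using 1 smul_diff[OF f lie_deriv_in[OF X \<omega>Y Ys] aform_in[OF \<omega>]] b_in[OF X Y] Ys by simp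
  next
    fix j Y Ys assume k: "k = Suc j" and Y: "Y \<in> T" and Ys: "Ys \<in> tuples j"
    have "LD X (\<lambda>Zs. \<omega> (Y # Y # Zs)) Ys = LD X (\<lambda>_. 0) Ys"
      by (rule lie_deriv_cong[OF X Ys]) (rule aform_same[OF \<omega>[unfolded k] Y])
    then show "LD X \<omega> (Y # Y # Ys) = 0"
      using aform_swap[OF \<omega>[unfolded k] Y b_in[OF X Y] Ys] lie_deriv_zero[OF X] by simp
  qed
qed

lemma cartan_d_cong:
  "Xs \<in> tuples (Suc k) \<Longrightarrow> (\<And>Ys. Ys \<in> tuples k \<Longrightarrow> \<omega> Ys = \<eta> Ys) \<Longrightarrow> d \<omega> Xs = d \<eta> Xs"
proof (induction k arbitrary: \<omega> \<eta> Xs)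
  case 0
  then obtain X where "Xs = [X]" by (metis tuples_SucE tuples_0)
  then show ?case using 0 by simp
next
  case (Suc k)
  then obtain X Ys where X: "Xs = X # Ys" "X \<in> T" "Ys \<in> tuples (Suc k)" by (metis tuples_SucE)
  then show ?case
    using Suc.IH[OF X(3), of "\<lambda>Zs. \<omega> (X # Zs)" "\<lambda>Zs. \<eta> (X # Zs)"] lie_deriv_cong[OF X(2,3), of \<omega> \<eta>] Suc.prems by simp
qed

lemma cartan_d_add:
  "aform k \<omega> \<Longrightarrow> aform k \<eta> \<Longrightarrow> Xs \<in> tuples (Suc k) \<Longrightarrow> d (\<lambda>Zs. \<omega> Zs + \<eta> Zs) Xs = d \<omega> Xs + d \<eta> Xs"
proof (induction k arbitrary: \<omega> \<eta> Xs)
  case 0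
  then obtain X where "Xs = [X]" "X \<in> T" by (metis tuples_SucE tuples_0)
  then show ?case using 0 by (simp add: P_add_right)
next
  case (Suc k)
  then obtain X Ys where X: "Xs = X # Ys" "X \<in> T" "Ys \<in> tuples (Suc k)" by (metis tuples_SucE)
  show ?case
    using Suc.IH[OF aform_Cons[OF Suc.prems(1) X(2)] aform_Cons[OF Suc.prems(2) X(2)] X(3)]
      lie_deriv_add[OF X(2) Suc.prems(1,2) X(3)] X(1) by simp
qed

lemma cartan_d_zero: "Xs \<in> tuples k \<Longrightarrow> d (\<lambda>_. 0) Xs = 0"
proof (induction k arbitrary: Xs)
  case (Suc k)
  then obtain X Ys where X: "Xs = X # Ys" "X \<in> T" "Ys \<in> tuples k" by (metis tuples_SucE)
  then show ?case using Suc.IH lie_deriv_zero by simp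
qed simp

lemma cartan_d_diff:
  assumes "aform k \<omega>" "aform k \<eta>" "Xs \<in> tuples (Suc k)"
  shows "d (\<lambda>Zs. \<omega> Zs - \<eta> Zs) Xs = d \<omega> Xs - d \<eta> Xs"
  using cartan_d_add[OF aform_diff[OF assms(1,2)] assms(2,3)] by (simp add: algebra_simps)

lemma cartan_d_in: "aform k \<omega> \<Longrightarrow> Xs \<in> tuples (Suc k) \<Longrightarrow> d \<omega> Xs \<in> T"
proof (induction k arbitrary: \<omega> Xs)
  case 0
  then obtain X where "Xs = [X]" "X \<in> T" by (metis tuples_SucE tuples_0)
  then show ?case using 0 by (simp add: P_in)
next
  case (Suc k)
  then obtain X Ys where X: "Xs = X # Ys" "X \<in> T" "Ys \<in> tuples (Suc k)" by (metis tuples_SucE)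
  then show ?case
    using Suc.IH[OF aform_Cons[OF Suc.prems(1) X(2)] X(3)] lie_deriv_in[OF X(2) Suc.prems(1) X(3)]
      diff_in by simp
qed

lemma cartan_d_smul:
  "f \<in> R \<Longrightarrow> aform k \<omega> \<Longrightarrow> Xs \<in> tuples (Suc k) \<Longrightarrow>
     d (\<lambda>Zs. smul f (\<omega> Zs)) Xs = smul f (d \<omega> Xs) + W f \<omega> Xs"
proof (induction k arbitrary: \<omega> Xs)
  case 0
  then obtain X where "Xs = [X]" "X \<in> T" by (metis tuples_SucE tuples_0)
  then show ?case using 0 by (simp add: P_smul_right)
next
  case (Suc k)
  then obtain X Ys where X: "Xs = X # Ys" "X \<in> T" "Ys \<in> tuples (Suc k)" by (metis tuples_SucE)
  note \<omega>X = aform_Cons[OF Suc.prems(2) X(2)]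
  show ?case
    using Suc.IH[OF Suc.prems(1) \<omega>X X(3)] lie_deriv_smul[OF X(2) Suc.prems(1,2) X(3)]
      smul_diff[OF Suc.prems(1) lie_deriv_in[OF X(2) Suc.prems(2) X(3)] cartan_d_in[OF \<omega>X X(3)]] X(1)
    by simp
qed

text \<open>By Cartan's formula the first slot carries two defects of linearity over functions, both equal to
  \<open>df \<and> \<iota>\<^sub>X \<omega>\<close>, with opposite signs.  For alternation, contracting twice with the same \<open>X\<close> leaves
  \<open>d \<iota>\<^sub>X \<iota>\<^sub>X \<omega> - \<iota>\<^bsub>b X X\<^esub> \<omega> = 0\<close>.\<close>

lemma aform_cartan_d: "aform k \<omega> \<Longrightarrow> aform (Suc k) (d \<omega>)"
proof (induction k arbitrary: \<omega>)
  case 0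
  then show ?case by (intro aform_SucI) (simp_all add: P_in P_add_left P_smul_left)
next
  case (Suc k)
  note \<omega> = Suc.prems
  show ?case
  proof (rule aform_SucI)
    fix X assume X: "X \<in> T"
    show "aform (Suc k) (\<lambda>Xs. d \<omega> (X # Xs))"
      using aform_diff[OF aform_lie_deriv[OF X \<omega>] Suc.IH[OF aform_Cons[OF \<omega> X]]] by simp
  next
    fix X Y Ys assume X: "X \<in> T" and Y: "Y \<in> T" and Ys: "Ys \<in> tuples (Suc k)"
    have "d (\<lambda>Zs. \<omega> ((X + Y) # Zs)) Ys = d (\<lambda>Zs. \<omega> (X # Zs) + \<omega> (Y # Zs)) Ys"
      by (rule cartan_d_cong[OF Ys]) (rule aform_slot_add[OF \<omega> X Y])
    then show "d \<omega> ((X + Y) # Ys) = d \<omega> (X # Ys) + d \<omega> (Y # Ys)"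
      using cartan_d_add[OF aform_Cons[OF \<omega> X] aform_Cons[OF \<omega> Y] Ys] lie_deriv_left_add[OF X Y \<omega> Ys] by simp
  next
    fix f X Ys assume f: "f \<in> R" and X: "X \<in> T" and Ys: "Ys \<in> tuples (Suc k)"
    note \<omega>X = aform_Cons[OF \<omega> X]
    have "d (\<lambda>Zs. \<omega> (smul f X # Zs)) Ys = d (\<lambda>Zs. smul f (\<omega> (X # Zs))) Ys"
      by (rule cartan_d_cong[OF Ys]) (rule aform_slot_smul[OF \<omega> f X])
    then show "d \<omega> (smul f X # Ys) = smul f (d \<omega> (X # Ys))"
      using cartan_d_smul[OF f \<omega>X Ys] lie_deriv_left_smul[OF X f \<omega> Ys]
        smul_diff[OF f lie_deriv_in[OF X \<omega> Ys] cartan_d_in[OF \<omega>X Ys]] by simp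
  next
    fix j X Ys assume k: "Suc k = Suc j" and X: "X \<in> T" and Ys: "Ys \<in> tuples j"
    have "d (\<lambda>Zs. \<omega> (X # X # Zs)) Ys = 0"
    proof (cases j)
      case (Suc i)
      have "d (\<lambda>Zs. \<omega> (X # X # Zs)) Ys = d (\<lambda>_. 0) Ys"
        by (rule cartan_d_cong[OF Ys[unfolded Suc]]) (use aform_same[of i \<omega> X] \<omega> X k Suc in simp)
      then show ?thesis using cartan_d_zero[OF Ys] by simp
    qed (use Ys in simp)
    then show "d \<omega> (X # X # Ys) = 0"
      using aform_slot_zero[OF \<omega>, of Ys] Ys k by (simp add: b_self X)
  qed
qed

end

text \<open>The Jacobi identity in the form that \<open>b X\<close> is a derivation of \<open>b\<close>, and its counterpart for \<open>P\<close>: the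
  derivatives form a representation of the bracket.\<close>

locale flat_anchored_connection = anchored_connection T R smul a P b
  for T :: "'v::ab_group_add set" and R :: "'r set" and smul a P b +
  assumes jacobi: "X \<in> T \<Longrightarrow> Y \<in> T \<Longrightarrow> Z \<in> T \<Longrightarrow> b (b X Y) Z = b X (b Y Z) - b Y (b X Z)"
    and flat: "X \<in> T \<Longrightarrow> Y \<in> T \<Longrightarrow> Z \<in> T \<Longrightarrow> P (b X Y) Z = P X (P Y Z) - P Y (P X Z)"
begin

lemma lie_deriv_bracket:
  "X \<in> T \<Longrightarrow> Y \<in> T \<Longrightarrow> aform k \<omega> \<Longrightarrow> Xs \<in> tuples k \<Longrightarrow>
     LD (b X Y) \<omega> Xs = LD X (LD Y \<omega>) Xs - LD Y (LD X \<omega>) Xs"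
proof (induction k arbitrary: \<omega> Xs)
  case 0
  then show ?case by (simp add: flat)
next
  case (Suc k)
  note X = Suc.prems(1) and Y = Suc.prems(2) and \<omega> = Suc.prems(3)
  obtain Z Zs where Z: "Xs = Z # Zs" "Z \<in> T" "Zs \<in> tuples k" using Suc.prems(4) by (metis tuples_SucE)
  have step: "LD X (LD Y \<omega>) Xs = LD X (LD Y (\<lambda>Ws. \<omega> (Z # Ws))) Zs - LD X (\<lambda>Ws. \<omega> (b Y Z # Ws)) Zs
      - LD Y (\<lambda>Ws. \<omega> (b X Z # Ws)) Zs + \<omega> (b Y (b X Z) # Zs)"
    if X: "X \<in> T" and Y: "Y \<in> T" for X Y
    using lie_deriv_diff[OF X aform_lie_deriv[OF Y aform_Cons[OF \<omega> Z(2)]] aform_Cons[OF \<omega> b_in[OF Y Z(2)]] Z(3)] Z(1)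
    by simp
  have "\<omega> (b (b X Y) Z # Zs) = \<omega> (b X (b Y Z) # Zs) - \<omega> (b Y (b X Z) # Zs)"
    unfolding jacobi[OF X Y Z(2)]
    using aform_slot_diff[OF \<omega> _ _ Z(3)] b_in X Y Z(2) by simp
  then show ?case
    unfolding step[OF X Y] step[OF Y X]
    using Suc.IH[OF X Y aform_Cons[OF \<omega> Z(2)] Z(3)] Z(1) by simp
qed

text \<open>Contract both sides with the head \<open>Y\<close> of the argument list.  The contractions differ by
  \<open>L\<^sub>Y L\<^sub>X - L\<^sub>X L\<^sub>Y + L\<^bsub>b X Y\<^esub>\<close>, which vanishes, and by the same identity for \<open>\<iota>\<^sub>Y \<omega>\<close>, of lower degree.\<close>

lemma cartan_d_lie_deriv:
  "X \<in> T \<Longrightarrow> aform k \<omega> \<Longrightarrow> Xs \<in> tuples (Suc k) \<Longrightarrow> d (LD X \<omega>) Xs = LD X (d \<omega>) Xs"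
proof (induction k arbitrary: \<omega> Xs)
  case 0
  then obtain Y where Y: "Xs = [Y]" "Y \<in> T" by (metis tuples_SucE tuples_0)
  then show ?case using flat[of X Y "\<omega> []"] 0 by simp
next
  case (Suc k)
  note X = Suc.prems(1) and \<omega> = Suc.prems(2)
  obtain Y Ys where Y: "Xs = Y # Ys" "Y \<in> T" "Ys \<in> tuples (Suc k)" using Suc.prems(3) by (metis tuples_SucE)
  note \<omega>Y = aform_Cons[OF \<omega> Y(2)]
  have "d (LD X \<omega>) Xs = LD Y (LD X \<omega>) Ys - (d (LD X (\<lambda>Zs. \<omega> (Y # Zs))) Ys - d (\<lambda>Zs. \<omega> (b X Y # Zs)) Ys)"
    using cartan_d_diff[OF aform_lie_deriv[OF X \<omega>Y] aform_Cons[OF \<omega> b_in[OF X Y(2)]] Y(3)] Y(1) by simp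
  moreover have "LD X (d \<omega>) Xs = LD X (LD Y \<omega>) Ys - LD X (d (\<lambda>Zs. \<omega> (Y # Zs))) Ys
      - (LD (b X Y) \<omega> Ys - d (\<lambda>Zs. \<omega> (b X Y # Zs)) Ys)"
    using lie_deriv_diff[OF X aform_lie_deriv[OF Y(2) \<omega>] aform_cartan_d[OF \<omega>Y] Y(3)] Y(1) by simp
  ultimately show ?case
    using Suc.IH[OF X \<omega>Y Y(3)] lie_deriv_bracket[OF X Y(2) \<omega> Y(3)] by simp
qed

text \<open>Contracting with \<open>X\<close> gives \<open>L\<^sub>X d \<omega> - d (L\<^sub>X \<omega> - d \<iota>\<^sub>X \<omega>)\<close>, which is \<open>d d \<iota>\<^sub>X \<omega>\<close> because \<open>d\<close> commutes
  with \<open>L\<^sub>X\<close>.\<close>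

theorem cartan_d_square: "aform k \<omega> \<Longrightarrow> Xs \<in> tuples (Suc (Suc k)) \<Longrightarrow> d (d \<omega>) Xs = 0"
proof (induction k arbitrary: \<omega> Xs)
  case 0
  then obtain X Y where "Xs = [X, Y]" "X \<in> T" "Y \<in> T" by (metis tuples_SucE tuples_0)
  then show ?case using flat[of X Y "\<omega> []"] 0 P_diff P_zero P_in by simp
next
  case (Suc k)
  note \<omega> = Suc.prems(1)
  obtain X Ys where X: "Xs = X # Ys" "X \<in> T" "Ys \<in> tuples (Suc (Suc k))" using Suc.prems(2) by (metis tuples_SucE)
  note \<omega>X = aform_Cons[OF \<omega> X(2)]
  have "d (\<lambda>Zs. d \<omega> (X # Zs)) Ys = d (LD X \<omega>) Ys - d (d (\<lambda>Zs. \<omega> (X # Zs))) Ys"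
    using cartan_d_diff[OF aform_lie_deriv[OF X(2) \<omega>] aform_cartan_d[OF \<omega>X] X(3)] by simp
  then show ?case
    using cartan_d_lie_deriv[OF X(2) \<omega> X(3)] Suc.IH[OF \<omega>X X(3)] X(1) by simp
qed

end

context form_module
begin

text \<open>The repeated entry is moved towards the front by transpositions of adjacent arguments.\<close>

lemma aform_repeat:
  "aform (Suc k) \<omega> \<Longrightarrow> X \<in> T \<Longrightarrow> Xs \<in> tuples k \<Longrightarrow> X \<in> set Xs \<Longrightarrow> \<omega> (X # Xs) = 0"
proof (induction k arbitrary: \<omega> Xs)
  case (Suc k)
  obtain Y Ys where Y: "Xs = Y # Ys" "Y \<in> T" "Ys \<in> tuples k" using Suc.prems(3) by (metis tuples_SucE)
  show ?case
  proof (cases "X = Y")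
    case True
    then show ?thesis using aform_same[OF Suc.prems(1,2) Y(3)] Y(1) by simp
  next
    case False
    then have "\<omega> (Y # X # Ys) = 0"
      using Suc.IH[OF aform_Cons[OF Suc.prems(1) Y(2)] Suc.prems(2) Y(3)] Suc.prems(4) Y(1) by simp
    then show ?thesis using aform_swap[OF Suc.prems(1) Y(2) Suc.prems(2) Y(3)] Y(1) by simp
  qed
qed simp

lemma aform_alternating:
  "aform k \<omega> \<Longrightarrow> Xs \<in> tuples k \<Longrightarrow> i < j \<Longrightarrow> j < k \<Longrightarrow> Xs ! i = Xs ! j \<Longrightarrow> \<omega> Xs = 0"
proof (induction k arbitrary: \<omega> Xs i j)
  case (Suc k)
  obtain Y Ys where Y: "Xs = Y # Ys" "Y \<in> T" "Ys \<in> tuples k" using Suc.prems(2) by (metis tuples_SucE)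
  obtain j' where j: "j = Suc j'" using Suc.prems(3) by (cases j) auto
  show ?case
  proof (cases i)
    case 0
    then have "Y \<in> set Ys" using Suc.prems(4,5) Y j by (simp add: tuples_def)
    then show ?thesis using aform_repeat[OF Suc.prems(1) Y(2,3)] Y(1) by simp
  next
    case (Suc i')
    then show ?thesis
      using Suc.IH[OF aform_Cons[OF Suc.prems(1) Y(2)] Y(3), of i' j'] Suc.prems(3-5) Y(1) j by simp
  qed
qed simp

lemma aform_update_add:
  "aform k \<omega> \<Longrightarrow> Xs \<in> tuples k \<Longrightarrow> i < k \<Longrightarrow> X \<in> T \<Longrightarrow> Y \<in> T \<Longrightarrow>
     \<omega> (Xs[i := X + Y]) = \<omega> (Xs[i := X]) + \<omega> (Xs[i := Y])"
proof (induction k arbitrary: \<omega> Xs i)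
  case (Suc k)
  obtain Z Zs where Z: "Xs = Z # Zs" "Z \<in> T" "Zs \<in> tuples k" using Suc.prems(2) by (metis tuples_SucE)
  show ?case
  proof (cases i)
    case 0
    then show ?thesis using aform_slot_add[OF Suc.prems(1,4,5) Z(3)] Z(1) by simp
  next
    case (Suc i')
    then show ?thesis
      using Suc.IH[OF aform_Cons[OF Suc.prems(1) Z(2)] Z(3), of i'] Suc.prems(3-5) Z(1) by simp
  qed
qed simp

lemma aform_update_smul:
  "aform k \<omega> \<Longrightarrow> Xs \<in> tuples k \<Longrightarrow> i < k \<Longrightarrow> f \<in> R \<Longrightarrow> X \<in> T \<Longrightarrow>
     \<omega> (Xs[i := smul f X]) = smul f (\<omega> (Xs[i := X]))"
proof (induction k arbitrary: \<omega> Xs i)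
  case (Suc k)
  obtain Z Zs where Z: "Xs = Z # Zs" "Z \<in> T" "Zs \<in> tuples k" using Suc.prems(2) by (metis tuples_SucE)
  show ?case
  proof (cases i)
    case 0
    then show ?thesis using aform_slot_smul[OF Suc.prems(1,4,5) Z(3)] Z(1) by simp
  next
    case (Suc i')
    then show ?thesis
      using Suc.IH[OF aform_Cons[OF Suc.prems(1) Z(2)] Z(3), of i'] Suc.prems(3-5) Z(1) by simp
  qed
qed simp

lemma aformI:
  "(\<And>Xs. Xs \<in> tuples k \<Longrightarrow> \<omega> Xs \<in> T) \<Longrightarrow>
   (\<And>Xs i X Y. Xs \<in> tuples k \<Longrightarrow> i < k \<Longrightarrow> X \<in> T \<Longrightarrow> Y \<in> T \<Longrightarrow>
      \<omega> (Xs[i := X + Y]) = \<omega> (Xs[i := X]) + \<omega> (Xs[i := Y])) \<Longrightarrow>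
   (\<And>Xs i f X. Xs \<in> tuples k \<Longrightarrow> i < k \<Longrightarrow> f \<in> R \<Longrightarrow> X \<in> T \<Longrightarrow> \<omega> (Xs[i := smul f X]) = smul f (\<omega> (Xs[i := X]))) \<Longrightarrow>
   (\<And>Xs i j. Xs \<in> tuples k \<Longrightarrow> i < j \<Longrightarrow> j < k \<Longrightarrow> Xs ! i = Xs ! j \<Longrightarrow> \<omega> Xs = 0) \<Longrightarrow>
   aform k \<omega>"
proof (induction k arbitrary: \<omega>)
  case (Suc k)
  show ?case
  proof (rule aform_SucI)
    fix X assume X: "X \<in> T"
    show "aform k (\<lambda>Xs. \<omega> (X # Xs))"
    proof (rule Suc.IH)
      fix Xs assume Xs: "Xs \<in> tuples k"
      then have XXs: "X # Xs \<in> tuples (Suc k)" using X by simp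
      show "\<omega> (X # Xs) \<in> T" using Suc.prems(1) XXs by blast
      fix i
      show "\<omega> (X # Xs[i := Y + Z]) = \<omega> (X # Xs[i := Y]) + \<omega> (X # Xs[i := Z])"
        if "i < k" "Y \<in> T" "Z \<in> T" for Y Z
        using Suc.prems(2)[OF XXs _ that(2,3), of "Suc i"] that(1) by simp
      show "\<omega> (X # Xs[i := smul f Y]) = smul f (\<omega> (X # Xs[i := Y]))" if "i < k" "f \<in> R" "Y \<in> T" for f Y
        using Suc.prems(3)[OF XXs _ that(2,3), of "Suc i"] that(1) by simp
      show "\<omega> (X # Xs) = 0" if "i < j" "j < k" "Xs ! i = Xs ! j" for j
        using Suc.prems(4)[OF XXs, of "Suc i" "Suc j"] that by simp
    qed
  next
    fix X Y Xs assume *: "X \<in> T" "Y \<in> T" "Xs \<in> tuples k"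
    then show "\<omega> ((X + Y) # Xs) = \<omega> (X # Xs) + \<omega> (Y # Xs)"
      using Suc.prems(2)[of "X # Xs" 0 X Y] by simp
  next
    fix f X Xs assume *: "f \<in> R" "X \<in> T" "Xs \<in> tuples k"
    then show "\<omega> (smul f X # Xs) = smul f (\<omega> (X # Xs))"
      using Suc.prems(3)[of "X # Xs" 0 f X] by simp
  next
    fix j X Xs assume *: "k = Suc j" "X \<in> T" "Xs \<in> tuples j"
    then show "\<omega> (X # X # Xs) = 0"
      using Suc.prems(4)[of "X # X # Xs" 0 1] by simp
  qed
qed simp

end

lemma omit_0 [simp]: "omit 0 (x # xs) = xs"
  by (simp add: omit_def)

lemma omit_Suc [simp]: "omit (Suc i) (x # xs) = x # omit i xs"
  by (simp add: omit_def)

lemma length_omit: "i < length xs \<Longrightarrow> length (omit i xs) = length xs - 1"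
  by (simp add: omit_def)

lemma set_omit_subset: "set (omit i xs) \<subseteq> set xs"
  by (auto simp: omit_def dest: in_set_takeD in_set_dropD)

lemma map_omit: "omit i (map f xs) = map f (omit i xs)"
  by (simp add: omit_def take_map drop_map)

definition alt_sign :: "nat \<Rightarrow> 'v::ab_group_add \<Rightarrow> 'v" where
  "alt_sign n x = (if even n then x else - x)"

lemma alt_sign_simps [simp]: "alt_sign 0 x = x" "alt_sign (Suc 0) x = - x"
  by (simp_all add: alt_sign_def)

lemma alt_sign_Suc: "alt_sign (Suc n) x = - alt_sign n x"
  by (simp add: alt_sign_def)

context anchored_connection
begin

lemma omit_tuples: "Xs \<in> tuples (Suc k) \<Longrightarrow> i \<le> k \<Longrightarrow> omit i Xs \<in> tuples k"
  using set_omit_subset[of i Xs] length_omit[of i Xs] by (auto simp: tuples_def)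

lemma tuples_nth: "Xs \<in> tuples k \<Longrightarrow> i < k \<Longrightarrow> Xs ! i \<in> T"
  by (auto simp: tuples_def)

text \<open>The sign of the \<open>j\<close>-th term comes from moving the bracket from its slot to the front.\<close>

lemma lie_deriv_explicit:
  "X \<in> T \<Longrightarrow> aform k \<omega> \<Longrightarrow> Xs \<in> tuples k \<Longrightarrow>
    LD X \<omega> Xs = P X (\<omega> Xs) + (\<Sum>j<k. alt_sign (Suc j) (\<omega> (b X (Xs ! j) # omit j Xs)))"
proof (induction k arbitrary: \<omega> Xs)
  case (Suc k)
  note X = Suc.prems(1) and \<omega> = Suc.prems(2)
  obtain Y Ys where Y: "Xs = Y # Ys" "Y \<in> T" "Ys \<in> tuples k" using Suc.prems(3) by (metis tuples_SucE)
  have "alt_sign (Suc j) (\<omega> (Y # b X (Ys ! j) # omit j Ys))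
      = alt_sign (Suc (Suc j)) (\<omega> (b X (Ys ! j) # Y # omit j Ys))" if "j < k" for j
  proof -
    from that obtain k' where k: "k = Suc k'" by (cases k) auto
    show ?thesis
      using aform_swap[OF \<omega>[unfolded k] b_in[OF X tuples_nth[OF Y(3) that]] Y(2) omit_tuples[OF Y(3)[unfolded k]], of j]
        that k by (simp add: alt_sign_def)
  qed
  then show ?case
    using Suc.IH[OF X aform_Cons[OF \<omega> Y(2)] Y(3)] Y(1)
    by (simp add: sum.lessThan_Suc_shift del: sum.lessThan_Suc)
qed simp

text \<open>The terms with \<open>i = 0\<close> in both sums of the Koszul formula add up to the Lie derivative along the
  first argument; the remaining terms are those of the contracted form, with all signs
  reversed because the indices shift by one or the contracted argument passes the bracket.\<close>

theorem cartan_d_explicit: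
  "aform k \<omega> \<Longrightarrow> Xs \<in> tuples (Suc k) \<Longrightarrow>
    d \<omega> Xs = (\<Sum>i\<le>k. alt_sign i (P (Xs ! i) (\<omega> (omit i Xs))))
      + (\<Sum>j\<le>k. \<Sum>i<j. alt_sign (i + j) (\<omega> (b (Xs ! i) (Xs ! j) # omit i (omit j Xs))))"
proof (induction k arbitrary: \<omega> Xs)
  case 0
  then obtain X where "Xs = [X]" by (metis tuples_SucE tuples_0)
  then show ?case by (simp add: alt_sign_def)
next
  case (Suc k)
  note \<omega> = Suc.prems(1)
  obtain X Ys where X: "Xs = X # Ys" "X \<in> T" "Ys \<in> tuples (Suc k)" using Suc.prems(2) by (metis tuples_SucE)
  let ?p = "\<lambda>i. alt_sign i (P (Ys ! i) (\<omega> (X # omit i Ys)))"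
  let ?q = "\<lambda>i j. alt_sign (i + j) (\<omega> (X # b (Ys ! i) (Ys ! j) # omit i (omit j Ys)))"
  let ?l = "\<lambda>j. alt_sign (Suc j) (\<omega> (b X (Ys ! j) # omit j Ys))"
  let ?r = "\<lambda>i j. alt_sign (i + j) (\<omega> (b (Xs ! i) (Xs ! j) # omit i (omit j Xs)))"
  have 1: "(\<Sum>i\<le>Suc k. alt_sign i (P (Xs ! i) (\<omega> (omit i Xs)))) = P X (\<omega> Ys) - (\<Sum>i\<le>k. ?p i)"
    unfolding sum.atMost_Suc_shift by (simp add: X(1) alt_sign_Suc sum_negf)
  have swap: "?r (Suc i) (Suc j) = - ?q i j" if "i < j" "j \<le> k" for i j
  proof -
    from that obtain k' where k: "k = Suc k'" by (cases k) auto
    have "omit i (omit j Ys) \<in> tuples k'"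
      using omit_tuples[OF omit_tuples[OF X(3)[unfolded k]]] that k by simp
    then show ?thesis
      using aform_swap[OF \<omega>[unfolded k] b_in X(2)] tuples_nth[OF X(3)] that X(1)
      by (simp add: alt_sign_def)
  qed
  have "(\<Sum>j\<le>Suc k. \<Sum>i<j. ?r i j) = (\<Sum>j\<le>k. \<Sum>i<Suc j. ?r i (Suc j))"
    unfolding sum.atMost_Suc_shift by simp
  also have "\<dots> = (\<Sum>j\<le>k. ?l j - (\<Sum>i<j. ?q i j))"
  proof (rule sum.cong)
    fix j assume "j \<in> {..k}"
    then have "(\<Sum>i<j. ?r (Suc i) (Suc j)) = (\<Sum>i<j. - ?q i j)" using swap by (intro sum.cong) auto
    then show "(\<Sum>i<Suc j. ?r i (Suc j)) = ?l j - (\<Sum>i<j. ?q i j)"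
      unfolding sum.lessThan_Suc_shift by (simp add: X(1) sum_negf)
  qed simp
  finally have 2: "(\<Sum>j\<le>Suc k. \<Sum>i<j. ?r i j) = (\<Sum>j\<le>k. ?l j) - (\<Sum>j\<le>k. \<Sum>i<j. ?q i j)"
    by (simp add: sum_subtractf)
  have "d \<omega> Xs = (P X (\<omega> Ys) + (\<Sum>j\<le>k. ?l j)) - ((\<Sum>i\<le>k. ?p i) + (\<Sum>j\<le>k. \<Sum>i<j. ?q i j))"
    using lie_deriv_explicit[OF X(2) \<omega> X(3)] Suc.IH[OF aform_Cons[OF \<omega> X(2)] X(3)]
    by (simp add: X(1) lessThan_Suc_atMost)
  then show ?case unfolding 1 2 by simp
qed

end

context form_module
begin

text \<open>Each term of the Koszul formula contains exactly one of \<open>P\<close> and \<open>b\<close>, so the differential is additive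
  in the pair.\<close>

lemma cartan_d_pencil:
  assumes "anchored_connection T R smul a P b" "anchored_connection T R smul a' P' b'"
    and "aform k \<omega>" "Xs \<in> tuples (Suc k)"
  shows "cartan_d (\<lambda>X Y. P X Y + P' X Y) (\<lambda>X Y. b X Y + b' X Y) \<omega> Xs = cartan_d P b \<omega> Xs + cartan_d P' b' \<omega> Xs"
proof -
  interpret A: anchored_connection T R smul a P b by fact
  interpret B: anchored_connection T R smul a' P' b' by fact
  have lie: "lie_deriv (\<lambda>X Y. P X Y + P' X Y) (\<lambda>X Y. b X Y + b' X Y) X \<omega> Xs
      = lie_deriv P b X \<omega> Xs + lie_deriv P' b' X \<omega> Xs"
    if "X \<in> T" "aform k \<omega>" "Xs \<in> tuples k" for X \<omega> Xs k
    using that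
  proof (induction k arbitrary: \<omega> Xs)
    case (Suc k)
    then obtain Y Ys where Y: "Xs = Y # Ys" "Y \<in> T" "Ys \<in> tuples k" by (metis tuples_SucE)
    show ?case
      using Suc.IH[OF Suc.prems(1) aform_Cons[OF Suc.prems(2) Y(2)] Y(3)]
        aform_slot_add[OF Suc.prems(2) A.b_in B.b_in Y(3)] Suc.prems(1) Y(1,2) by simp
  qed simp
  show ?thesis
    using assms(3,4)
  proof (induction k arbitrary: \<omega> Xs)
    case 0
    then obtain X where "Xs = [X]" by (metis tuples_SucE tuples_0)
    then show ?case by simp
  next
    case (Suc k)
    then obtain X Ys where X: "Xs = X # Ys" "X \<in> T" "Ys \<in> tuples (Suc k)" by (metis tuples_SucE)
    show ?case
      using Suc.IH[OF aform_Cons[OF Suc.prems(1) X(2)] X(3)] lie[OF X(2) Suc.prems(1) X(3)] X(1) by simp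
  qed
qed

text \<open>The square of the sum of two differentials of square zero is their anticommutator.\<close>

theorem cartan_d_anticommute:
  assumes A: "flat_anchored_connection T R smul a P b" and B: "flat_anchored_connection T R smul a' P' b'"
    and C: "flat_anchored_connection T R smul c (\<lambda>X Y. P X Y + P' X Y) (\<lambda>X Y. b X Y + b' X Y)"
    and \<omega>: "aform k \<omega>" and Xs: "Xs \<in> tuples (Suc (Suc k))"
  shows "cartan_d P b (cartan_d P' b' \<omega>) Xs + cartan_d P' b' (cartan_d P b \<omega>) Xs = 0"
proof -
  interpret A: flat_anchored_connection T R smul a P b by fact
  interpret B: flat_anchored_connection T R smul a' P' b' by fact
  interpret C: flat_anchored_connection T R smul c "\<lambda>X Y. P X Y + P' X Y" "\<lambda>X Y. b X Y + b' X Y" by fact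
  note pencil = cartan_d_pencil[OF A.anchored_connection_axioms B.anchored_connection_axioms]
  note dA = A.aform_cartan_d[OF \<omega>] and dB = B.aform_cartan_d[OF \<omega>]
  have "0 = C.d (C.d \<omega>) Xs"
    using C.cartan_d_square[OF \<omega> Xs] by simp
  also have "\<dots> = C.d (\<lambda>Ys. A.d \<omega> Ys + B.d \<omega> Ys) Xs"
    by (rule C.cartan_d_cong[OF Xs]) (rule pencil[OF \<omega>])
  also have "\<dots> = C.d (A.d \<omega>) Xs + C.d (B.d \<omega>) Xs"
    by (rule C.cartan_d_add[OF dA dB Xs])
  also have "\<dots> = A.d (B.d \<omega>) Xs + B.d (A.d \<omega>) Xs"
    using pencil[OF dA Xs] pencil[OF dB Xs] A.cartan_d_square[OF \<omega> Xs] B.cartan_d_square[OF \<omega> Xs]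
    by (simp add: add.commute)
  finally show ?thesis by simp
qed

end


section \<open>The algebra of bi-flat structures\<close>

text \<open>The data of a bi-flat F-manifold over one open set, reduced to the identities that the argument
  rests on.  Here \<open>D_flat\<close> and \<open>D_mult\<close> are the coefficients of the flatness of \<open>D - c \<star>\<close> at the powers
  \<open>0\<close> and \<open>1\<close> of \<open>c\<close>, and \<open>E_cancel\<close> comes from the invertibility of \<open>E \<star>\<close>.\<close>

locale bi_flat_algebra =
  fixes T :: "'v::ab_group_add set" and br :: "'v \<Rightarrow> 'v \<Rightarrow> 'v"
    and m :: "'v \<Rightarrow> 'v \<Rightarrow> 'v" (infixl \<open>\<star>\<close> 70)
    and D :: "'v \<Rightarrow> 'v \<Rightarrow> 'v" and D' :: "'v \<Rightarrow> 'v \<Rightarrow> 'v" and e :: 'v and E :: 'v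
  assumes zero_in: "0 \<in> T"
    and add_in: "X \<in> T \<Longrightarrow> Y \<in> T \<Longrightarrow> X + Y \<in> T"
    and uminus_in: "X \<in> T \<Longrightarrow> - X \<in> T"
    and br_in: "X \<in> T \<Longrightarrow> Y \<in> T \<Longrightarrow> br X Y \<in> T"
    and br_self: "X \<in> T \<Longrightarrow> br X X = 0"
    and br_add: "X \<in> T \<Longrightarrow> Y \<in> T \<Longrightarrow> Z \<in> T \<Longrightarrow> br X (Y + Z) = br X Y + br X Z"
    and br_anti: "X \<in> T \<Longrightarrow> Y \<in> T \<Longrightarrow> br Y X = - br X Y"
    and jacobi: "X \<in> T \<Longrightarrow> Y \<in> T \<Longrightarrow> Z \<in> T \<Longrightarrow> br (br X Y) Z = br X (br Y Z) - br Y (br X Z)"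
    and m_in: "X \<in> T \<Longrightarrow> Y \<in> T \<Longrightarrow> X \<star> Y \<in> T"
    and m_add_left: "X \<in> T \<Longrightarrow> Y \<in> T \<Longrightarrow> Z \<in> T \<Longrightarrow> (X + Y) \<star> Z = X \<star> Z + Y \<star> Z"
    and m_comm: "X \<in> T \<Longrightarrow> Y \<in> T \<Longrightarrow> X \<star> Y = Y \<star> X"
    and m_assoc: "X \<in> T \<Longrightarrow> Y \<in> T \<Longrightarrow> Z \<in> T \<Longrightarrow> X \<star> Y \<star> Z = X \<star> (Y \<star> Z)"
    and e_in: "e \<in> T"
    and m_unit: "X \<in> T \<Longrightarrow> e \<star> X = X"
    and hertling_manin: "X \<in> T \<Longrightarrow> Y \<in> T \<Longrightarrow> Z \<in> T \<Longrightarrow> W \<in> T \<Longrightarrow>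
      br (X \<star> Y) (W \<star> Z) - br (X \<star> Y) Z \<star> W - br (X \<star> Y) W \<star> Z
      - X \<star> br Y (Z \<star> W) + X \<star> (br Y Z \<star> W) + X \<star> (br Y W \<star> Z)
      - Y \<star> br X (Z \<star> W) + Y \<star> (br X Z \<star> W) + Y \<star> (br X W \<star> Z) = 0"
    and E_in: "E \<in> T"
    and euler: "X \<in> T \<Longrightarrow> Y \<in> T \<Longrightarrow> br E (X \<star> Y) - br E X \<star> Y - X \<star> br E Y = X \<star> Y"
    and E_cancel: "X \<in> T \<Longrightarrow> Y \<in> T \<Longrightarrow> E \<star> X = E \<star> Y \<Longrightarrow> X = Y"
    and D_in: "X \<in> T \<Longrightarrow> Y \<in> T \<Longrightarrow> D X Y \<in> T"
    and D_add_left: "X \<in> T \<Longrightarrow> Y \<in> T \<Longrightarrow> Z \<in> T \<Longrightarrow> D (X + Y) Z = D X Z + D Y Z"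
    and D_add: "X \<in> T \<Longrightarrow> Y \<in> T \<Longrightarrow> Z \<in> T \<Longrightarrow> D X (Y + Z) = D X Y + D X Z"
    and D_flat: "X \<in> T \<Longrightarrow> Y \<in> T \<Longrightarrow> Z \<in> T \<Longrightarrow> D (br X Y) Z = D X (D Y Z) - D Y (D X Z)"
    and D_torsion: "X \<in> T \<Longrightarrow> Y \<in> T \<Longrightarrow> D X Y - D Y X = br X Y"
    and D_mult: "X \<in> T \<Longrightarrow> Y \<in> T \<Longrightarrow> Z \<in> T \<Longrightarrow>
      br X Y \<star> Z = D X (Y \<star> Z) - Y \<star> D X Z - D Y (X \<star> Z) + X \<star> D Y Z"
    and D'_in: "X \<in> T \<Longrightarrow> Y \<in> T \<Longrightarrow> D' X Y \<in> T"
    and D'_add: "X \<in> T \<Longrightarrow> Y \<in> T \<Longrightarrow> Z \<in> T \<Longrightarrow> D' X (Y + Z) = D' X Y + D' X Z"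
    and D'_flat: "X \<in> T \<Longrightarrow> Y \<in> T \<Longrightarrow> Z \<in> T \<Longrightarrow> D' (br X Y) Z = D' X (D' Y Z) - D' Y (D' X Z)"
    and D'_E: "X \<in> T \<Longrightarrow> D' X E = 0"
    and compat: "X \<in> T \<Longrightarrow> Y \<in> T \<Longrightarrow> Z \<in> T \<Longrightarrow>
      D Y (X \<star> Z) - D Z (X \<star> Y) = D' Y (X \<star> Z) - D' Z (X \<star> Y)"
begin

lemma diff_in: "X \<in> T \<Longrightarrow> Y \<in> T \<Longrightarrow> X - Y \<in> T"
  using add_in[OF _ uminus_in, of X Y] by simp

lemmas closed = add_in diff_in br_in m_in D_in D'_in E_in e_in

lemma br_diff: "X \<in> T \<Longrightarrow> Y \<in> T \<Longrightarrow> Z \<in> T \<Longrightarrow> br X (Y - Z) = br X Y - br X Z"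
  using br_add[of X "Y - Z" Z] diff_in by (simp add: algebra_simps)

lemma br_add_left: "X \<in> T \<Longrightarrow> Y \<in> T \<Longrightarrow> Z \<in> T \<Longrightarrow> br (X + Y) Z = br X Z + br Y Z"
  using br_anti[of Z "X + Y"] br_anti[of Z X] br_anti[of Z Y] br_add[of Z X Y] add_in by simp

lemma br_diff_left: "X \<in> T \<Longrightarrow> Y \<in> T \<Longrightarrow> Z \<in> T \<Longrightarrow> br (X - Y) Z = br X Z - br Y Z"
  using br_add_left[of "X - Y" Y Z] diff_in by (simp add: algebra_simps)

lemma m_add: "X \<in> T \<Longrightarrow> Y \<in> T \<Longrightarrow> Z \<in> T \<Longrightarrow> X \<star> (Y + Z) = X \<star> Y + X \<star> Z"
  using m_add_left[of Y Z X] m_comm[of X] add_in by simp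

lemma m_diff: "X \<in> T \<Longrightarrow> Y \<in> T \<Longrightarrow> Z \<in> T \<Longrightarrow> X \<star> (Y - Z) = X \<star> Y - X \<star> Z"
  using m_add[of X "Y - Z" Z] diff_in by (simp add: algebra_simps)

lemma m_diff_left: "X \<in> T \<Longrightarrow> Y \<in> T \<Longrightarrow> Z \<in> T \<Longrightarrow> (X - Y) \<star> Z = X \<star> Z - Y \<star> Z"
  using m_diff[of Z X Y] m_comm[of Z] diff_in by simp

lemma m_zero: "X \<in> T \<Longrightarrow> X \<star> 0 = 0"
  using m_diff[of X X X] by simp

lemma m_left_comm: "X \<in> T \<Longrightarrow> Y \<in> T \<Longrightarrow> Z \<in> T \<Longrightarrow> X \<star> (Y \<star> Z) = Y \<star> (X \<star> Z)"
  using m_assoc[of X Y Z] m_assoc[of Y X Z] m_comm[of X Y] by simp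

lemma D_diff: "X \<in> T \<Longrightarrow> Y \<in> T \<Longrightarrow> Z \<in> T \<Longrightarrow> D X (Y - Z) = D X Y - D X Z"
  using D_add[of X "Y - Z" Z] diff_in by (simp add: algebra_simps)

lemma D_diff_left: "X \<in> T \<Longrightarrow> Y \<in> T \<Longrightarrow> Z \<in> T \<Longrightarrow> D (X - Y) Z = D X Z - D Y Z"
  using D_add_left[of "X - Y" Y Z] diff_in by (simp add: algebra_simps)

lemma D'_diff: "X \<in> T \<Longrightarrow> Y \<in> T \<Longrightarrow> Z \<in> T \<Longrightarrow> D' X (Y - Z) = D' X Y - D' X Z"
  using D'_add[of X "Y - Z" Z] diff_in by (simp add: algebra_simps)

text \<open>The bracket \<open>[X,Y]\<^sub>L\<close> of the endomorphism \<open>L = E \<star>\<close>.\<close>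

definition brE :: "'v \<Rightarrow> 'v \<Rightarrow> 'v" where
  "brE X Y = br (E \<star> X) Y + br X (E \<star> Y) - E \<star> br X Y"

lemma brE_in: "X \<in> T \<Longrightarrow> Y \<in> T \<Longrightarrow> brE X Y \<in> T"
  by (simp add: brE_def closed)

text \<open>Vanishing of the Nijenhuis torsion of \<open>E \<star>\<close>: expand \<open>[E \<star> X, Y \<star> E]\<close> by the Hertling-Manin identity;
  the brackets with \<open>E\<close> that it produces are evaluated by the Euler property, and what they contribute
  cancels.\<close>

lemma nijenhuis:
  assumes X: "X \<in> T" and Y: "Y \<in> T"
  shows "br (E \<star> X) (E \<star> Y) = E \<star> brE X Y"
proof -
  \<comment> \<open>\<open>E\<close> commutes with itself, so the Euler identity at \<open>(E, X)\<close> and \<open>(Y, E)\<close> evaluates all brackets with \<open>E\<close>\<close>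
  have EE: "br E E = 0" by (rule br_self[OF E_in])
  have e1: "br E (E \<star> X) = E \<star> br E X + E \<star> X"
    using euler[OF E_in X] m_zero[OF X] m_comm[OF X zero_in] by (simp add: EE algebra_simps)
  have e1': "br (E \<star> X) E = - (E \<star> br E X + E \<star> X)"
    using br_anti[OF E_in m_in[OF E_in X]] e1 by simp
  have e2: "br E (Y \<star> E) = br E Y \<star> E + Y \<star> E"
    using euler[OF Y E_in] m_zero[OF Y] by (simp add: EE algebra_simps)
  have "br (E \<star> X) (E \<star> Y) - br (E \<star> X) Y \<star> E - br (E \<star> X) E \<star> Y
      - E \<star> br X (Y \<star> E) + E \<star> (br X Y \<star> E) + E \<star> (br X E \<star> Y)
      - X \<star> br E (Y \<star> E) + X \<star> (br E Y \<star> E) + X \<star> (br E E \<star> Y) = 0"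
    by (rule hertling_manin[OF E_in X Y E_in])
  moreover have "br (E \<star> X) E \<star> Y = - (E \<star> (br E X \<star> Y)) - E \<star> (X \<star> Y)"
    using m_diff_left[of "- (E \<star> br E X)" "E \<star> X" Y] m_diff_left[of 0 "E \<star> br E X" Y] m_zero[OF Y] m_comm[OF Y zero_in]
    unfolding e1' using X Y by (simp add: closed uminus_in zero_in m_assoc)
  moreover have "E \<star> (br X E \<star> Y) = - (E \<star> (br E X \<star> Y))"
    using m_diff_left[of 0 "br E X" Y] m_diff[of E 0 "br E X \<star> Y"] m_zero[OF Y] m_comm[OF Y zero_in] m_zero[OF E_in]
      br_anti[OF E_in X] X Y by (simp add: closed zero_in)
  moreover have "X \<star> br E (Y \<star> E) = X \<star> (br E Y \<star> E) + E \<star> (X \<star> Y)"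
    unfolding e2 using X Y by (simp add: closed m_add m_comm[OF Y E_in] m_left_comm[OF X E_in Y])
  moreover have "X \<star> (br E E \<star> Y) = 0"
    using EE m_zero X Y m_comm[OF Y zero_in] by simp
  moreover have "E \<star> brE X Y = E \<star> br (E \<star> X) Y + E \<star> br X (E \<star> Y) - E \<star> (E \<star> br X Y)"
    unfolding brE_def using X Y by (simp add: closed m_add m_diff)
  moreover have "br (E \<star> X) Y \<star> E = E \<star> br (E \<star> X) Y" "br X Y \<star> E = E \<star> br X Y" "Y \<star> E = E \<star> Y"
    using X Y m_comm closed by simp_all
  ultimately have "br (E \<star> X) (E \<star> Y) + E \<star> (E \<star> br X Y) = E \<star> brE X Y + E \<star> (E \<star> br X Y)"
    by (simp add: algebra_simps)
  then show ?thesis by simp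
qed

text \<open>By the vanishing of the torsion, \<open>E \<star>\<close> carries the deformed bracket to the original one, and it is
  injective.\<close>

lemma brE_jacobi:
  assumes X: "X \<in> T" and Y: "Y \<in> T" and Z: "Z \<in> T"
  shows "brE (brE X Y) Z = brE X (brE Y Z) - brE Y (brE X Z)"
proof (rule E_cancel)
  show "brE (brE X Y) Z \<in> T" "brE X (brE Y Z) - brE Y (brE X Z) \<in> T"
    using X Y Z by (simp_all add: brE_in closed)
  have "E \<star> brE (brE X Y) Z = br (br (E \<star> X) (E \<star> Y)) (E \<star> Z)"
    using X Y Z by (simp add: nijenhuis brE_in flip: nijenhuis)
  also have "\<dots> = br (E \<star> X) (br (E \<star> Y) (E \<star> Z)) - br (E \<star> Y) (br (E \<star> X) (E \<star> Z))"
    using X Y Z by (intro jacobi) (simp_all add: closed)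
  also have "\<dots> = E \<star> (brE X (brE Y Z) - brE Y (brE X Z))"
    using X Y Z by (simp add: nijenhuis brE_in m_diff closed)
  finally show "E \<star> brE (brE X Y) Z = E \<star> (brE X (brE Y Z) - brE Y (brE X Z))" .
qed

text \<open>This is the sum of the Jacobi identities of the triples obtained by applying \<open>E \<star>\<close> to one of the
  three arguments, minus the image under \<open>E \<star>\<close> of the Jacobi identity of \<open>X, Y, Z\<close>.\<close>

lemma mixed_jacobi:
  assumes "X \<in> T" and "Y \<in> T" and "Z \<in> T"
  shows "brE (br X Y) Z + br (brE X Y) Z
    = brE X (br Y Z) + br X (brE Y Z) - (brE Y (br X Z) + br Y (brE X Z))"
  using assms unfolding brE_def
  by (simp add: closed jacobi br_add br_diff br_add_left br_diff_left m_diff algebra_simps)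

text \<open>The difference of the two connections is tensorial in both arguments and, by \<open>compat\<close>, depends
  only on their product; \<open>t\<close> is this function of the product.\<close>

definition t :: "'v \<Rightarrow> 'v" where "t Y = D' e Y - D e Y"

lemma t_in: "X \<in> T \<Longrightarrow> t X \<in> T"
  by (simp add: t_def closed)

lemma t_add: "X \<in> T \<Longrightarrow> Y \<in> T \<Longrightarrow> t (X + Y) = t X + t Y"
  by (simp add: t_def closed D_add D'_add)

lemma t_diff: "X \<in> T \<Longrightarrow> Y \<in> T \<Longrightarrow> t (X - Y) = t X - t Y"
  by (simp add: t_def closed D_diff D'_diff)

lemma D'_eq:
  assumes "X \<in> T" "Y \<in> T"
  shows "D' Y X = D Y X + t (Y \<star> X)"
  using compat[OF assms e_in] m_comm[OF assms(1) e_in] m_unit[OF assms(1)] m_comm[OF assms]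
  by (simp add: t_def algebra_simps)

lemma D_E: "Y \<in> T \<Longrightarrow> D Y E = - t (E \<star> Y)"
  using D'_eq[OF E_in, of Y] D'_E[of Y] m_comm[OF E_in, of Y] by (metis add_eq_0_iff minus_minus)

lemma D'_E_mult:
  assumes "X \<in> T" "Z \<in> T"
  shows "D' (E \<star> X) Z = D (E \<star> X) Z - D (X \<star> Z) E"
  using D'_eq[OF assms(2), of "E \<star> X"] D_E[of "X \<star> Z"] m_assoc[OF E_in assms] assms by (simp add: closed)

text \<open>Flatness of \<open>D' = D + t (\<star>)\<close>: the curvature of \<open>D\<close> drops out, and \<open>D_mult\<close> absorbs the derivatives
  of the product.\<close>

lemma D'_curvature:
  assumes X: "X \<in> T" and Y: "Y \<in> T" and Z: "Z \<in> T"
  shows "D X (t (Y \<star> Z)) - t (D X (Y \<star> Z)) + t (X \<star> t (Y \<star> Z))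
       = D Y (t (X \<star> Z)) - t (D Y (X \<star> Z)) + t (Y \<star> t (X \<star> Z))"
proof -
  have "D' X (D' Y Z) = D X (D Y Z) + D X (t (Y \<star> Z)) + t (X \<star> D Y Z) + t (X \<star> t (Y \<star> Z))"
    if "X \<in> T" "Y \<in> T" for X Y
    using that Z by (simp add: D'_eq closed t_in D_add m_add t_add algebra_simps)
  note expand = this[OF X Y] this[OF Y X]
  have "D' (br X Y) Z = D (br X Y) Z + D X (t (Y \<star> Z)) + t (X \<star> D Y Z) + t (X \<star> t (Y \<star> Z))
      - (D Y (t (X \<star> Z)) + t (Y \<star> D X Z) + t (Y \<star> t (X \<star> Z)))"
    unfolding D'_flat[OF X Y Z] D_flat[OF X Y Z] expand by (simp add: algebra_simps)
  moreover have "D' (br X Y) Z = D (br X Y) Z + t (br X Y \<star> Z)"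
    using X Y Z by (simp add: D'_eq closed)
  moreover have "t (br X Y \<star> Z) = t (D X (Y \<star> Z)) - t (Y \<star> D X Z) - t (D Y (X \<star> Z)) + t (X \<star> D Y Z)"
    unfolding D_mult[OF X Y Z] using X Y Z by (simp add: closed t_add t_diff)
  ultimately show ?thesis by (simp add: algebra_simps)
qed

text \<open>Since \<open>D W E = - t (E \<star> W)\<close>, the identity \<open>D'_curvature\<close> with \<open>E \<star> Z\<close> in place of \<open>Z\<close> concerns the second
  derivatives of \<open>E\<close>.  Up to these, each side is an expression in the triple product \<open>X \<star> Y \<star> Z\<close> alone
  by the Euler property, hence symmetric.\<close>

lemma D_D_E_symmetric:
  assumes X: "X \<in> T" and Y: "Y \<in> T" and Z: "Z \<in> T"
  shows "D X (D (Y \<star> Z) E) - D (D X (Y \<star> Z)) E = D Y (D (X \<star> Z) E) - D (D Y (X \<star> Z)) E"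
proof -
  \<comment> \<open>at \<open>W = Y \<star> Z\<close>, everything on the right except the first two terms depends on \<open>X \<star> W\<close> only\<close>
  have expand: "D X (t (E \<star> W)) - t (D X (E \<star> W)) + t (X \<star> t (E \<star> W))
      = D (D X W) E - D X (D W E) - t (D E (X \<star> W)) + t (br E (X \<star> W)) - t (X \<star> W)"
    if X: "X \<in> T" and W: "W \<in> T" for X W
  proof -
    have tE: "t (E \<star> V) = - D V E" if "V \<in> T" for V using D_E[OF that] by simp
    have neg: "- D W E = br E W - D E W" using D_torsion[OF E_in W, symmetric] by simp
    have "br E X \<star> W = D E (X \<star> W) - X \<star> D E W - D X (E \<star> W) + E \<star> D X W"
      by (rule D_mult[OF E_in X W])
    then have "D X (E \<star> W) = D E (X \<star> W) - X \<star> D E W + E \<star> D X W - br E X \<star> W"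
      by (simp add: algebra_simps)
    then have tD: "t (D X (E \<star> W)) = t (D E (X \<star> W)) - t (X \<star> D E W) - D (D X W) E - t (br E X \<star> W)"
      using X W by (simp add: closed t_add t_diff tE)
    have tt: "t (X \<star> t (E \<star> W)) = t (X \<star> br E W) - t (X \<star> D E W)"
      unfolding tE[OF W] neg using X W by (simp add: closed m_diff t_diff)
    have "br E (X \<star> W) = X \<star> br E W + br E X \<star> W + X \<star> W"
      using euler[OF X W] by (simp add: algebra_simps)
    then have tE_br: "t (br E (X \<star> W)) = t (X \<star> br E W) + t (br E X \<star> W) + t (X \<star> W)"
      using X W by (simp add: closed t_add)
    have Dt: "D X (t (E \<star> W)) = - D X (D W E)"
      unfolding tE[OF W] using D_diff[of X 0 "D W E"] D_diff[of X X X] X W by (simp add: closed zero_in)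
    show ?thesis unfolding tD tt tE_br Dt by (simp add: algebra_simps)
  qed
  have "Y \<star> (E \<star> Z) = E \<star> (Y \<star> Z)" "X \<star> (E \<star> Z) = E \<star> (X \<star> Z)"
    using m_left_comm X Y Z E_in by simp_all
  with D'_curvature[OF X Y m_in[OF E_in Z]]
  have "D (D X (Y \<star> Z)) E - D X (D (Y \<star> Z) E) - t (D E (X \<star> (Y \<star> Z))) + t (br E (X \<star> (Y \<star> Z))) - t (X \<star> (Y \<star> Z))
      = D (D Y (X \<star> Z)) E - D Y (D (X \<star> Z) E) - t (D E (X \<star> (Y \<star> Z))) + t (br E (X \<star> (Y \<star> Z))) - t (X \<star> (Y \<star> Z))"
    using expand[OF X m_in[OF Y Z]] expand[OF Y m_in[OF X Z]] m_left_comm[OF Y X Z] by metis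
  then have "D (D X (Y \<star> Z)) E - D X (D (Y \<star> Z) E) = D (D Y (X \<star> Z)) E - D Y (D (X \<star> Z) E)"
    by simp
  then show ?thesis by (metis minus_diff_eq)
qed

text \<open>Substitute \<open>D' (E \<star> X) Z = D (E \<star> X) Z - D (X \<star> Z) E\<close>.  The terms without \<open>E\<close> as differentiated field
  cancel by flatness of \<open>D\<close>; by \<open>D_mult\<close> the others are the difference of the two sides of
  \<open>D_D_E_symmetric\<close>.\<close>

lemma mixed_flat:
  assumes X: "X \<in> T" and Y: "Y \<in> T" and Z: "Z \<in> T"
  shows "D (brE X Y) Z + D' (E \<star> br X Y) Z
    = D X (D' (E \<star> Y) Z) + D' (E \<star> X) (D Y Z) - (D Y (D' (E \<star> X) Z) + D' (E \<star> Y) (D X Z))"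
proof -
  have N: "D (br X Y \<star> Z) E = D (D X (Y \<star> Z)) E - D (Y \<star> D X Z) E - D (D Y (X \<star> Z)) E + D (X \<star> D Y Z) E"
    unfolding D_mult[OF X Y Z] using X Y Z by (simp add: closed D_add_left D_diff_left)
  have "D (brE X Y) Z = D (br (E \<star> X) Y) Z + D (br X (E \<star> Y)) Z - D (E \<star> br X Y) Z"
    unfolding brE_def using X Y Z by (simp add: closed D_add_left D_diff_left)
  also have "\<dots> = D (E \<star> X) (D Y Z) - D Y (D (E \<star> X) Z) + (D X (D (E \<star> Y) Z) - D (E \<star> Y) (D X Z)) - D (E \<star> br X Y) Z"
    using X Y Z by (simp add: closed D_flat)
  finally have 1: "D (brE X Y) Z = \<dots>" .
  have 2: "D X (D' (E \<star> Y) Z) = D X (D (E \<star> Y) Z) - D X (D (Y \<star> Z) E)" if "X \<in> T" "Y \<in> T" for X Y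
    using that Z by (simp add: D'_E_mult closed D_diff)
  have 3: "D' (E \<star> X) (D Y Z) = D (E \<star> X) (D Y Z) - D (X \<star> D Y Z) E" if "X \<in> T" "Y \<in> T" for X Y
    using that Z by (simp add: D'_E_mult closed)
  have 4: "D' (E \<star> br X Y) Z = D (E \<star> br X Y) Z - D (br X Y \<star> Z) E"
    using X Y Z by (simp add: D'_E_mult closed)
  show ?thesis
    unfolding 1 2[OF X Y] 2[OF Y X] 3[OF X Y] 3[OF Y X] 4 N
    using D_D_E_symmetric[OF X Y Z] by (simp add: algebra_simps)
qed

end


section \<open>The tangent sheaf\<close>

context function_sheaf
begin

lemma sec_cmult:
  assumes "open V" "f \<in> S V"
  shows "(\<lambda>_. c) * f \<in> S V"
proof -
  have "(\<lambda>_. c) * f = res V (\<lambda>_. c) * f"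
    using sec_outside[OF assms(2)] by (auto simp: fun_eq_iff res_def)
  then show ?thesis using sec_mult[OF assms(1) sec_const assms(2)] assms(1) by simp
qed

lemma sec_zero: "open V \<Longrightarrow> 0 \<in> S V"
  using sec_const[of V 0] by (simp add: res_def func_zero)

lemma sec_uminus: "open V \<Longrightarrow> f \<in> S V \<Longrightarrow> - f \<in> S V"
  using sec_cmult[of V f "-1"] by (simp add: fun_eq_iff func_times fun_Compl_def)

lemma sec_diff: "open V \<Longrightarrow> f \<in> S V \<Longrightarrow> g \<in> S V \<Longrightarrow> f - g \<in> S V"
  using sec_add[OF _ _ sec_uminus, of V f g] by simp

lemma tan_outside: "X \<in> tangent S V \<Longrightarrow> \<not> (open W \<and> W \<subseteq> V \<and> f \<in> S W) \<Longrightarrow> X W f = 0"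
  by (simp add: tangent_def)

context
  fixes V W :: "'m set"
  assumes W: "open W" "W \<subseteq> V"
begin

lemma tan_sec: "X \<in> tangent S V \<Longrightarrow> f \<in> S W \<Longrightarrow> X W f \<in> S W"
  using W by (simp add: tangent_def)

lemma tan_add: "X \<in> tangent S V \<Longrightarrow> f \<in> S W \<Longrightarrow> g \<in> S W \<Longrightarrow> X W (f + g) = X W f + X W g"
  using W by (simp add: tangent_def)

lemma tan_cmult: "X \<in> tangent S V \<Longrightarrow> f \<in> S W \<Longrightarrow> X W ((\<lambda>_. c) * f) = (\<lambda>_. c) * X W f"
  using W by (simp add: tangent_def)

lemma tan_mult: "X \<in> tangent S V \<Longrightarrow> f \<in> S W \<Longrightarrow> g \<in> S W \<Longrightarrow> X W (f * g) = X W f * g + f * X W g"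
  using W by (simp add: tangent_def)

lemma tan_res: "X \<in> tangent S V \<Longrightarrow> open W' \<Longrightarrow> W' \<subseteq> W \<Longrightarrow> f \<in> S W \<Longrightarrow> X W' (res W' f) = res W' (X W f)"
  using W by (simp add: tangent_def)

lemma tan_diff: "X \<in> tangent S V \<Longrightarrow> f \<in> S W \<Longrightarrow> g \<in> S W \<Longrightarrow> X W (f - g) = X W f - X W g"
  using tan_add[of X "f - g" g] sec_diff[OF W(1)] by (simp add: algebra_simps)

end

lemma tan_zero: "X \<in> tangent S V \<Longrightarrow> X W 0 = 0"
  using tan_diff[of W V X 0 0] tan_outside[of X V W 0] by (cases "open W \<and> W \<subseteq> V \<and> 0 \<in> S W") auto

text \<open>A derivation kills the unit of the ring of sections, by the Leibniz rule for \<open>1 = 1 * 1\<close>.\<close>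

lemma tan_const: "open V \<Longrightarrow> X \<in> tangent S V \<Longrightarrow> X V (res V (\<lambda>_. c)) = 0"
proof -
  assume V: "open V" and X: "X \<in> tangent S V"
  let ?u = "res V (\<lambda>_. 1 :: 'k)"
  have u: "?u \<in> S V" by (rule sec_const[OF V])
  have "?u * ?u = ?u" by (auto simp: res_def fun_eq_iff)
  moreover have "X V ?u * ?u = X V ?u" "?u * X V ?u = X V ?u"
    using sec_outside[OF tan_sec[OF V order_refl X u]] by (auto simp: res_def fun_eq_iff)
  ultimately have "X V ?u = X V ?u + X V ?u"
    using tan_mult[OF V order_refl X u u] by simp
  then have "X V ?u = 0" by simp
  moreover have "res V (\<lambda>_. c) = (\<lambda>_. c) * ?u" by (auto simp: res_def fun_eq_iff)
  ultimately show ?thesis using tan_cmult[OF V order_refl X u, of c] by simp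
qed

lemma vfield_eqI:
  assumes "X \<in> tangent S V" "Y \<in> tangent S V"
    and "\<And>W f. open W \<Longrightarrow> W \<subseteq> V \<Longrightarrow> f \<in> S W \<Longrightarrow> X W f = Y W f"
  shows "X = Y"
proof -
  have "X W f = Y W f" for W f
    using assms(3) tan_outside[OF assms(1)] tan_outside[OF assms(2)]
    by (cases "open W \<and> W \<subseteq> V \<and> f \<in> S W") auto
  then show ?thesis by blast
qed

lemma res_add: "res V (f + g) = res V f + res V g" for f g :: "'m \<Rightarrow> 'k"
  by (auto simp: res_def)

lemma res_diff: "res V (f - g) = res V f - res V g" for f g :: "'m \<Rightarrow> 'k"
  by (auto simp: res_def)

lemma sec_mult_res: "f \<in> S W \<Longrightarrow> g * f = res W g * f"
  using sec_outside[of f W] by (auto simp: res_def fun_eq_iff)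

lemma tangent_zero: "open V \<Longrightarrow> 0 \<in> tangent S V"
  by (auto simp: tangent_def sec_zero) (auto simp: res_def)

lemma tangent_add: "X \<in> tangent S V \<Longrightarrow> Y \<in> tangent S V \<Longrightarrow> X + Y \<in> tangent S V"
  unfolding tangent_def mem_Collect_eq
  by (simp add: res_add sec_add algebra_simps)

lemma tangent_uminus: "X \<in> tangent S V \<Longrightarrow> - X \<in> tangent S V"
proof -
  assume X: "X \<in> tangent S V"
  have "res W (- f) = - res W f" for W and f :: "'m \<Rightarrow> 'k" by (auto simp: res_def)
  with X show ?thesis
    unfolding tangent_def mem_Collect_eq by (simp add: fun_Compl_def[of X] fun_Compl_def[of "X _"] sec_uminus algebra_simps)
qed

lemma tangent_diff: "X \<in> tangent S V \<Longrightarrow> Y \<in> tangent S V \<Longrightarrow> X - Y \<in> tangent S V"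
  using tangent_add[OF _ tangent_uminus, of X V Y] by simp

lemma tangent_fmult:
  assumes V: "open V" and g: "g \<in> S V" and X: "X \<in> tangent S V"
  shows "g \<cdot> X \<in> tangent S V"
proof -
  have "g * X W f \<in> S W" if "open W" "W \<subseteq> V" "f \<in> S W" for W f
    unfolding sec_mult_res[OF tan_sec[OF that(1,2) X that(3)], of g]
    by (rule sec_mult[OF that(1) sec_res[OF V that(1,2) g] tan_sec[OF that(1,2) X that(3)]])
  moreover have "g * res W' (X W f) = res W' (g * X W f)" for W W' f
    by (auto simp: res_def)
  ultimately show ?thesis
    using X unfolding tangent_def mem_Collect_eq fmult_def by (simp add: algebra_simps)
qed

lemma tangent_lie:
  assumes X: "X \<in> tangent S V" and Y: "Y \<in> tangent S V"
  shows "lie X Y \<in> tangent S V"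
proof -
  have 1: "lie X Y W f = 0" if "\<not> (open W \<and> W \<subseteq> V \<and> f \<in> S W)" for W f
    using tan_outside[OF X that] tan_outside[OF Y that] tan_zero[OF X] tan_zero[OF Y] by (simp add: lie_def)
  have 2: "lie X Y W f \<in> S W" if W: "open W" "W \<subseteq> V" and f: "f \<in> S W" for W f
    unfolding lie_def by (intro sec_diff tan_sec[OF W X] tan_sec[OF W Y] f W(1))
  have 3: "lie X Y W (f + g) = lie X Y W f + lie X Y W g"
    if W: "open W" "W \<subseteq> V" and f: "f \<in> S W" and g: "g \<in> S W" for W f g
    unfolding lie_def tan_add[OF W X f g] tan_add[OF W Y f g]
      tan_add[OF W X tan_sec[OF W Y f] tan_sec[OF W Y g]] tan_add[OF W Y tan_sec[OF W X f] tan_sec[OF W X g]]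
    by (rule add_diff_add)
  have 4: "lie X Y W ((\<lambda>_. c) * f) = (\<lambda>_. c) * lie X Y W f"
    if W: "open W" "W \<subseteq> V" and f: "f \<in> S W" for W f c
    unfolding lie_def tan_cmult[OF W X f] tan_cmult[OF W Y f]
      tan_cmult[OF W X tan_sec[OF W Y f]] tan_cmult[OF W Y tan_sec[OF W X f]]
    by (rule right_diff_distrib[symmetric])
  have 5: "lie X Y W (f * g) = lie X Y W f * g + f * lie X Y W g"
    if W: "open W" "W \<subseteq> V" and f: "f \<in> S W" and g: "g \<in> S W" for W f g
  proof -
    have "Z W (Z' W (f * g)) = Z W (Z' W f) * g + Z' W f * Z W g + (Z W f * Z' W g + f * Z W (Z' W g))"
      if Z: "Z \<in> tangent S V" and Z': "Z' \<in> tangent S V" for Z Z'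
      unfolding tan_mult[OF W Z' f g]
        tan_add[OF W Z sec_mult[OF W(1) tan_sec[OF W Z' f] g] sec_mult[OF W(1) f tan_sec[OF W Z' g]]]
        tan_mult[OF W Z tan_sec[OF W Z' f] g] tan_mult[OF W Z f tan_sec[OF W Z' g]] ..
    from this[OF X Y] this[OF Y X] show ?thesis
      unfolding lie_def by (simp only: left_diff_distrib right_diff_distrib) (auto simp: fun_eq_iff)
  qed
  have 6: "lie X Y W' (res W' f) = res W' (lie X Y W f)"
    if W: "open W" "W \<subseteq> V" and W': "open W'" "W' \<subseteq> W" and f: "f \<in> S W" for W W' f
    unfolding lie_def res_diff tan_res[OF W X W' f] tan_res[OF W Y W' f]
      tan_res[OF W X W' tan_sec[OF W Y f]] tan_res[OF W Y W' tan_sec[OF W X f]] ..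
  show ?thesis
    unfolding tangent_def mem_Collect_eq using 1 2 3 4 5 6 by auto
qed

lemma tangent_vres: "V' \<subseteq> V \<Longrightarrow> X \<in> tangent S V \<Longrightarrow> vres V' X \<in> tangent S V'"
  unfolding tangent_def mem_Collect_eq vres_def by auto

lemma lie_anti: "lie Y X = - lie X Y" for X Y :: "('m, 'k) vfield"
  by (simp add: lie_def fun_eq_iff fun_Compl_def)

lemma lie_self: "lie X X = 0" for X :: "('m, 'k) vfield"
  by (simp add: lie_def fun_eq_iff)

lemma lie_add:
  assumes "X \<in> tangent S V" "Y \<in> tangent S V" "Z \<in> tangent S V"
  shows "lie X (Y + Z) = lie X Y + lie X Z"
proof (rule vfield_eqI[where V = V])
  show "lie X (Y + Z) \<in> tangent S V" "lie X Y + lie X Z \<in> tangent S V"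
    using assms by (simp_all add: tangent_lie tangent_add)
  show "lie X (Y + Z) W f = (lie X Y + lie X Z) W f" if "open W" "W \<subseteq> V" "f \<in> S W" for W f
    using that assms by (auto simp: lie_def tan_add tan_sec fun_eq_iff)
qed

lemma lie_jacobi:
  assumes "X \<in> tangent S V" "Y \<in> tangent S V" "Z \<in> tangent S V"
  shows "lie (lie X Y) Z = lie X (lie Y Z) - lie Y (lie X Z)"
proof (rule vfield_eqI[where V = V])
  show "lie (lie X Y) Z \<in> tangent S V" "lie X (lie Y Z) - lie Y (lie X Z) \<in> tangent S V"
    using assms by (simp_all add: tangent_lie tangent_diff)
  show "lie (lie X Y) Z W f = (lie X (lie Y Z) - lie Y (lie X Z)) W f" if "open W" "W \<subseteq> V" "f \<in> S W" for W f
    using that assms by (auto simp: lie_def tan_diff tan_sec fun_eq_iff)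
qed

text \<open>Here \<open>f\<close> lives on \<open>V\<close> while the identity is tested on functions over a smaller \<open>W\<close>; the Leibniz rule
  over \<open>W\<close> is applied to the restriction of \<open>f\<close>, and derivations commute with restriction.\<close>

lemma lie_fmult:
  assumes V: "open V" and f: "f \<in> S V" and X: "X \<in> tangent S V" and Y: "Y \<in> tangent S V"
  shows "lie X (f \<cdot> Y) = X V f \<cdot> Y + f \<cdot> lie X Y"
proof (rule vfield_eqI[where V = V])
  show "lie X (f \<cdot> Y) \<in> tangent S V" "X V f \<cdot> Y + f \<cdot> lie X Y \<in> tangent S V"
    using assms tan_sec[OF V order_refl X f] by (simp_all add: tangent_lie tangent_fmult tangent_add)
  fix W g assume W: "open W" "W \<subseteq> V" and g: "g \<in> S W"
  note Yg = tan_sec[OF W Y g]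
  have "X W (f * Y W g) = X W (res W f * Y W g)"
    by (rule arg_cong[where f = "X W"]) (rule sec_mult_res[OF Yg])
  also have "\<dots> = res W (X V f) * Y W g + res W f * X W (Y W g)"
    using tan_mult[OF W X sec_res[OF V W f] Yg] tan_res[OF V order_refl X W f] by simp
  also have "\<dots> = X V f * Y W g + f * X W (Y W g)"
    by (simp only: sec_mult_res[OF Yg, symmetric] sec_mult_res[OF tan_sec[OF W X Yg], symmetric])
  finally show "lie X (f \<cdot> Y) W g = (X V f \<cdot> Y + f \<cdot> lie X Y) W g"
    by (auto simp: lie_def fmult_def algebra_simps fun_eq_iff)
qed

text \<open>A constant function is not a section over \<open>V\<close>, as it does not vanish outside; the section with the
  same effect on vector fields is its truncation.\<close>

lemma fmult_const: "X \<in> tangent S V \<Longrightarrow> (\<lambda>_. c) \<cdot> X = res V (\<lambda>_. c) \<cdot> X"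
proof (intro ext)
  fix W f p assume X: "X \<in> tangent S V"
  have "p \<in> V" if "X W f p \<noteq> 0"
  proof (rule ccontr)
    assume p: "p \<notin> V"
    have *: "open W \<and> W \<subseteq> V \<and> f \<in> S W"
      using tan_outside[OF X, of W f] that by (metis zero_fun_apply)
    then show False using sec_outside[OF tan_sec[of W V X f], of p] X p that by blast
  qed
  then show "((\<lambda>_. c) \<cdot> X) W f p = (res V (\<lambda>_. c) \<cdot> X) W f p"
    by (auto simp: fmult_def res_def)
qed

lemma form_module_tangent:
  assumes V: "open V"
  shows "form_module (tangent S V) (S V) fmult"
  by unfold_locales
    (use V in \<open>simp_all add: tangent_zero tangent_add tangent_uminus tangent_fmult\<close>,
     auto simp: fmult_def algebra_simps fun_eq_iff)

end

lemma vres_add: "vres V (X + Y) = vres V X + vres V Y" for X Y :: "('m, 'k::ab_group_add) vfield"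
  by (auto simp: vres_def fun_eq_iff)

lemma vres_diff: "vres V (X - Y) = vres V X - vres V Y" for X Y :: "('m, 'k::ab_group_add) vfield"
  by (auto simp: vres_def fun_eq_iff)

lemma vres_lie: "vres V (lie X Y) = lie (vres V X) (vres V Y)" for X Y :: "('m, 'k::ab_group_add) vfield"
  by (auto simp: vres_def lie_def fun_eq_iff)

lemma vres_vres: "V' \<subseteq> V \<Longrightarrow> vres V' (vres V X) = vres V' X"
  by (auto simp: vres_def fun_eq_iff)


section \<open>Differentials twisted by an endomorphism\<close>

lemma power_minus_one_fmult: "(-1) ^ n \<cdot> X = alt_sign n X" for X :: "('m, 'k::field) vfield"
proof -
  have "((-1) ^ n :: 'm \<Rightarrow> 'k) = (if even n then 1 else -1)" by (simp add: uminus_power_if)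
  then show ?thesis by (auto simp: alt_sign_def fmult_def fun_eq_iff)
qed

lemma vres_fmult: "vres V (f \<cdot> X) = f \<cdot> vres V X" for f :: "'m \<Rightarrow> 'k::mult_zero"
  by (auto simp: vres_def fmult_def fun_eq_iff)

lemma vres_zero: "vres V 0 = (0 :: ('m, 'k::ab_group_add) vfield)"
  by (auto simp: vres_def fun_eq_iff)

lemma vres_sum: "vres V (\<Sum>i\<in>I. X i) = (\<Sum>i\<in>I. vres V (X i))" for X :: "'i \<Rightarrow> ('m, 'k::ab_group_add) vfield"
  by (induction I rule: infinite_finite_induct) (simp_all only: sum.infinite sum.empty sum.insert vres_zero vres_add not_False_eq_True)

text \<open>A connection composed with an endomorphism \<open>L\<close> of the tangent sheaf satisfies the Leibniz rule for the
  action \<open>f \<mapsto> (L X) f\<close>, and so does the deformed bracket of \<open>L\<close>.  Hence the twisted differential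
  is a morphism of sheaves of forms.\<close>

locale twisted_connection = function_sheaf S
  for S :: "'m::topological_space set \<Rightarrow> ('m \<Rightarrow> 'k::field) set" +
  fixes U :: "'m set" and L :: "'m set \<Rightarrow> ('m, 'k) vfield \<Rightarrow> ('m, 'k) vfield" and D :: "('m, 'k) vop2"
  assumes conn: "connection S U D"
    and L_in: "open V \<Longrightarrow> V \<subseteq> U \<Longrightarrow> X \<in> tangent S V \<Longrightarrow> L V X \<in> tangent S V"
    and L_add: "open V \<Longrightarrow> V \<subseteq> U \<Longrightarrow> X \<in> tangent S V \<Longrightarrow> Y \<in> tangent S V \<Longrightarrow> L V (X + Y) = L V X + L V Y"
    and L_fmult: "open V \<Longrightarrow> V \<subseteq> U \<Longrightarrow> f \<in> S V \<Longrightarrow> X \<in> tangent S V \<Longrightarrow> L V (f \<cdot> X) = f \<cdot> L V X"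
    and L_vres: "open V \<Longrightarrow> V \<subseteq> U \<Longrightarrow> open V' \<Longrightarrow> V' \<subseteq> V \<Longrightarrow> X \<in> tangent S V \<Longrightarrow> L V' (vres V' X) = vres V' (L V X)"
begin

lemma D_facts:
  assumes "open V" "V \<subseteq> U" "X \<in> tangent S V" "Y \<in> tangent S V"
  shows "D V X Y \<in> tangent S V"
    and "open V' \<Longrightarrow> V' \<subseteq> V \<Longrightarrow> D V' (vres V' X) (vres V' Y) = vres V' (D V X Y)"
    and "Z \<in> tangent S V \<Longrightarrow> D V (X + Y) Z = D V X Z + D V Y Z"
    and "Z \<in> tangent S V \<Longrightarrow> D V Z (X + Y) = D V Z X + D V Z Y"
    and "f \<in> S V \<Longrightarrow> D V (f \<cdot> X) Y = f \<cdot> D V X Y"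
    and "f \<in> S V \<Longrightarrow> D V X (f \<cdot> Y) = X V f \<cdot> Y + f \<cdot> D V X Y"
proof -
  note c = conn[unfolded connection_def sheaf_op2_def] and V = conjI[OF assms(1,2)]
  note op = conjunct1[OF c, THEN spec, THEN mp, OF V, THEN bspec, OF assms(3), THEN bspec, OF assms(4)]
  note lin = conjunct2[OF c, THEN spec, THEN mp, OF V, THEN bspec, OF assms(3), THEN bspec, OF assms(4)]
  show "D V X Y \<in> tangent S V" using op ..
  show "D V' (vres V' X) (vres V' Y) = vres V' (D V X Y)" if "open V'" "V' \<subseteq> V"
    using op that by simp
  show "D V (X + Y) Z = D V X Z + D V Y Z" "D V Z (X + Y) = D V Z X + D V Z Y" if "Z \<in> tangent S V"
    using conjunct1[OF lin, THEN bspec, OF that] by blast+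
  show "D V (f \<cdot> X) Y = f \<cdot> D V X Y" "D V X (f \<cdot> Y) = X V f \<cdot> Y + f \<cdot> D V X Y" if "f \<in> S V"
    using conjunct2[OF lin, THEN bspec, OF that] by blast+
qed

definition deriv_along :: "'m set \<Rightarrow> ('m, 'k) vfield \<Rightarrow> ('m, 'k) vfield \<Rightarrow> ('m, 'k) vfield" where
  "deriv_along V X Y = D V (L V X) Y"

lemma anchored:
  assumes V: "open V" "V \<subseteq> U"
  shows "anchored_connection (tangent S V) (S V) fmult (\<lambda>X. L V X V) (deriv_along V) (lie_via L V)"
proof -
  interpret form_module "tangent S V" "S V" fmult by (rule form_module_tangent[OF V(1)])
  note L = L_in[OF V] and Ladd = L_add[OF V] and D = D_facts[OF V]
  have Lzero: "L V 0 = 0" using Ladd[OF zero_in zero_in] by simp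
  have lie_add_left: "lie (X + Y) Z = lie X Z + lie Y Z"
    if "X \<in> tangent S V" "Y \<in> tangent S V" "Z \<in> tangent S V" for X Y Z
    unfolding lie_anti[of "X + Y" Z] lie_anti[of X Z] lie_anti[of Y Z] lie_add[OF that(3,1,2)] by simp
  note lie_in = tangent_lie[where V = V] and lie_add = lie_add[where V = V]
  show ?thesis
  proof
    fix X Y assume X: "X \<in> tangent S V" and Y: "Y \<in> tangent S V"
    show "L V X V f \<in> S V" if "f \<in> S V" for f
      by (rule tan_sec[OF V(1) order_refl L[OF X] that])
    show "deriv_along V X Y \<in> tangent S V" unfolding deriv_along_def by (rule D(1)[OF L[OF X] Y])
    show "lie_via L V X Y \<in> tangent S V"
      unfolding lie_via_def using X Y by (intro tangent_diff tangent_add lie_in L)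
    show "lie_via L V X X = 0"
      using lie_anti[of "L V X" X] by (simp add: lie_via_def lie_self Lzero)
    show "deriv_along V (X + Y) Z = deriv_along V X Z + deriv_along V Y Z" "deriv_along V X (Y + Z) = deriv_along V X Y + deriv_along V X Z"
      if Z: "Z \<in> tangent S V" for Z
      using X Y Z by (simp_all add: deriv_along_def Ladd D(3,4) L)
    show "lie_via L V (X + Y) Z = lie_via L V X Z + lie_via L V Y Z"
      if Z: "Z \<in> tangent S V" for Z
      using X Y Z by (simp add: lie_via_def Ladd L lie_in lie_add_left)
    show "lie_via L V X (Y + Z) = lie_via L V X Y + lie_via L V X Z"
      if Z: "Z \<in> tangent S V" for Z
      using X Y Z by (simp add: lie_via_def Ladd L lie_in lie_add)
    fix f assume f: "f \<in> S V"
    show "deriv_along V (f \<cdot> X) Y = f \<cdot> deriv_along V X Y"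
      using X Y f by (simp add: deriv_along_def L_fmult[OF V] D(5) L)
    show "deriv_along V X (f \<cdot> Y) = L V X V f \<cdot> Y + f \<cdot> deriv_along V X Y"
      using X Y f by (simp add: deriv_along_def D(6) L)
    have "lie_via L V X (f \<cdot> Y) = (L V X V f \<cdot> Y + f \<cdot> lie (L V X) Y) + (X V f \<cdot> L V Y + f \<cdot> lie X (L V Y))
        - (X V f \<cdot> L V Y + f \<cdot> L V (lie X Y))"
      using X Y f tan_sec[OF V(1) order_refl X f]
      by (simp add: lie_via_def L_fmult[OF V] Ladd L lie_in lie_fmult[OF V(1)] tangent_fmult[OF V(1)])
    also have "\<dots> = L V X V f \<cdot> Y + f \<cdot> lie_via L V X Y"
      by (auto simp: lie_via_def fmult_def fun_eq_iff algebra_simps)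
    finally show "lie_via L V X (f \<cdot> Y) = L V X V f \<cdot> Y + f \<cdot> lie_via L V X Y" .
  qed
qed

lemma lie_via_vres:
  assumes "open V" "V \<subseteq> U" "open V'" "V' \<subseteq> V" "X \<in> tangent S V" "Y \<in> tangent S V"
  shows "lie_via L V' (vres V' X) (vres V' Y) = vres V' (lie_via L V X Y)"
  using assms by (simp add: lie_via_def vres_add vres_diff vres_lie L_vres tangent_lie flip: L_vres)

end

context function_sheaf
begin

text \<open>Over each open set, the conditions on a form at arbitrary positions are equivalent to the recursive
  description by the first slot.\<close>

lemma vforms_iff_aform:
  "\<omega> \<in> vforms S V k \<longleftrightarrow>
    (\<forall>W Xs. \<not> (open W \<and> W \<subseteq> V \<and> length Xs = k \<and> set Xs \<subseteq> tangent S W) \<longrightarrow> \<omega> W Xs = 0) \<and>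
    (\<forall>W. open W \<and> W \<subseteq> V \<longrightarrow> form_module.aform (tangent S W) (S W) fmult k (\<omega> W)) \<and>
    (\<forall>W W' Xs. open W \<and> W \<subseteq> V \<and> open W' \<and> W' \<subseteq> W \<and> length Xs = k \<and> set Xs \<subseteq> tangent S W \<longrightarrow>
       \<omega> W' (map (vres W') Xs) = vres W' (\<omega> W Xs))" (is "?l \<longleftrightarrow> ?r1 \<and> ?r2 \<and> ?r3")
proof
  assume \<omega>: ?l
  note v = \<omega>[unfolded vforms_def mem_Collect_eq, THEN conjunct2, THEN spec, THEN spec, THEN mp]
  have ?r1 using \<omega> unfolding vforms_def mem_Collect_eq by (rule conjunct1)
  moreover have ?r2
  proof (intro allI impI)
    fix W assume W: "open W \<and> W \<subseteq> V"
    interpret form_module "tangent S W" "S W" fmult by (rule form_module_tangent) (use W in simp)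
    show "aform k (\<omega> W)"
    proof (rule aformI)
      fix Xs assume "Xs \<in> tuples k"
      then have "open W \<and> W \<subseteq> V \<and> length Xs = k \<and> set Xs \<subseteq> tangent S W"
        using W by (simp add: tuples_def)
      note vXs = v[OF this]
      show "\<omega> W Xs \<in> tangent S W" using vXs ..
      fix i
      show "\<omega> W (Xs[i := X + Y]) = \<omega> W (Xs[i := X]) + \<omega> W (Xs[i := Y])"
        if "i < k" "X \<in> tangent S W" "Y \<in> tangent S W" for X Y
        using vXs that by simp
      show "\<omega> W (Xs[i := f \<cdot> X]) = f \<cdot> \<omega> W (Xs[i := X])" if "i < k" "f \<in> S W" "X \<in> tangent S W" for f X
        using vXs that by simp
      show "\<omega> W Xs = 0" if "i < j" "j < k" "Xs ! i = Xs ! j" for j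
        using vXs that by blast
    qed
  qed
  moreover have ?r3
  proof (intro allI impI)
    fix W W' Xs
    assume *: "open W \<and> W \<subseteq> V \<and> open W' \<and> W' \<subseteq> W \<and> length Xs = k \<and> set Xs \<subseteq> tangent S W"
    then have "open W \<and> W \<subseteq> V \<and> length Xs = k \<and> set Xs \<subseteq> tangent S W" by simp
    from v[OF this] * show "\<omega> W' (map (vres W') Xs) = vres W' (\<omega> W Xs)" by simp
  qed
  ultimately show "?r1 \<and> ?r2 \<and> ?r3" by blast
next
  assume r: "?r1 \<and> ?r2 \<and> ?r3"
  have main: "\<omega> W Xs \<in> tangent S W \<and>
        (\<forall>i<k. \<forall>X\<in>tangent S W. \<forall>Y\<in>tangent S W.
           \<omega> W (Xs[i := X + Y]) = \<omega> W (Xs[i := X]) + \<omega> W (Xs[i := Y])) \<and>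
        (\<forall>i<k. \<forall>f\<in>S W. \<forall>X\<in>tangent S W. \<omega> W (Xs[i := f \<cdot> X]) = f \<cdot> \<omega> W (Xs[i := X])) \<and>
        (\<forall>i j. i < j \<and> j < k \<and> Xs ! i = Xs ! j \<longrightarrow> \<omega> W Xs = 0)"
    if W: "open W" "W \<subseteq> V" and "length Xs = k" "set Xs \<subseteq> tangent S W" for W Xs
  proof -
    interpret form_module "tangent S W" "S W" fmult by (rule form_module_tangent) fact
    have Xs: "Xs \<in> tuples k" using that by (simp add: tuples_def)
    have \<omega>: "aform k (\<omega> W)" using r[THEN conjunct2, THEN conjunct1] W by simp
    show ?thesis
      using aform_in[OF \<omega> Xs] aform_update_add[OF \<omega> Xs] aform_update_smul[OF \<omega> Xs] aform_alternating[OF \<omega> Xs]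
      by blast
  qed
  show ?l
    unfolding vforms_def mem_Collect_eq
  proof (rule conjI[OF conjunct1[OF r]], intro allI impI)
    fix W Xs assume *: "open W \<and> W \<subseteq> V \<and> length Xs = k \<and> set Xs \<subseteq> tangent S W"
    have "\<forall>W'. open W' \<and> W' \<subseteq> W \<longrightarrow> \<omega> W' (map (vres W') Xs) = vres W' (\<omega> W Xs)"
      using r[THEN conjunct2, THEN conjunct2, THEN spec, of W, THEN spec, THEN spec, of _ Xs] * by simp
    with main[of W Xs] * show "\<omega> W Xs \<in> tangent S W \<and>
        (\<forall>W'. open W' \<and> W' \<subseteq> W \<longrightarrow> \<omega> W' (map (vres W') Xs) = vres W' (\<omega> W Xs)) \<and>
        (\<forall>i<k. \<forall>X\<in>tangent S W. \<forall>Y\<in>tangent S W.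
           \<omega> W (Xs[i := X + Y]) = \<omega> W (Xs[i := X]) + \<omega> W (Xs[i := Y])) \<and>
        (\<forall>i<k. \<forall>f\<in>S W. \<forall>X\<in>tangent S W. \<omega> W (Xs[i := f \<cdot> X]) = f \<cdot> \<omega> W (Xs[i := X])) \<and>
        (\<forall>i j. i < j \<and> j < k \<and> Xs ! i = Xs ! j \<longrightarrow> \<omega> W Xs = 0)" by simp
  qed
qed

lemma vforms_aform:
  "\<omega> \<in> vforms S V k \<Longrightarrow> open W \<Longrightarrow> W \<subseteq> V \<Longrightarrow> form_module.aform (tangent S W) (S W) fmult k (\<omega> W)"
  by (drule vforms_iff_aform[THEN iffD1]) simp

lemma vforms_vres:
  "\<omega> \<in> vforms S V k \<Longrightarrow> open W \<Longrightarrow> W \<subseteq> V \<Longrightarrow> open W' \<Longrightarrow> W' \<subseteq> W \<Longrightarrow> length Xs = k \<Longrightarrow>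
    set Xs \<subseteq> tangent S W \<Longrightarrow> \<omega> W' (map (vres W') Xs) = vres W' (\<omega> W Xs)"
  by (drule vforms_iff_aform[THEN iffD1]) simp

end

context twisted_connection
begin

lemma twisted_d_eq_cartan:
  assumes "open W" "W \<subseteq> V" "V \<subseteq> U"
    and "form_module.aform (tangent S W) (S W) fmult k (\<omega> W)" "length Xs = Suc k" "set Xs \<subseteq> tangent S W"
  shows "twisted_d S L D V k \<omega> W Xs = cartan_d (deriv_along W) (lie_via L W) (\<omega> W) Xs"
proof -
  interpret anchored_connection "tangent S W" "S W" fmult "\<lambda>X. L W X W" "deriv_along W" "lie_via L W"
    by (rule anchored) (use assms in auto)
  have "Xs \<in> tuples (Suc k)" using assms by (simp add: tuples_def)
  from cartan_d_explicit[OF assms(4) this] show ?thesis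
    using assms(1,2,5,6) by (simp add: twisted_d_def deriv_along_def power_minus_one_fmult)
qed

text \<open>Stated for a single open set \<open>W\<close>, so that it can be applied to forms of which only the values over
  \<open>W\<close> are under consideration.\<close>

lemma twisted_d_aform:
  assumes "open W" "W \<subseteq> V" "V \<subseteq> U" "form_module.aform (tangent S W) (S W) fmult k (\<omega> W)"
  shows "form_module.aform (tangent S W) (S W) fmult (Suc k) (twisted_d S L D V k \<omega> W)"
proof -
  interpret anchored_connection "tangent S W" "S W" fmult "\<lambda>X. L W X W" "deriv_along W" "lie_via L W"
    by (rule anchored) (use assms in auto)
  show ?thesis
    by (rule aform_cong[OF aform_cartan_d[OF assms(4)]])
      (simp add: twisted_d_eq_cartan[where \<omega> = \<omega>, OF assms] tuples_def)
qed

lemma twisted_d_vres: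
  assumes V: "open V" "V \<subseteq> U" and \<omega>: "\<omega> \<in> vforms S V k"
    and W: "open W" "W \<subseteq> V" "open W'" "W' \<subseteq> W" and Xs: "length Xs = Suc k" "set Xs \<subseteq> tangent S W"
  shows "twisted_d S L D V k \<omega> W' (map (vres W') Xs) = vres W' (twisted_d S L D V k \<omega> W Xs)"
proof -
  interpret form_module "tangent S W" "S W" fmult by (rule form_module_tangent) fact
  have WU: "W \<subseteq> U" using W V by auto
  have \<omega>W: "aform k (\<omega> W)" by (rule vforms_aform[OF \<omega> W(1,2)])
  have nat: "\<omega> W' (map (vres W') Ys) = vres W' (\<omega> W Ys)" if "Ys \<in> tuples k" for Ys
    using vforms_vres[OF \<omega> W] that by (simp add: tuples_def)
  have XsT: "Xs \<in> tuples (Suc k)" using Xs by (simp add: tuples_def)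
  have nth: "Xs ! i \<in> tangent S W" if "i \<le> k" for i using Xs that by auto
  have om: "omit i Ys \<in> tuples j" if "Ys \<in> tuples (Suc j)" "i \<le> j" for i j Ys
    using that set_omit_subset[of i Ys] length_omit[of i Ys] by (auto simp: tuples_def)
  have 1: "D W' (L W' (map (vres W') Xs ! i)) (\<omega> W' (omit i (map (vres W') Xs)))
      = vres W' (D W (L W (Xs ! i)) (\<omega> W (omit i Xs)))" if "i \<le> k" for i
  proof -
    note o = om[OF XsT that]
    have "D W' (L W' (map (vres W') Xs ! i)) (\<omega> W' (omit i (map (vres W') Xs)))
        = D W' (vres W' (L W (Xs ! i))) (vres W' (\<omega> W (omit i Xs)))"
      using L_vres[OF W(1) WU W(3,4) nth[OF that]] nat[OF o] Xs that by (simp add: map_omit)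
    then show ?thesis
      using D_facts(2)[OF W(1) WU L_in[OF W(1) WU nth[OF that]] aform_in[OF \<omega>W o] W(3,4)] by simp
  qed
  have 2: "\<omega> W' (lie_via L W' (map (vres W') Xs ! i) (map (vres W') Xs ! j) # omit i (omit j (map (vres W') Xs)))
      = vres W' (\<omega> W (lie_via L W (Xs ! i) (Xs ! j) # omit i (omit j Xs)))" if ij: "i < j" "j \<le> k" for i j
  proof -
    from ij obtain k' where k: "k = Suc k'" by (cases k) auto
    interpret A: anchored_connection "tangent S W" "S W" fmult "\<lambda>X. L W X W" "deriv_along W" "lie_via L W"
      by (rule anchored[OF W(1) WU])
    have "omit i (omit j Xs) \<in> tuples k'" using om[OF om[OF XsT, unfolded k], of j i] ij k by simp
    then have "lie_via L W (Xs ! i) (Xs ! j) # omit i (omit j Xs) \<in> tuples k"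
      using A.b_in nth ij k by simp
    from nat[OF this] show ?thesis
      using lie_via_vres[OF W(1) WU W(3,4) nth nth] ij Xs by (simp add: map_omit)
  qed
  have "set (map (vres W') Xs) \<subseteq> tangent S W'"
    using Xs tangent_vres[OF W(4)] by auto
  then show ?thesis
    using W Xs 1 2 by (simp add: twisted_d_def vres_add vres_sum vres_fmult)
qed

text \<open>For constants \<open>c\<close>, linearity is the Leibniz rule with a vanishing derivative term.\<close>

theorem twisted_d_degree_one: "degree_one_morphism S U (twisted_d S L D)"
  unfolding degree_one_morphism_def
proof (intro allI impI ballI conjI)
  fix V k \<omega> assume "open V \<and> V \<subseteq> U" and \<omega>: "\<omega> \<in> vforms S V k"
  then have V: "open V" "V \<subseteq> U" by auto
  have form: "form_module.aform (tangent S W) (S W) fmult k (\<omega> W)"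
    if "open W" "W \<subseteq> V" "\<omega> \<in> vforms S V k" for W \<omega>
    by (rule vforms_aform[OF that(3,1,2)])
  show "twisted_d S L D V k \<omega> \<in> vforms S V (Suc k)"
    unfolding vforms_iff_aform
    using twisted_d_aform[where V = V] twisted_d_vres[OF V \<omega>] form[OF _ _ \<omega>] V by (auto simp: twisted_d_def)
  show "twisted_d S L D V k (\<omega> + \<eta>) = twisted_d S L D V k \<omega> + twisted_d S L D V k \<eta>"
    if \<eta>: "\<eta> \<in> vforms S V k" for \<eta>
  proof -
    have "twisted_d S L D V k (\<omega> + \<eta>) W Xs = (twisted_d S L D V k \<omega> + twisted_d S L D V k \<eta>) W Xs" for W Xs
    proof (cases "open W \<and> W \<subseteq> V \<and> length Xs = Suc k \<and> set Xs \<subseteq> tangent S W")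
      case True
      then interpret anchored_connection "tangent S W" "S W" fmult "\<lambda>X. L W X W" "deriv_along W" "lie_via L W"
        by (intro anchored) (use V in auto)
      have W: "open W" "W \<subseteq> V" and Xs: "length Xs = Suc k" "set Xs \<subseteq> tangent S W" and XsT: "Xs \<in> tuples (Suc k)"
        using True by (auto simp: tuples_def)
      have sum: "(\<omega> + \<eta>) W = (\<lambda>Xs. \<omega> W Xs + \<eta> W Xs)" by auto
      show ?thesis
        using cartan_d_add[OF form[OF W \<omega>] form[OF W \<eta>] XsT]
          twisted_d_eq_cartan[where \<omega> = \<omega>, OF W V(2) form[OF W \<omega>] Xs] twisted_d_eq_cartan[where \<omega> = \<eta>, OF W V(2) form[OF W \<eta>] Xs]
          twisted_d_eq_cartan[where \<omega> = "\<omega> + \<eta>", OF W V(2) _ Xs, unfolded sum] aform_add[OF form[OF W \<omega>] form[OF W \<eta>]]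
        by simp
    qed (auto simp: twisted_d_def)
    then show ?thesis by blast
  qed
  show "twisted_d S L D V k (\<lambda>W Xs. (\<lambda>_. c) \<cdot> \<omega> W Xs) = (\<lambda>W Xs. (\<lambda>_. c) \<cdot> twisted_d S L D V k \<omega> W Xs)" for c
  proof -
    have "twisted_d S L D V k (\<lambda>W Xs. (\<lambda>_. c) \<cdot> \<omega> W Xs) W Xs = (\<lambda>_. c) \<cdot> twisted_d S L D V k \<omega> W Xs" for W Xs
    proof (cases "open W \<and> W \<subseteq> V \<and> length Xs = Suc k \<and> set Xs \<subseteq> tangent S W")
      case True
      then interpret anchored_connection "tangent S W" "S W" fmult "\<lambda>X. L W X W" "deriv_along W" "lie_via L W"
        by (intro anchored) (use V in auto)
      have W: "open W" "W \<subseteq> V" "W \<subseteq> U" and Xs: "length Xs = Suc k" "set Xs \<subseteq> tangent S W" and XsT: "Xs \<in> tuples (Suc k)"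
        using True V by (auto simp: tuples_def)
      let ?c = "res W (\<lambda>_. c)"
      have c: "?c \<in> S W" by (rule sec_const[OF W(1)])
      note \<omega>W = form[OF W(1,2) \<omega>]
      have c\<omega>: "?c \<cdot> \<omega> W Ys = (\<lambda>_. c) \<cdot> \<omega> W Ys" if "Ys \<in> tuples k" for Ys
        using fmult_const[OF aform_in[OF \<omega>W that], of c] by simp
      have form_c: "aform k (\<lambda>Xs. (\<lambda>_. c) \<cdot> \<omega> W Xs)"
        by (rule aform_cong[OF aform_smul[OF c \<omega>W] c\<omega>])
      \<comment> \<open>the constant section has vanishing differential, so the Leibniz term drops out\<close>
      have wedge: "wedge_d (\<lambda>X. L W X W) fmult ?c \<eta> Ys = 0" if "set Ys \<subseteq> tangent S W" for \<eta> Ys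
        using that
        by (induction Ys arbitrary: \<eta>) (simp_all add: tan_const[OF W(1)] L_in[OF W(1,3)], simp add: fmult_def fun_eq_iff)
      have "twisted_d S L D V k (\<lambda>W Xs. (\<lambda>_. c) \<cdot> \<omega> W Xs) W Xs = d (\<lambda>Xs. (\<lambda>_. c) \<cdot> \<omega> W Xs) Xs"
        by (rule twisted_d_eq_cartan[where \<omega> = "\<lambda>W Xs. (\<lambda>_. c) \<cdot> \<omega> W Xs", OF W(1,2) V(2) form_c Xs])
      also have "\<dots> = d (\<lambda>Xs. ?c \<cdot> \<omega> W Xs) Xs"
        by (rule cartan_d_cong[OF XsT]) (simp add: c\<omega>)
      also have "\<dots> = ?c \<cdot> d (\<omega> W) Xs"
        using cartan_d_smul[OF c \<omega>W XsT] wedge[OF Xs(2)] by simp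
      also have "\<dots> = (\<lambda>_. c) \<cdot> d (\<omega> W) Xs"
        using fmult_const[OF cartan_d_in[OF \<omega>W XsT], of c] by simp
      finally show ?thesis using twisted_d_eq_cartan[where \<omega> = \<omega>, OF W(1,2) V(2) \<omega>W Xs] by simp
    qed (auto simp: twisted_d_def fmult_def fun_eq_iff)
    then show ?thesis by blast
  qed
  show "twisted_d S L D V' k (form_res V' \<omega>) = form_res V' (twisted_d S L D V k \<omega>)"
    if "open V' \<and> V' \<subseteq> V" for V'
  proof -
    have "twisted_d S L D V' k (form_res V' \<omega>) W Xs = form_res V' (twisted_d S L D V k \<omega>) W Xs" for W Xs
      using that by (auto simp: twisted_d_def form_res_def)
    then show ?thesis by blast
  qed
qed

lemma twisted_d_twisted_d_eq_cartan:
  assumes "twisted_connection S U L' D'"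
    and W: "open W" "W \<subseteq> V" "V \<subseteq> U" and \<omega>: "form_module.aform (tangent S W) (S W) fmult k (\<omega> W)"
    and Xs: "length Xs = Suc (Suc k)" "set Xs \<subseteq> tangent S W"
  shows "twisted_d S L D V (Suc k) (twisted_d S L' D' V k \<omega>) W Xs
    = cartan_d (deriv_along W) (lie_via L W) (cartan_d (twisted_connection.deriv_along L' D' W) (lie_via L' W) (\<omega> W)) Xs"
proof -
  interpret B: twisted_connection S U L' D' by fact
  interpret anchored_connection "tangent S W" "S W" fmult "\<lambda>X. L W X W" "deriv_along W" "lie_via L W"
    by (rule anchored) (use W in auto)
  have XsT: "Xs \<in> tuples (Suc (Suc k))" using Xs by (simp add: tuples_def)
  show ?thesis
    unfolding twisted_d_eq_cartan[where \<omega> = "twisted_d S L' D' V k \<omega>", OF W B.twisted_d_aform[where \<omega> = \<omega>, OF W \<omega>] Xs]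
    by (rule cartan_d_cong[OF XsT]) (simp add: B.twisted_d_eq_cartan[where \<omega> = \<omega>, OF W \<omega>] tuples_def)
qed

end


section \<open>Bi-flat F-manifolds\<close>

lemma fmult_add_right: "f \<cdot> (X + Y) = f \<cdot> X + f \<cdot> Y" for f :: "'m \<Rightarrow> 'k::comm_ring"
  by (auto simp: fmult_def fun_eq_iff distrib_left)

lemma fmult_add_left: "(f + g) \<cdot> X = f \<cdot> X + g \<cdot> X" for f :: "'m \<Rightarrow> 'k::comm_ring"
  by (auto simp: fmult_def fun_eq_iff distrib_right)

lemma anchored_connection_sum:
  fixes R :: "('m \<Rightarrow> 'k::comm_ring) set"
  assumes "anchored_connection T R fmult a P b" "anchored_connection T R fmult a' P' b'"
    and R: "\<And>f g. f \<in> R \<Longrightarrow> g \<in> R \<Longrightarrow> f + g \<in> R"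
  shows "anchored_connection T R fmult (\<lambda>X f. a X f + a' X f) (\<lambda>X Y. P X Y + P' X Y) (\<lambda>X Y. b X Y + b' X Y)"
proof -
  interpret A: anchored_connection T R fmult a P b by fact
  interpret B: anchored_connection T R fmult a' P' b' by fact
  show ?thesis
  proof
    fix X Y assume X: "X \<in> T" and Y: "Y \<in> T"
    show "P X Y + P' X Y \<in> T" "b X Y + b' X Y \<in> T" "b X X + b' X X = 0"
      using X Y by (simp_all add: A.add_in A.P_in B.P_in A.b_in B.b_in A.b_self B.b_self)
    show "a X f + a' X f \<in> R" if "f \<in> R" for f
      using R A.anchor_in[OF X that] B.anchor_in[OF X that] by simp
    show "P (X + Y) Z + P' (X + Y) Z = P X Z + P' X Z + (P Y Z + P' Y Z)"
      "P X (Y + Z) + P' X (Y + Z) = P X Y + P' X Y + (P X Z + P' X Z)"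
      "b (X + Y) Z + b' (X + Y) Z = b X Z + b' X Z + (b Y Z + b' Y Z)"
      "b X (Y + Z) + b' X (Y + Z) = b X Y + b' X Y + (b X Z + b' X Z)" if Z: "Z \<in> T" for Z
      unfolding A.P_add_left[OF X Y Z] B.P_add_left[OF X Y Z] A.P_add_right[OF X Y Z] B.P_add_right[OF X Y Z]
        A.b_add_left[OF X Y Z] B.b_add_left[OF X Y Z] A.b_add_right[OF X Y Z] B.b_add_right[OF X Y Z]
      by (simp_all only: ac_simps)
    fix f assume f: "f \<in> R"
    show "P (f \<cdot> X) Y + P' (f \<cdot> X) Y = f \<cdot> (P X Y + P' X Y)"
      unfolding A.P_smul_left[OF f X Y] B.P_smul_left[OF f X Y] by (rule fmult_add_right[symmetric])
    show "P X (f \<cdot> Y) + P' X (f \<cdot> Y) = (a X f + a' X f) \<cdot> Y + f \<cdot> (P X Y + P' X Y)"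
      unfolding A.P_smul_right[OF f X Y] B.P_smul_right[OF f X Y] fmult_add_right fmult_add_left
      by (simp only: ac_simps)
    show "b X (f \<cdot> Y) + b' X (f \<cdot> Y) = (a X f + a' X f) \<cdot> Y + f \<cdot> (b X Y + b' X Y)"
      unfolding A.b_smul_right[OF f X Y] B.b_smul_right[OF f X Y] fmult_add_right fmult_add_left
      by (simp only: ac_simps)
  qed
qed

context function_sheaf
begin

lemma sheaf_op2_in:
  "sheaf_op2 S B m \<Longrightarrow> open V \<Longrightarrow> V \<subseteq> B \<Longrightarrow> X \<in> tangent S V \<Longrightarrow> Y \<in> tangent S V \<Longrightarrow> m V X Y \<in> tangent S V"
  unfolding sheaf_op2_def by simp

lemma sheaf_op2_vres:
  "sheaf_op2 S B m \<Longrightarrow> open V \<Longrightarrow> V \<subseteq> B \<Longrightarrow> X \<in> tangent S V \<Longrightarrow> Y \<in> tangent S V \<Longrightarrow> open V' \<Longrightarrow> V' \<subseteq> V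
    \<Longrightarrow> m V' (vres V' X) (vres V' Y) = vres V' (m V X Y)"
  unfolding sheaf_op2_def by simp

lemma F_manifoldD:
  assumes F: "F_manifold S B m e" and V: "open V" "V \<subseteq> B"
    and X: "X \<in> tangent S V" and Y: "Y \<in> tangent S V" and Z: "Z \<in> tangent S V"
  shows "m V (X + Y) Z = m V X Z + m V Y Z" and "f \<in> S V \<Longrightarrow> m V (f \<cdot> X) Y = f \<cdot> m V X Y"
    and "m V X Y = m V Y X" and "m V (m V X Y) Z = m V X (m V Y Z)" and "m V (vres V e) X = X"
    and "W \<in> tangent S V \<Longrightarrow> lie (m V X Y) (m V W Z) - m V (lie (m V X Y) Z) W - m V (lie (m V X Y) W) Z
          - m V X (lie Y (m V Z W)) + m V X (m V (lie Y Z) W) + m V X (m V (lie Y W) Z)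
          - m V Y (lie X (m V Z W)) + m V Y (m V (lie X Z) W) + m V Y (m V (lie X W) Z) = 0"
proof -
  note F' = F[unfolded F_manifold_def, THEN conjunct2, THEN conjunct2, THEN spec, THEN mp, OF conjI[OF V]]
  note prod = F'[THEN conjunct1, THEN bspec, OF X, THEN bspec, OF Y, THEN bspec, OF Z]
  note hm = F'[THEN conjunct2, THEN conjunct2, THEN bspec, OF X, THEN bspec, OF Y, THEN bspec, OF Z]
  show "m V (X + Y) Z = m V X Z + m V Y Z" "m V X Y = m V Y X" "m V (m V X Y) Z = m V X (m V Y Z)"
    using prod by blast+
  show "f \<in> S V \<Longrightarrow> m V (f \<cdot> X) Y = f \<cdot> m V X Y" using prod by blast
  show "m V (vres V e) X = X" using F' X by blast
  show "W \<in> tangent S V \<Longrightarrow> lie (m V X Y) (m V W Z) - m V (lie (m V X Y) Z) W - m V (lie (m V X Y) W) Z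
          - m V X (lie Y (m V Z W)) + m V X (m V (lie Y Z) W) + m V X (m V (lie Y W) Z)
          - m V Y (lie X (m V Z W)) + m V Y (m V (lie X Z) W) + m V Y (m V (lie X W) Z) = 0"
    using hm by (rule bspec)
qed

lemma flat_torsionlessD:
  assumes "flat_torsionless S B D" "open V" "V \<subseteq> B" "X \<in> tangent S V" "Y \<in> tangent S V"
  shows "Z \<in> tangent S V \<Longrightarrow> D V X (D V Y Z) - D V Y (D V X Z) - D V (lie X Y) Z = 0"
    and "D V X Y - D V Y X - lie X Y = 0"
  using assms unfolding flat_torsionless_def by blast+

lemma twisted_connection_id:
  assumes "connection S B D"
  shows "twisted_connection S B (\<lambda>V X. X) D"
  using assms by unfold_locales simp_all

text \<open>The first two identities are the flatness and vanishing torsion of the pencil at the parameter \<open>0\<close>.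
  The curvature at the parameter \<open>1\<close> then yields the third one, because the quadratic terms cancel by
  commutativity and associativity of the product.\<close>

lemma flat_F_manifoldD:
  assumes flat: "flat_F_manifold S B D m e" and V: "open V" "V \<subseteq> B"
    and X: "X \<in> tangent S V" and Y: "Y \<in> tangent S V" and Z: "Z \<in> tangent S V"
  shows "D V (lie X Y) Z = D V X (D V Y Z) - D V Y (D V X Z)"
    and "D V X Y - D V Y X = lie X Y"
    and "m V (lie X Y) Z = D V X (m V Y Z) - m V Y (D V X Z) - D V Y (m V X Z) + m V X (D V Y Z)"
    and "D V X (vres V e) = 0"
proof -
  have F: "F_manifold S B m e" and conn: "connection S B D"
    and pencil: "\<And>c. flat_torsionless S B (\<lambda>V X Y. D V X Y - (\<lambda>_. c) \<cdot> m V X Y)"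
    and unit: "\<And>V X. open V \<Longrightarrow> V \<subseteq> B \<Longrightarrow> X \<in> tangent S V \<Longrightarrow> D V X (vres V e) = 0"
    using flat unfolding flat_F_manifold_def by blast+
  show "D V X (vres V e) = 0" by (rule unit[OF V X])
  interpret D: twisted_connection S B "\<lambda>V X. X" D by (rule twisted_connection_id[OF conn])
  interpret A: anchored_connection "tangent S V" "S V" fmult "\<lambda>X. X V" "D.deriv_along V" "lie_via (\<lambda>V X. X) V"
    by (rule D.anchored[OF V])
  have deriv_along: "D.deriv_along V = D V" by (simp add: D.deriv_along_def fun_eq_iff)
  have c0: "(\<lambda>_. 0 :: 'k) \<cdot> X = 0" and c1: "(\<lambda>_. 1 :: 'k) \<cdot> X = X" for X :: "('m, 'k) vfield"
    by (auto simp: fmult_def fun_eq_iff)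
  have m_in: "m V X Y \<in> tangent S V" if "X \<in> tangent S V" "Y \<in> tangent S V" for X Y
    by (rule sheaf_op2_in[OF F[unfolded F_manifold_def, THEN conjunct1] V that])
  note D_in = A.P_in[unfolded deriv_along] and D_diff = A.P_diff[unfolded deriv_along]
  have m_diff: "m V X (Y - Z) = m V X Y - m V X Z"
    if X: "X \<in> tangent S V" and Y: "Y \<in> tangent S V" and Z: "Z \<in> tangent S V" for X Y Z
  proof -
    have "m V (Y - Z + Z) X = m V (Y - Z) X + m V Z X"
      by (rule F_manifoldD(1)[OF F V A.diff_in[OF Y Z] Z X])
    then show ?thesis
      using F_manifoldD(3)[OF F V X A.diff_in[OF Y Z] Z] F_manifoldD(3)[OF F V X Y Z] F_manifoldD(3)[OF F V X Z Y]
      by simp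
  qed
  show f0: "D V (lie X Y) Z = D V X (D V Y Z) - D V Y (D V X Z)"
    using flat_torsionlessD(1)[OF pencil[of 0] V X Y Z] unfolding c0 by simp
  show "D V X Y - D V Y X = lie X Y"
    using flat_torsionlessD(2)[OF pencil[of 0] V X Y] unfolding c0 by simp
  have XY: "lie X Y \<in> tangent S V" by (rule tangent_lie[OF X Y])
  have "D V X (D V Y Z - m V Y Z) - m V X (D V Y Z - m V Y Z) - (D V Y (D V X Z - m V X Z) - m V Y (D V X Z - m V X Z))
      - (D V (lie X Y) Z - m V (lie X Y) Z) = 0"
    using flat_torsionlessD(1)[OF pencil[of 1] V X Y Z] unfolding c1 .
  then have zero: "D V X (D V Y Z) - D V X (m V Y Z) - (m V X (D V Y Z) - m V X (m V Y Z))
      - (D V Y (D V X Z) - D V Y (m V X Z) - (m V Y (D V X Z) - m V Y (m V X Z)))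
      - (D V (lie X Y) Z - m V (lie X Y) Z) = 0"
    using X Y Z by (simp only: D_diff m_diff D_in m_in)
  have swap: "m V X (m V Y Z) = m V Y (m V X Z)"
    using F_manifoldD(4)[OF F V X Y Z] F_manifoldD(4)[OF F V Y X Z] F_manifoldD(3)[OF F V X Y Z] by simp
  have cancel: "h = p - g - q + c"
    if "u - p - (c - w) - (v - q - (g - w)) - (u - v - h) = 0" for u p c w v q g h :: "('m, 'k) vfield"
  proof -
    have "u - p - (c - w) - (v - q - (g - w)) - (u - v - h) = h - (p - g - q + c)"
      by (simp only: algebra_simps)
    with that show ?thesis by simp
  qed
  show "m V (lie X Y) Z = D V X (m V Y Z) - m V Y (D V X Z) - D V Y (m V X Z) + m V X (D V Y Z)"
    by (rule cancel) (rule zero[unfolded f0 swap])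
qed

end

locale bi_flat_manifold = function_sheaf S
  for S :: "'m::topological_space set \<Rightarrow> ('m \<Rightarrow> 'k::field) set" +
  fixes nabla nabla' mult mult' :: "('m, 'k) vop2" and e E :: "('m, 'k) vfield" and U :: "'m set"
  assumes bi_flat: "bi_flat_F_manifold S nabla mult e U nabla' mult' E"
begin

lemmas bi_flatD = bi_flat[unfolded bi_flat_F_manifold_def]

lemmas flat = bi_flatD[THEN conjunct1]
  and Euler = bi_flatD[THEN conjunct2, THEN conjunct1]
  and invertible = bi_flatD[THEN conjunct2, THEN conjunct2, THEN conjunct2, THEN conjunct2, THEN conjunct1]
  and flat' = bi_flatD[THEN conjunct2, THEN conjunct2, THEN conjunct2, THEN conjunct2, THEN conjunct2, THEN conjunct2, THEN conjunct1]
  and compat = bi_flatD[THEN conjunct2, THEN conjunct2, THEN conjunct2, THEN conjunct2, THEN conjunct2, THEN conjunct2, THEN conjunct2]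

lemmas F = flat[unfolded flat_F_manifold_def, THEN conjunct1]
  and conn = flat[unfolded flat_F_manifold_def, THEN conjunct2, THEN conjunct1]
  and conn' = flat'[unfolded flat_F_manifold_def, THEN conjunct2, THEN conjunct1]

lemmas mult_sheaf = F[unfolded F_manifold_def, THEN conjunct1]
  and e_tangent = F[unfolded F_manifold_def, THEN conjunct2, THEN conjunct1]

lemma E_tangent: "E \<in> tangent S UNIV"
  using Euler unfolding Euler_field_def by (rule conjunct1)

lemma mult_by_cancel:
  assumes "open V" "V \<subseteq> U" "X \<in> tangent S V" "Y \<in> tangent S V" "mult V (vres V E) X = mult V (vres V E) Y"
  shows "X = Y"
proof -
  have "bij_betw (mult_by mult E V) (tangent S V) (tangent S V)"
    using invertible assms(1,2) by simp
  then show ?thesis using assms(3-5) by (metis bij_betw_imp_inj_on inj_onD mult_by_def)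
qed

sublocale A: twisted_connection S U "\<lambda>V X. X" nabla
proof (rule twisted_connection_id)
  show "connection S U nabla" using conn by (simp add: connection_def sheaf_op2_def)
qed

sublocale B: twisted_connection S U "mult_by mult E" nabla'
proof (unfold_locales, rule conn')
  fix V X assume V: "open V" "V \<subseteq> U" and X: "X \<in> tangent S V"
  have E: "vres V E \<in> tangent S V" by (rule tangent_vres[OF subset_UNIV E_tangent])
  note prod = F_manifoldD[OF F V(1) subset_UNIV]
  note m_in = sheaf_op2_in[OF mult_sheaf V(1) subset_UNIV]
  show "mult_by mult E V X \<in> tangent S V" unfolding mult_by_def by (rule m_in[OF E X])
  show "mult_by mult E V (X + Y) = mult_by mult E V X + mult_by mult E V Y" if Y: "Y \<in> tangent S V" for Y
    unfolding mult_by_def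
    using prod(1)[OF X Y E] prod(3)[OF tangent_add[OF X Y] E E] prod(3)[OF X E E] prod(3)[OF Y E E] by simp
  show "mult_by mult E V (f \<cdot> X) = f \<cdot> mult_by mult E V X" if f: "f \<in> S V" for f
    unfolding mult_by_def
    using prod(2)[OF X E E f] prod(3)[OF tangent_fmult[OF V(1) f X] E E] prod(3)[OF X E E] by simp
  show "mult_by mult E V' (vres V' X) = vres V' (mult_by mult E V X)" if "open V'" "V' \<subseteq> V" for V'
    unfolding mult_by_def
    using sheaf_op2_vres[OF mult_sheaf V(1) subset_UNIV E X that] by (simp only: vres_vres[OF that(2)])
qed

lemma bi_flat_algebra_tangent:
  assumes V: "open V" "V \<subseteq> U"
  shows "bi_flat_algebra (tangent S V) lie (mult V) (nabla V) (nabla' V) (vres V e) (vres V E)"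
proof -
  interpret form_module "tangent S V" "S V" fmult by (rule form_module_tangent[OF V(1)])
  have E: "vres V E \<in> tangent S V" by (rule tangent_vres[OF subset_UNIV E_tangent])
  have e: "vres V e \<in> tangent S V" by (rule tangent_vres[OF subset_UNIV e_tangent])
  note prod = F_manifoldD[OF F V(1) subset_UNIV]
  note D = A.D_facts[OF V] and D' = B.D_facts[OF V]
  note flatD = flat_F_manifoldD[OF flat V(1) subset_UNIV] and flatD' = flat_F_manifoldD[OF flat' V]
  show ?thesis
  proof
    show "0 \<in> tangent S V" by (rule zero_in)
    show "vres V e \<in> tangent S V" "vres V E \<in> tangent S V" by fact+
    fix X assume X: "X \<in> tangent S V"
    show "- X \<in> tangent S V" by (rule uminus_in[OF X])
    show "lie X X = 0" by (rule lie_self)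
    show "mult V (vres V e) X = X" by (rule prod(5)[OF X X X])
    show "nabla' V X (vres V E) = 0"
      using flatD'(4)[OF X X X] by (simp only: vres_vres[OF V(2)])
    fix Y assume Y: "Y \<in> tangent S V"
    show "X + Y \<in> tangent S V" by (rule add_in[OF X Y])
    show "lie X Y \<in> tangent S V" by (rule tangent_lie[OF X Y])
    show "lie Y X = - lie X Y" by (rule lie_anti)
    show "mult V X Y \<in> tangent S V" by (rule sheaf_op2_in[OF mult_sheaf V(1) subset_UNIV X Y])
    show "mult V X Y = mult V Y X" by (rule prod(3)[OF X Y Y])
    show "lie (vres V E) (mult V X Y) - mult V (lie (vres V E) X) Y - mult V X (lie (vres V E) Y) = mult V X Y"
      using Euler V(1) X Y unfolding Euler_field_def by simp
    show "mult V (vres V E) X = mult V (vres V E) Y \<Longrightarrow> X = Y" by (rule mult_by_cancel[OF V X Y])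
    show "nabla V X Y \<in> tangent S V" "nabla' V X Y \<in> tangent S V" by (rule D(1)[OF X Y] D'(1)[OF X Y])+
    show "nabla V X Y - nabla V Y X = lie X Y" by (rule flatD(2)[OF X Y Y])
    fix Z assume Z: "Z \<in> tangent S V"
    show "lie X (Y + Z) = lie X Y + lie X Z" by (rule lie_add[OF X Y Z])
    show "lie (lie X Y) Z = lie X (lie Y Z) - lie Y (lie X Z)" by (rule lie_jacobi[OF X Y Z])
    show "mult V (X + Y) Z = mult V X Z + mult V Y Z" by (rule prod(1)[OF X Y Z])
    show "mult V (mult V X Y) Z = mult V X (mult V Y Z)" by (rule prod(4)[OF X Y Z])
    show "nabla V (X + Y) Z = nabla V X Z + nabla V Y Z" by (rule D(3)[OF X Y Z])
    show "nabla V X (Y + Z) = nabla V X Y + nabla V X Z" by (rule D(4)[OF Y Z X])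
    show "nabla' V X (Y + Z) = nabla' V X Y + nabla' V X Z" by (rule D'(4)[OF Y Z X])
    show "nabla V (lie X Y) Z = nabla V X (nabla V Y Z) - nabla V Y (nabla V X Z)" by (rule flatD(1)[OF X Y Z])
    show "nabla' V (lie X Y) Z = nabla' V X (nabla' V Y Z) - nabla' V Y (nabla' V X Z)" by (rule flatD'(1)[OF X Y Z])
    show "mult V (lie X Y) Z = nabla V X (mult V Y Z) - mult V Y (nabla V X Z) - nabla V Y (mult V X Z) + mult V X (nabla V Y Z)"
      by (rule flatD(3)[OF X Y Z])
    show "nabla V Y (mult V X Z) - nabla V Z (mult V X Y) = nabla' V Y (mult V X Z) - nabla' V Z (mult V X Y)"
      by (rule compat[THEN spec, THEN mp, OF conjI[OF V], THEN bspec, OF X, THEN bspec, OF Y, THEN bspec, OF Z])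
    fix W assume W: "W \<in> tangent S V"
    show "lie (mult V X Y) (mult V W Z) - mult V (lie (mult V X Y) Z) W - mult V (lie (mult V X Y) W) Z
      - mult V X (lie Y (mult V Z W)) + mult V X (mult V (lie Y Z) W) + mult V X (mult V (lie Y W) Z)
      - mult V Y (lie X (mult V Z W)) + mult V Y (mult V (lie X Z) W) + mult V Y (mult V (lie X W) Z) = 0"
      by (rule prod(6)[OF X Y Z W])
  qed
qed

text \<open>For the second pair the identity \<open>nijenhuis\<close> turns flatness along the deformed bracket into flatness of
  \<open>\<nabla>'\<close> along \<open>E \<circ> X\<close> and \<open>E \<circ> Y\<close>; the third pair adds the two mixed identities to the first two
  pairs.\<close>

lemma flat_anchored:
  assumes V: "open V" "V \<subseteq> U"
  shows flat_id: "flat_anchored_connection (tangent S V) (S V) fmult (\<lambda>X. X V) (A.deriv_along V) (lie_via (\<lambda>V X. X) V)"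
    and flat_E: "flat_anchored_connection (tangent S V) (S V) fmult (\<lambda>X. mult_by mult E V X V)
      (B.deriv_along V) (lie_via (mult_by mult E) V)"
    and flat_sum: "flat_anchored_connection (tangent S V) (S V) fmult (\<lambda>X f. X V f + mult_by mult E V X V f)
      (\<lambda>X Y. A.deriv_along V X Y + B.deriv_along V X Y) (\<lambda>X Y. lie_via (\<lambda>V X. X) V X Y + lie_via (mult_by mult E) V X Y)"
proof -
  interpret G: bi_flat_algebra "tangent S V" lie "mult V" "nabla V" "nabla' V" "vres V e" "vres V E"
    by (rule bi_flat_algebra_tangent[OF V])
  have via: "lie_via (\<lambda>V X. X) V = lie"
    by (simp add: lie_via_def fun_eq_iff)
  have viaE: "lie_via (mult_by mult E) V = G.brE"
    unfolding lie_via_def mult_by_def G.brE_def by (rule refl)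
  have deriv_along: "A.deriv_along V = nabla V" by (simp add: A.deriv_along_def fun_eq_iff)
  have dirE: "B.deriv_along V X Y = nabla' V (mult V (vres V E) X) Y" for X Y
    by (simp add: B.deriv_along_def mult_by_def)
  interpret A': anchored_connection "tangent S V" "S V" fmult "\<lambda>X. X V" "A.deriv_along V" "lie_via (\<lambda>V X. X) V"
    by (rule A.anchored[OF V])
  interpret B': anchored_connection "tangent S V" "S V" fmult "\<lambda>X. mult_by mult E V X V" "B.deriv_along V" "lie_via (mult_by mult E) V"
    by (rule B.anchored[OF V])
  interpret C': anchored_connection "tangent S V" "S V" fmult "\<lambda>X f. X V f + mult_by mult E V X V f"
    "\<lambda>X Y. A.deriv_along V X Y + B.deriv_along V X Y" "\<lambda>X Y. lie_via (\<lambda>V X. X) V X Y + lie_via (mult_by mult E) V X Y"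
    by (rule anchored_connection_sum[OF A.anchored[OF V] B.anchored[OF V]]) (rule sec_add[OF V(1)])
  show A: "flat_anchored_connection (tangent S V) (S V) fmult (\<lambda>X. X V) (A.deriv_along V) (lie_via (\<lambda>V X. X) V)"
    by unfold_locales (simp_all only: via deriv_along G.jacobi G.D_flat)
  show B: "flat_anchored_connection (tangent S V) (S V) fmult (\<lambda>X. mult_by mult E V X V)
      (B.deriv_along V) (lie_via (mult_by mult E) V)"
  proof
    fix X Y Z assume X: "X \<in> tangent S V" and Y: "Y \<in> tangent S V" and Z: "Z \<in> tangent S V"
    show "lie_via (mult_by mult E) V (lie_via (mult_by mult E) V X Y) Z
      = lie_via (mult_by mult E) V X (lie_via (mult_by mult E) V Y Z) - lie_via (mult_by mult E) V Y (lie_via (mult_by mult E) V X Z)"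
      unfolding viaE by (rule G.brE_jacobi[OF X Y Z])
    show "B.deriv_along V (lie_via (mult_by mult E) V X Y) Z = B.deriv_along V X (B.deriv_along V Y Z) - B.deriv_along V Y (B.deriv_along V X Z)"
      unfolding dirE viaE G.nijenhuis[OF X Y, symmetric]
      by (rule G.D'_flat[OF G.m_in[OF G.E_in X] G.m_in[OF G.E_in Y] Z])
  qed
  interpret A'': flat_anchored_connection "tangent S V" "S V" fmult "\<lambda>X. X V" "A.deriv_along V" "lie_via (\<lambda>V X. X) V"
    by (rule A)
  interpret B'': flat_anchored_connection "tangent S V" "S V" fmult "\<lambda>X. mult_by mult E V X V" "B.deriv_along V" "lie_via (mult_by mult E) V"
    by (rule B)
  show "flat_anchored_connection (tangent S V) (S V) fmult (\<lambda>X f. X V f + mult_by mult E V X V f)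
      (\<lambda>X Y. A.deriv_along V X Y + B.deriv_along V X Y) (\<lambda>X Y. lie_via (\<lambda>V X. X) V X Y + lie_via (mult_by mult E) V X Y)"
  proof (unfold_locales, goal_cases)
    case (1 X Y Z)
    show ?case
      using 1 A''.jacobi[OF 1] B''.jacobi[OF 1] G.mixed_jacobi[OF 1]
      unfolding via viaE
      by (simp add: G.br_add G.br_add_left G.br_in G.brE_in B'.b_add_left[unfolded viaE] B'.b_add_right[unfolded viaE] algebra_simps)
  next
    case (2 X Y Z)
    show ?case
      using 2 A''.flat[OF 2] B''.flat[OF 2] G.mixed_flat[OF 2]
      unfolding via viaE deriv_along dirE
      by (simp add: G.D_add_left G.D_add G.D'_add G.br_in G.brE_in G.D_in G.D'_in G.m_in G.E_in
          B'.P_add_left[unfolded dirE] algebra_simps)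
  qed
qed

text \<open>On argument lists outside the domain of a form all compositions are zero by convention; on the
  domain they are compositions of the algebraic differentials.\<close>

theorem bicomplex: "differential_bicomplex S U (exterior_d S nabla) (twisted_d S (mult_by mult E) nabla')"
proof -
  let ?d = "twisted_d S (\<lambda>V X. X) nabla" and ?d' = "twisted_d S (mult_by mult E) nabla'"
  have main: "?d V (Suc k) (?d V k \<omega>) W Xs = 0 \<and> ?d' V (Suc k) (?d' V k \<omega>) W Xs = 0 \<and>
      ?d V (Suc k) (?d' V k \<omega>) W Xs + ?d' V (Suc k) (?d V k \<omega>) W Xs = 0"
    if V: "open V" "V \<subseteq> U" and \<omega>: "\<omega> \<in> vforms S V k" for V k \<omega> W Xs
  proof (cases "open W \<and> W \<subseteq> V \<and> length Xs = Suc (Suc k) \<and> set Xs \<subseteq> tangent S W")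
    case True
    then have W: "open W" "W \<subseteq> V" "W \<subseteq> U" and Xs: "length Xs = Suc (Suc k)" "set Xs \<subseteq> tangent S W"
      using V by auto
    note form = vforms_aform[OF \<omega> W(1,2)]
    interpret A': flat_anchored_connection "tangent S W" "S W" fmult "\<lambda>X. X W" "A.deriv_along W" "lie_via (\<lambda>V X. X) W"
      by (rule flat_id[OF W(1,3)])
    interpret B': flat_anchored_connection "tangent S W" "S W" fmult "\<lambda>X. mult_by mult E W X W" "B.deriv_along W" "lie_via (mult_by mult E) W"
      by (rule flat_E[OF W(1,3)])
    have XsT: "Xs \<in> A'.tuples (Suc (Suc k))" using Xs by (simp add: A'.tuples_def)
    note AA = A.twisted_d_twisted_d_eq_cartan[OF A.twisted_connection_axioms W(1,2) V(2), where \<omega> = \<omega>, OF form Xs]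
    note BB = B.twisted_d_twisted_d_eq_cartan[OF B.twisted_connection_axioms W(1,2) V(2), where \<omega> = \<omega>, OF form Xs]
    note AB = A.twisted_d_twisted_d_eq_cartan[OF B.twisted_connection_axioms W(1,2) V(2), where \<omega> = \<omega>, OF form Xs]
    note BA = B.twisted_d_twisted_d_eq_cartan[OF A.twisted_connection_axioms W(1,2) V(2), where \<omega> = \<omega>, OF form Xs]
    show ?thesis
      unfolding AA BB AB BA
      using A'.cartan_d_square[OF form XsT] B'.cartan_d_square[OF form XsT]
        A'.cartan_d_anticommute[OF flat_id[OF W(1,3)] flat_E[OF W(1,3)] flat_sum[OF W(1,3)] form XsT]
      by blast
  next
    case False
    have "twisted_d S L D V (Suc k) \<eta> W Xs = 0" for L D \<eta>
      unfolding twisted_d_def using False by (rule if_not_P)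
    then show ?thesis by simp
  qed
  show ?thesis
    unfolding differential_bicomplex_def exterior_d_def
  proof (intro conjI allI impI ballI)
    show "degree_one_morphism S U ?d" by (rule A.twisted_d_degree_one)
    show "degree_one_morphism S U ?d'" by (rule B.twisted_d_degree_one)
    fix V k \<omega> assume "open V \<and> V \<subseteq> U" and \<omega>: "\<omega> \<in> vforms S V k"
    then have V: "open V" "V \<subseteq> U" by auto
    note m = main[OF V \<omega>]
    show "?d V (Suc k) (?d V k \<omega>) = 0" "?d' V (Suc k) (?d' V k \<omega>) = 0"
      using m by (simp_all add: fun_eq_iff)
    show "?d V (Suc k) (?d' V k \<omega>) + ?d' V (Suc k) (?d V k \<omega>) = 0"
      using m by (simp add: fun_eq_iff)
  qed
qed

end

theorem theorem4p2:
  fixes r :: regularity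
    and A :: "('m::{second_countable_topology, t2_space}, 'k::{real_normed_field, banach}, 'n::finite) chart set"
    and nabla nabla' mult mult' :: "('m, 'k) vop2"
    and e E :: "('m, 'k) vfield"
    and U :: "'m set"
  defines "S \<equiv> structure_sheaf r A"
  assumes "manifold r A"
    and "bi_flat_F_manifold S nabla mult e U nabla' mult' E"
  shows "differential_bicomplex S U (exterior_d S nabla) (twisted_d S (mult_by mult E) nabla')"
proof -
  interpret bi_flat_manifold S nabla nabla' mult mult' e E U
    using structure_sheaf_is_function_sheaf[OF assms(2)] assms(3)
    by (simp add: bi_flat_manifold_def bi_flat_manifold_axioms_def S_def)
  show ?thesis by (rule bicomplex)
qed

end
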